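(* Let $d\ge1$, let $\kappa\in\mathbb{R}^{d+1}$ with $\kappa_i>-1$ for all $i$, and let $0\le n\le N$ be integers. For every $\alpha\in\mathbb{N}_0^{d+1}$ with $|\alpha|=N$ and all $x\in\mathbb{R}^d$, $$R_{\alpha,n}^\kappa(x)=\frac{(\kappa+\mathbf 1)_\alpha}{(|\kappa|+d+1)_N}\sum_{\nu\in\mathbb{N}_0^d,\,|\nu|=n}\frac{\mathsf{H}_\nu(\alpha;\kappa,N)}{\mathsf{B}_\nu(\kappa,N)}\,P_\nu^\kappa(x),$$ and, conversely, for every $\nu\in\mathbb{N}_0^d$ with $|\nu|=n$ and all $x\in\mathbb{R}^d$, $$P_\nu^\kappa(x)=\sum_{\alpha\in\mathbb{N}_0^{d+1},\,|\alpha|=N}\frac{N!}{\alpha!}\,\mathsf{H}_\nu(\alpha;\kappa,N)\,R_{\alpha,n}^\kappa(x).$$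
   Context: Notation: $(a)_k=a(a+1)\cdots(a+k-1)$; for vectors, $|\cdot|$ is the sum of the components, $\alpha!=\prod_i\alpha_i!$, $\mathbf 1=(1,\ldots,1)$, $(\kappa+\mathbf 1)_\alpha=\prod_{i=1}^{d+1}(\kappa_i+1)_{\alpha_i}$. Jacobi inner product on the simplex $T^d=\{x\in\mathbb{R}^d: x_i\ge 0,\ |x|\le 1\}$: with $W_\kappa(x)=x_1^{\kappa_1}\cdots x_d^{\kappa_d}(1-|x|)^{\kappa_{d+1}}$, $\langle f,g\rangle_{W_\kappa}=c\int_{T^d}f(x)g(x)W_\kappa(x)\,dx$ with $c=\Gamma(|\kappa|+d+1)/\prod_{i=1}^{d+1}\Gamma(\kappa_i+1)$, so $\langle 1,1\rangle_{W_\kappa}=1$. $\mathcal{V}_n^d(W_\kappa)$ is the space of polynomials of degree at most $n$ in $d$ variables that are orthogonal to all polynomials of degree at most $n-1$. Jacobi polynomials on the simplex: for $\nu\in\mathbb{N}_0^d$, $$P_\nu^\kappa(x)=\prod_{j=1}^d(1-x_1-\cdots-x_{j-1})^{\nu_j}\,\frac{P_{\nu_j}^{(a_j,\kappa_j)}\left(\frac{2x_j}{1-x_1-\cdots-x_{j-1}}-1\right)}{P_{\nu_j}^{(a_j,\kappa_j)}(1)}$$ (a polynomial in $x$), where $a_j=\sum_{i=j+1}^{d+1}\kappa_i+2\sum_{i=j+1}^{d}\nu_i+d-j$ and $P_m^{(a,b)}(t)/P_m^{(a,b)}(1)={}_2F_1\left(-m,m+a+b+1;a+1;\frac{1-t}{2}\right)$.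 For $x\in\mathbb{R}^d$ put $X=(x_1,\ldots,x_d,1-|x|)$. For $\alpha\in\mathbb{N}_0^{d+1}$, $R_{\alpha,n}^\kappa$ denotes the orthogonal projection (with respect to $\langle\cdot,\cdot\rangle_{W_\kappa}$) of the polynomial $X^\alpha$ onto $\mathcal{V}_n^d(W_\kappa)$. Hahn polynomials: for $\nu\in\mathbb{N}_0^d$ with $|\nu|\le N$, the values $\mathsf{H}_\nu(\alpha;\kappa,N)$, $\alpha\in\mathbb{N}_0^{d+1}$, $|\alpha|=N$, are defined by the identity of homogeneous polynomials of degree $N$ in $y=(y',y_{d+1})\in\mathbb{R}^{d+1}$ (with $|y|=y_1+\cdots+y_{d+1}$) $$|y|^N P_\nu^\kappa\left(\frac{y'}{|y|}\right)=\sum_{|\alpha|=N}\frac{N!}{\alpha!}\,\mathsf{H}_\nu(\alpha;\kappa,N)\,y^\alpha .$$ Their squared norm is $$\mathsf{B}_\nu(\kappa,N)=\frac{N!}{(|\kappa|+d+1)_N}\sum_{\alpha\in\mathbb{N}_0^{d+1},|\alpha|=N}\mathsf{H}_\nu(\alpha;\kappa,N)^2\,\frac{(\kappa+\mathbf 1)_\alpha}{\alpha!}.$$ *)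

theory Defs
  imports "HOL-Analysis.Analysis"
begin

(* Vectors in R^m and multi-indices in N_0^m are functions on nat of which only the
   components 1, ..., m matter. Multi-indices vanish outside {1..m}, so that each is
   represented exactly once. *)

definition multi_indices :: "nat \<Rightarrow> nat \<Rightarrow> (nat \<Rightarrow> nat) set" where
  "multi_indices m n = {\<alpha>. (\<forall>i. i \<notin> {1..m} \<longrightarrow> \<alpha> i = 0) \<and> (\<Sum>i=1..m. \<alpha> i) = n}"

definition monomial :: "nat \<Rightarrow> (nat \<Rightarrow> nat) \<Rightarrow> (nat \<Rightarrow> real) \<Rightarrow> real" where
  "monomial m \<alpha> x = (\<Prod>i=1..m. x i ^ \<alpha> i)"

definition multi_fact :: "nat \<Rightarrow> (nat \<Rightarrow> nat) \<Rightarrow> real" where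
  "multi_fact m \<alpha> = (\<Prod>i=1..m. fact (\<alpha> i))"

definition multi_pochhammer :: "nat \<Rightarrow> (nat \<Rightarrow> real) \<Rightarrow> (nat \<Rightarrow> nat) \<Rightarrow> real" where
  "multi_pochhammer m a \<alpha> = (\<Prod>i=1..m. pochhammer (a i) (\<alpha> i))"

definition poly_funs :: "nat \<Rightarrow> nat \<Rightarrow> ((nat \<Rightarrow> real) \<Rightarrow> real) set" where
  "poly_funs d n =
     {p. \<exists>c. p = (\<lambda>x. \<Sum>m\<le>n. \<Sum>\<alpha>\<in>multi_indices d m. c \<alpha> * monomial d \<alpha> x)}"

definition unit_simplex :: "nat \<Rightarrow> (nat \<Rightarrow> real) set" where
  "unit_simplex d = {x \<in> {1..d} \<rightarrow>\<^sub>E UNIV. (\<forall>i\<in>{1..d}. 0 \<le> x i) \<and> (\<Sum>i=1..d. x i) \<le> 1}"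

(* powr yields 0 at base 0 whatever the exponent; this only affects the boundary of the
   simplex, a null set. *)
definition weight :: "nat \<Rightarrow> (nat \<Rightarrow> real) \<Rightarrow> (nat \<Rightarrow> real) \<Rightarrow> real" where
  "weight d \<kappa> x =
     (\<Prod>i=1..d. x i powr \<kappa> i) * (1 - (\<Sum>i=1..d. x i)) powr \<kappa> (d + 1)"

definition jacobi_inner ::
    "nat \<Rightarrow> (nat \<Rightarrow> real) \<Rightarrow> ((nat \<Rightarrow> real) \<Rightarrow> real) \<Rightarrow> ((nat \<Rightarrow> real) \<Rightarrow> real) \<Rightarrow> real" where
  "jacobi_inner d \<kappa> f g =
     Gamma ((\<Sum>i=1..d+1. \<kappa> i) + real d + 1) / (\<Prod>i=1..d+1. Gamma (\<kappa> i + 1)) *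
     (LINT x:unit_simplex d|(\<Pi>\<^sub>M i\<in>{1..d}. lborel). f x * g x * weight d \<kappa> x)"

definition orth_polys :: "nat \<Rightarrow> (nat \<Rightarrow> real) \<Rightarrow> nat \<Rightarrow> ((nat \<Rightarrow> real) \<Rightarrow> real) set" where
  "orth_polys d \<kappa> n =
     {p \<in> poly_funs d n. \<forall>m<n. \<forall>q\<in>poly_funs d m. jacobi_inner d \<kappa> p q = 0}"

definition orth_proj ::
    "nat \<Rightarrow> (nat \<Rightarrow> real) \<Rightarrow> ((nat \<Rightarrow> real) \<Rightarrow> real) set \<Rightarrow> ((nat \<Rightarrow> real) \<Rightarrow> real)
      \<Rightarrow> ((nat \<Rightarrow> real) \<Rightarrow> real)" where
  "orth_proj d \<kappa> V f =
     (THE p. p \<in> V \<and> (\<forall>q\<in>V. jacobi_inner d \<kappa> (\<lambda>x. f x - p x) q = 0))"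

definition extend_coords :: "nat \<Rightarrow> (nat \<Rightarrow> real) \<Rightarrow> (nat \<Rightarrow> real)" where
  "extend_coords d x = x(d + 1 := 1 - (\<Sum>i=1..d. x i))"

definition R_proj ::
    "nat \<Rightarrow> (nat \<Rightarrow> real) \<Rightarrow> nat \<Rightarrow> (nat \<Rightarrow> nat) \<Rightarrow> (nat \<Rightarrow> real) \<Rightarrow> real" where
  "R_proj d \<kappa> n \<alpha> =
     orth_proj d \<kappa> (orth_polys d \<kappa> n) (\<lambda>x. monomial (d + 1) \<alpha> (extend_coords d x))"

definition hyp2F1 :: "real \<Rightarrow> real \<Rightarrow> real \<Rightarrow> real \<Rightarrow> real" where
  "hyp2F1 a b c z =
     (\<Sum>k. pochhammer a k * pochhammer b k / (pochhammer c k * fact k) * z ^ k)"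

(* The Jacobi polynomial of degree m with parameters a, b, divided by its value at 1. *)
definition jacobi_normalized :: "nat \<Rightarrow> real \<Rightarrow> real \<Rightarrow> real \<Rightarrow> real" where
  "jacobi_normalized m a b t = hyp2F1 (- real m) (real m + a + b + 1) (a + 1) ((1 - t) / 2)"

(* The form s^m * jacobi_normalized m a b (2 * x / s - 1), homogeneous of degree m in
   (s, x), with the division by s carried out: for t = 2 * x / s - 1 one has
   (1 - t) / 2 = (s - x) / s. See jacobi_homogeneous_eq. *)
definition jacobi_homogeneous :: "nat \<Rightarrow> real \<Rightarrow> real \<Rightarrow> real \<Rightarrow> real \<Rightarrow> real" where
  "jacobi_homogeneous m a b s x =
     (\<Sum>k\<le>m. pochhammer (- real m) k * pochhammer (real m + a + b + 1) k /
              (pochhammer (a + 1) k * fact k) * (s - x) ^ k * s ^ (m - k))"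

definition jacobi_param :: "nat \<Rightarrow> (nat \<Rightarrow> real) \<Rightarrow> (nat \<Rightarrow> nat) \<Rightarrow> nat \<Rightarrow> real" where
  "jacobi_param d \<kappa> \<nu> j =
     (\<Sum>i=j+1..d+1. \<kappa> i) + 2 * (\<Sum>i=j+1..d. real (\<nu> i)) + real d - real j"

(* Each factor is the homogeneous form above, so that this is a polynomial in x on all of
   R^d; simplex_jacobi_eq gives the usual quotient formula. *)
definition simplex_jacobi ::
    "nat \<Rightarrow> (nat \<Rightarrow> real) \<Rightarrow> (nat \<Rightarrow> nat) \<Rightarrow> (nat \<Rightarrow> real) \<Rightarrow> real" where
  "simplex_jacobi d \<kappa> \<nu> x =
     (\<Prod>j=1..d. jacobi_homogeneous (\<nu> j) (jacobi_param d \<kappa> \<nu> j) (\<kappa> j)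
                  (1 - (\<Sum>i=1..<j. x i)) (x j))"

lemma jacobi_normalized_finite_sum:
  "jacobi_normalized m a b t =
     (\<Sum>k\<le>m. pochhammer (- real m) k * pochhammer (real m + a + b + 1) k /
              (pochhammer (a + 1) k * fact k) * ((1 - t) / 2) ^ k)"
  unfolding jacobi_normalized_def hyp2F1_def
  by (rule suminf_finite) (auto simp: pochhammer_of_nat_eq_0_lemma)

lemma jacobi_homogeneous_eq:
  assumes "s \<noteq> 0"
  shows "jacobi_homogeneous m a b s x = s ^ m * jacobi_normalized m a b (2 * x / s - 1)"
proof -
  have t: "(1 - (2 * x / s - 1)) / 2 = (s - x) / s"
    using assms by (simp add: field_simps)
  have pow: "(s - x) ^ k * s ^ (m - k) = s ^ m * ((s - x) / s) ^ k" if "k \<le> m" for k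
    using assms that by (simp add: power_divide power_diff)
  show ?thesis
    unfolding jacobi_homogeneous_def jacobi_normalized_finite_sum t sum_distrib_left
    by (rule sum.cong[OF refl]) (simp add: pow mult.assoc mult.left_commute)
qed

lemma simplex_jacobi_eq:
  assumes "\<And>j. j \<in> {1..d} \<Longrightarrow> 1 - (\<Sum>i=1..<j. x i) \<noteq> 0"
  shows "simplex_jacobi d \<kappa> \<nu> x =
     (\<Prod>j=1..d. (1 - (\<Sum>i=1..<j. x i)) ^ \<nu> j *
        jacobi_normalized (\<nu> j) (jacobi_param d \<kappa> \<nu> j) (\<kappa> j)
          (2 * x j / (1 - (\<Sum>i=1..<j. x i)) - 1))"
  unfolding simplex_jacobi_def
  by (rule prod.cong[OF refl jacobi_homogeneous_eq[OF assms]])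

(* The identity of polynomials in y is tested on the dense set where the sum of the y i is
   nonzero, which determines h; such an h exists when the sum of the \<nu> i is at most N. *)
definition hahn ::
    "nat \<Rightarrow> (nat \<Rightarrow> real) \<Rightarrow> nat \<Rightarrow> (nat \<Rightarrow> nat) \<Rightarrow> (nat \<Rightarrow> nat) \<Rightarrow> real" where
  "hahn d \<kappa> N \<nu> =
     (THE h. (\<forall>\<alpha>. \<alpha> \<notin> multi_indices (d + 1) N \<longrightarrow> h \<alpha> = 0) \<and>
        (\<forall>y. (\<Sum>i=1..d+1. y i) \<noteq> 0 \<longrightarrow>
           (\<Sum>i=1..d+1. y i) ^ N * simplex_jacobi d \<kappa> \<nu> (\<lambda>i. y i / (\<Sum>i=1..d+1. y i)) =
           (\<Sum>\<alpha>\<in>multi_indices (d + 1) N.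
              fact N / multi_fact (d + 1) \<alpha> * h \<alpha> * monomial (d + 1) \<alpha> y)))"

definition hahn_norm :: "nat \<Rightarrow> (nat \<Rightarrow> real) \<Rightarrow> nat \<Rightarrow> (nat \<Rightarrow> nat) \<Rightarrow> real" where
  "hahn_norm d \<kappa> N \<nu> =
     fact N / pochhammer ((\<Sum>i=1..d+1. \<kappa> i) + real d + 1) N *
     (\<Sum>\<alpha>\<in>multi_indices (d + 1) N.
        (hahn d \<kappa> N \<nu> \<alpha>)\<^sup>2 * multi_pochhammer (d + 1) (\<lambda>i. \<kappa> i + 1) \<alpha> / multi_fact (d + 1) \<alpha>)"

end

(* With respect to the variables s_(j+1) / s_j, s_j = 1 - x_1 - ... - x_(j-1), the Jacobi weight is
   a product of Beta densities, so that the Jacobi polynomials are mutually orthogonal by a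
   univariate computation; by a dimension count they form a basis. For the relation with the Hahn
   polynomials consider the Bernstein-Durrmeyer operator

     M f = sum over |alpha| = N of N!/alpha! (|kappa|+d+1)_N/(kappa+1)_alpha <f, X^alpha> X^alpha .

   It is self-adjoint, does not increase degrees, and acts on the leading part of degree n as a
   scalar lambda_n; hence M P = lambda_n P for every P in V_n. Comparing the coefficients of X^alpha
   in this equation for P = P_nu shows that <P_nu, X^alpha> equals
   lambda_n (kappa+1)_alpha/(|kappa|+d+1)_N H_nu(alpha), and summing against the expansion
   P_nu = sum of N!/alpha! H_nu(alpha) X^alpha gives <P_nu, P_nu> = lambda_n B_nu. The factor
   lambda_n cancels in the Fourier coefficients of X^alpha. *)
theory Submission
  imports Defs "HOL-Library.Function_Algebras"
begin

text \<open>All analysis sits in one iterated Beta integral. It is stated for densities with powers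
  of every remainder 1 - x_1 - ... - x_{j-1}, because such powers occur in
  \<open>simplex_jacobi\<close>; the rest is algebra on moments. Norms are never evaluated: only
  their non-vanishing is shown, from the m-th moment of a Jacobi polynomial of degree m, and
  lambda_n \<noteq> 0 is then read off from <P_nu, P_nu> = lambda_n B_nu. The scalar lambda_n arises
  because <x^gamma, X^alpha> divided by (kappa+1)_alpha is a polynomial in alpha whose leading term
  is a multiple of alpha^gamma. In the basis of falling factorials the sum over alpha with weights
  N!/alpha! becomes explicit, and |X| = 1 turns terms of lower order in alpha into polynomials of
  lower degree in x. The bound n \<le> N enters since P_nu has to be a combination of the X^alpha
  with |alpha| = N: a monomial of degree k \<le> N is multiplied by 1 = |X|^(N-k).\<close>

section \<open>Univariate Jacobi moments\<close>

text \<open>Pascal's rule: a finite difference of order m + 1 is one of order m applied to a first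
  difference. This drives the inductions on \<open>m\<close> below.\<close>

lemma alternating_sum_Suc:
  fixes f :: "nat \<Rightarrow> real"
  shows "(\<Sum>k\<le>Suc m. (-1) ^ k * real (Suc m choose k) * f k) =
         (\<Sum>k\<le>m. (-1) ^ k * real (m choose k) * (f k - f (Suc k)))"
proof -
  have "(\<Sum>k\<le>Suc m. (-1) ^ k * real (Suc m choose k) * f k) =
      f 0 + (\<Sum>k\<le>m. (-1) ^ Suc k * real (Suc m choose Suc k) * f (Suc k))"
    by (subst sum.atMost_Suc_shift) simp
  also have "\<dots> = f 0 + (\<Sum>k\<le>m. (-1) ^ Suc k * real (m choose Suc k) * f (Suc k))
      - (\<Sum>k\<le>m. (-1) ^ k * real (m choose k) * f (Suc k))"
    by (simp add: sum_negf sum_subtractf[symmetric] left_diff_distrib)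
      (simp add: algebra_simps flip: sum_negf sum.distrib)
  also have "f 0 + (\<Sum>k\<le>m. (-1) ^ Suc k * real (m choose Suc k) * f (Suc k)) =
      (\<Sum>k\<le>Suc m. (-1) ^ k * real (m choose k) * f k)"
    by (subst sum.atMost_Suc_shift) simp
  also have "\<dots> = (\<Sum>k\<le>m. (-1) ^ k * real (m choose k) * f k)"
    by simp
  finally show ?thesis
    by (simp add: algebra_simps sum_subtractf)
qed

text \<open>A finite difference of order \<open>m\<close> kills degrees below \<open>m\<close>,
  since q(X) and q(X + 1) have the same leading coefficient and their difference has smaller degree.
  The alternative \<open>q = 0\<close> is what remains of the assumption when the induction reaches
  \<open>m = 0\<close>.\<close>

lemma alternating_sum_poly_eq_0:
  fixes q :: "real poly"
  assumes "q = 0 \<or> degree q < m"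
  shows "(\<Sum>k\<le>m. (-1) ^ k * real (m choose k) * poly q (real k)) = 0"
  using assms
proof (induction m arbitrary: q)
  case 0
  then show ?case by simp
next
  case (Suc m)
  define q' where "q' = q - pcompose q [:1, 1:]"
  have "degree q' \<le> degree q"
    unfolding q'_def by (intro degree_diff_le) (auto simp: degree_pcompose)
  moreover have "coeff q' (degree q) = 0"
    using lead_coeff_comp[of "[:1, 1:]" q] by (simp add: q'_def degree_pcompose)
  ultimately have "q' = 0 \<or> degree q' < degree q"
    by (rule eq_zero_or_degree_less)
  then have "q' = 0 \<or> degree q' < m"
    using Suc.prems by (auto simp: q'_def)
  from Suc.IH[OF this] show ?case
    by (simp only: alternating_sum_Suc) (simp add: q'_def poly_pcompose add.commute)
qed

text \<open>Partial fractions of m! / (w (w + 1) ... (w + m)); equally, the finite difference of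
  order m of 1/x, which gives the induction.\<close>

lemma alternating_sum_inverse:
  fixes w :: real
  assumes "w > 0"
  shows "(\<Sum>k\<le>m. (-1) ^ k * real (m choose k) * (1 / (real k + w))) =
         fact m / pochhammer w (Suc m)"
  using assms
proof (induction m arbitrary: w)
  case 0
  then show ?case by simp
next
  case (Suc m)
  have pos: "pochhammer (w + 1) m > 0"
    using Suc.prems by (intro pochhammer_pos) simp
  have "(\<Sum>k\<le>Suc m. (-1) ^ k * real (Suc m choose k) * (1 / (real k + w))) =
      (\<Sum>k\<le>m. (-1) ^ k * real (m choose k) * (1 / (real k + w))) -
      (\<Sum>k\<le>m. (-1) ^ k * real (m choose k) * (1 / (real k + (w + 1))))"
    by (simp only: alternating_sum_Suc right_diff_distrib sum_subtractf) (simp add: add_ac)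
  also have "\<dots> = fact m / pochhammer w (Suc m) - fact m / pochhammer (w + 1) (Suc m)"
    using Suc.IH[of w] Suc.IH[of "w + 1"] Suc.prems by simp
  also have "\<dots> = fact m / (w * pochhammer (w + 1) m) -
      fact m / (pochhammer (w + 1) m * (w + 1 + real m))"
    by (simp add: pochhammer_rec[of w m] pochhammer_Suc[of "w + 1" m])
  also have "\<dots> = fact (Suc m) / (w * (pochhammer (w + 1) m * (w + 1 + real m)))"
    using pos Suc.prems by (simp add: divide_simps) (simp add: algebra_simps)
  also have "w * (pochhammer (w + 1) m * (w + 1 + real m)) = pochhammer w (Suc (Suc m))"
    by (simp only: pochhammer_rec[of w "Suc m"] pochhammer_Suc[of "w + 1" m])
  finally show ?case .
qed

text \<open>In the moment sums the summation index k enters through the base of shifted factorials.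
  Making these polynomials in k gives them a degree, so that the difference lemma applies.\<close>

definition pochhammer_poly :: "real \<Rightarrow> nat \<Rightarrow> real poly" where
  "pochhammer_poly a n = (\<Prod>i<n. [:a + real i, 1:])"

lemma poly_pochhammer_poly: "poly (pochhammer_poly a n) x = pochhammer (a + x) n"
  by (simp add: pochhammer_poly_def poly_prod pochhammer_prod atLeast0LessThan add_ac)

lemma degree_pochhammer_poly: "degree (pochhammer_poly a n) \<le> n"
proof -
  have "degree (pochhammer_poly a n) \<le> (\<Sum>i<n. degree [:a + real i, 1:])"
    unfolding pochhammer_poly_def using degree_prod_sum_le[of "{..<n}" "\<lambda>i. [:a + real i, 1:]"]
    by (simp add: comp_def)
  then show ?thesis by simp
qed

text \<open>Coefficient of u^k in 2F1(-m, m+a+b+1; a+1; u), the normalized Jacobi polynomial in the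
  variable u = (1 - t)/2.\<close>

definition jacobi_coeff :: "nat \<Rightarrow> real \<Rightarrow> real \<Rightarrow> nat \<Rightarrow> real" where
  "jacobi_coeff m a b k = pochhammer (- real m) k * pochhammer (real m + a + b + 1) k /
     (pochhammer (a + 1) k * fact k)"

lemma pochhammer_neg_div_fact:
  "pochhammer (- real m) k / fact k = (-1) ^ k * real (m choose k)"
proof -
  have "real (m choose k) = (-1) ^ k * pochhammer (- real m) k / fact k"
    by (simp add: binomial_gbinomial gbinomial_pochhammer)
  then have "(-1) ^ k * real (m choose k) = ((-1) ^ k * (-1) ^ k) * (pochhammer (- real m) k / fact k)"
    by simp
  also have "(-1 :: real) ^ k * (-1) ^ k = 1"
    by (simp flip: power_mult_distrib)
  finally show ?thesis by simp
qed

text \<open>Brings the terms of a moment into the form of a finite difference in \<open>k\<close>: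
  (-m)_k / k! becomes a signed binomial coefficient, and (a+1)_k divides (a+1)_{k+l}, leaving a
  polynomial of degree \<open>l\<close> in \<open>k\<close>. The denominator \<open>z\<close> stays
  arbitrary because the cases l < m and l = m treat it differently.\<close>

lemma jacobi_moment_term:
  assumes "a > -1"
  shows "jacobi_coeff m a b k * (pochhammer (a + 1) (k + l) / z) =
    (-1) ^ k * real (m choose k) *
      (pochhammer (a + 1 + real k) l * (pochhammer (real m + a + b + 1) k / z))"
proof -
  have "pochhammer (a + 1) k > 0"
    using assms by (intro pochhammer_pos) simp
  then show ?thesis
    unfolding pochhammer_neg_div_fact[symmetric] jacobi_coeff_def pochhammer_product'
    by (simp add: field_simps)
qed

text \<open>As (a+1)_j / (a+b+2)_j is the j-th moment of the Beta distribution with parameters a + 1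
  and b + 1, this is orthogonality of the Jacobi polynomial to u^l. The term without its signed
  binomial coefficient is a polynomial in \<open>k\<close> of degree l + (m - 1 - l) = m - 1, which
  the difference of order \<open>m\<close> annihilates.\<close>

lemma jacobi_moment_eq_0:
  assumes "a > -1" "b > -1" "l < m"
  shows "(\<Sum>k\<le>m. jacobi_coeff m a b k *
    (pochhammer (a + 1) (k + l) / pochhammer (a + b + 2) (k + l))) = 0"
proof -
  define z where "z = a + b + 2"
  define q where "q = pochhammer_poly (a + 1) l * pochhammer_poly (z + real l) (m - 1 - l)"
  have z: "z > 0" using assms by (simp add: z_def)
  \<comment> \<open>After cross-multiplication both sides are (z)_{m-1+k}, because z + (m - 1) = m +
    a + b + 1.\<close>
  have ratio: "pochhammer (real m + a + b + 1) k / pochhammer z (k + l) =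
      pochhammer (z + real l + real k) (m - 1 - l) / pochhammer z (m - 1)" for k
  proof -
    have "pochhammer z (k + l) * pochhammer (z + real (k + l)) (m - 1 - l) =
        pochhammer z (k + l + (m - 1 - l))"
      by (simp add: pochhammer_product')
    also have "k + l + (m - 1 - l) = m - 1 + k"
      using assms by simp
    also have "pochhammer z (m - 1 + k) = pochhammer z (m - 1) * pochhammer (z + real (m - 1)) k"
      by (simp add: pochhammer_product')
    also have "z + real (m - 1) = real m + a + b + 1"
      using assms by (simp add: z_def of_nat_diff)
    finally have "pochhammer z (k + l) * pochhammer (z + real l + real k) (m - 1 - l) =
        pochhammer z (m - 1) * pochhammer (real m + a + b + 1) k"
      by (simp add: add_ac)
    moreover have "pochhammer z (k + l) > 0" "pochhammer z (m - 1) > 0"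
      using z by (auto intro: pochhammer_pos)
    ultimately show ?thesis by (simp add: field_simps)
  qed
  have "degree q \<le> l + (m - 1 - l)"
    unfolding q_def
    using degree_mult_le[of "pochhammer_poly (a + 1) l" "pochhammer_poly (z + real l) (m - 1 - l)"]
      degree_pochhammer_poly[of "a + 1" l] degree_pochhammer_poly[of "z + real l" "m - 1 - l"]
    by linarith
  then have "degree q < m" using assms by simp
  then have "(\<Sum>k\<le>m. (-1) ^ k * real (m choose k) * poly q (real k)) = 0"
    by (intro alternating_sum_poly_eq_0) simp
  moreover have "(\<Sum>k\<le>m. jacobi_coeff m a b k *
      (pochhammer (a + 1) (k + l) / pochhammer z (k + l))) =
      (\<Sum>k\<le>m. (-1) ^ k * real (m choose k) * poly q (real k)) / pochhammer z (m - 1)"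
    by (simp only: jacobi_moment_term[OF assms(1)] ratio)
      (simp add: q_def poly_pochhammer_poly sum_divide_distrib mult_ac)
  ultimately show ?thesis by (simp add: z_def)
qed

text \<open>For l = m the denominator keeps one factor \<open>real k + w\<close> too many, so the
  term is a polynomial of degree m in \<open>k\<close> over a linear one. Division with remainder
  leaves a quotient that the difference kills, and a remainder over \<open>real k + w\<close>, which
  \<open>alternating_sum_inverse\<close> evaluates to something nonzero.\<close>

lemma jacobi_moment_neq_0:
  assumes "a > -1" "b > -1"
  shows "(\<Sum>k\<le>m. jacobi_coeff m a b k *
    (pochhammer (a + 1) (k + m) / pochhammer (a + b + 2) (k + m))) \<noteq> 0"
proof (cases m)
  case 0
  then show ?thesis by (simp add: jacobi_coeff_def)
next
  case (Suc m')
  define z where "z = a + b + 2"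
  define w where "w = z + real m'"
  have z: "z > 0" using assms by (simp add: z_def)
  then have w: "w > 0" by (simp add: w_def)
  have ratio: "pochhammer (real m + a + b + 1) k / pochhammer z (k + m) =
      1 / (pochhammer z m' * (real k + w))" for k
  proof -
    have "pochhammer z (k + m) = pochhammer z (m' + Suc k)"
      using Suc by (simp add: add_ac)
    also have "\<dots> = pochhammer z m' * (pochhammer w k * (w + real k))"
      by (simp add: pochhammer_product' w_def pochhammer_Suc)
    finally have "pochhammer z (k + m) = pochhammer z m' * (pochhammer w k * (w + real k))" .
    moreover have "real m + a + b + 1 = w"
      using Suc by (simp add: w_def z_def)
    moreover have "pochhammer w k > 0"
      using w by (rule pochhammer_pos)
    ultimately show ?thesis by simp
  qed
  define p where "p = pochhammer_poly (a + 1) m"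
  \<comment> \<open>Quotient of \<open>p\<close> by X + w; the remainder is the value of
    \<open>p\<close> at -w.\<close>
  define q where "q = synthetic_div p (-w)"
  have p: "poly p x = (x + w) * poly q x + poly p (-w)" for x
    using arg_cong[OF synthetic_div_correct'[of "-w" p], of "\<lambda>r. poly r x"]
    by (simp add: q_def algebra_simps)
  have "degree q < m"
    using degree_pochhammer_poly[of "a + 1" m] Suc
    by (simp add: q_def degree_synthetic_div p_def)
  then have q0: "(\<Sum>k\<le>m. (-1) ^ k * real (m choose k) * poly q (real k)) = 0"
    by (intro alternating_sum_poly_eq_0) simp
  \<comment> \<open>Here a + 1 - w = -(b + m), so the m factors are -(b+m), ..., -(b+1). The
    assumption b > -1 thus makes the remainder nonzero.\<close>
  have "pochhammer (a + 1 - w) m = (-1) ^ m * pochhammer (b + 1) m"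
    using pochhammer_minus[of "b + real m" m] Suc by (simp add: w_def z_def algebra_simps)
  moreover have "pochhammer (b + 1) m > 0"
    using assms by (intro pochhammer_pos) simp
  ultimately have pw: "poly p (-w) \<noteq> 0"
    by (simp add: p_def poly_pochhammer_poly)
  have "(\<Sum>k\<le>m. jacobi_coeff m a b k * (pochhammer (a + 1) (k + m) / pochhammer z (k + m))) =
      (\<Sum>k\<le>m. (-1) ^ k * real (m choose k) * (poly p (real k) / (real k + w))) / pochhammer z m'"
    by (simp only: jacobi_moment_term[OF assms(1)] ratio)
      (simp add: p_def poly_pochhammer_poly sum_divide_distrib field_simps)
  also have "(\<lambda>k. poly p (real k) / (real k + w)) =
      (\<lambda>k. poly q (real k) + poly p (-w) * (1 / (real k + w)))"
  proof
    fix k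
    have "real k + w \<noteq> 0" using w by linarith
    then show "poly p (real k) / (real k + w) = poly q (real k) + poly p (-w) * (1 / (real k + w))"
      by (subst p) (simp add: field_simps)
  qed
  also have "(\<Sum>k\<le>m. (-1) ^ k * real (m choose k) *
        (poly q (real k) + poly p (-w) * (1 / (real k + w)))) =
      poly p (-w) * (\<Sum>k\<le>m. (-1) ^ k * real (m choose k) * (1 / (real k + w)))"
    unfolding distrib_left sum.distrib q0 by (simp add: sum_distrib_left mult_ac)
  also note alternating_sum_inverse[OF w]
  finally show ?thesis
    using pw pochhammer_pos[OF w, of "Suc m"] pochhammer_pos[OF z, of m']
    by (simp add: z_def)
qed

section \<open>Dirichlet integrals over the simplex\<close>

text \<open>Stick breaking: what is left of length 1 after removing the first j - 1 coordinates.
  Hence \<open>stick x 1\<close> is 1, and \<open>stick x (d + 1)\<close> is the last barycentric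
  coordinate.\<close>

definition stick :: "(nat \<Rightarrow> real) \<Rightarrow> nat \<Rightarrow> real" where
  "stick x j = 1 - (\<Sum>i=1..<j. x i)"

lemma stick_1 [simp]: "stick x (Suc 0) = 1"
  by (simp add: stick_def)

lemma stick_Suc: "j \<ge> 1 \<Longrightarrow> stick x (Suc j) = stick x j - x j"
  by (simp add: stick_def)

text \<open>The substitution y = s t reduces this to the Beta integral on the unit interval. The
  degenerate length s = 0 is included because it occurs on the boundary of the simplex.\<close>

lemma nn_integral_Beta_scaled:
  fixes a b s :: real
  assumes "a > 0" "b > 0" "s \<ge> 0"
  shows "(\<integral>\<^sup>+y. ennreal (y powr (a - 1) * (s - y) powr (b - 1) * indicator {0..s} y) \<partial>lborel) =
    ennreal (s powr (a + b - 1) * Beta a b)"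
\<comment> \<open>For s = 0 both sides are 0, since only y = 0 lies in the interval and
  \<open>0 powr _ = 0\<close>.\<close>
proof (cases "s = 0")
  case True
  then have "(\<lambda>y. ennreal (y powr (a - 1) * (s - y) powr (b - 1) * indicator {0..s} y)) = (\<lambda>_. 0)"
    by (auto simp: indicator_def fun_eq_iff)
  then show ?thesis
    using True by simp
next
  case False
  with assms have s: "s > 0" by simp
  have unit: "(\<integral>\<^sup>+t. ennreal (t powr (a - 1) * (1 - t) powr (b - 1) * indicator {0..1} t) \<partial>lborel) =
      ennreal (Beta a b)"
    using nn_integral_has_integral_lebesgue[OF _ has_integral_Beta_real[OF assms(1,2)]]
    by (simp add: mult_ac)
  have scale: "(s * t) powr (a - 1) * (s - s * t) powr (b - 1) * indicator {0..s} (s * t) =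
      s powr (a + b - 2) * (t powr (a - 1) * (1 - t) powr (b - 1) * indicator {0..1} t)" for t
  proof (cases "t \<in> {0..1}")
    case True
    have "(s - s * t) powr (b - 1) = s powr (b - 1) * (1 - t) powr (b - 1)"
      using powr_mult[of s "1 - t" "b - 1"] True s by (simp add: right_diff_distrib)
    moreover have "(s * t) powr (a - 1) = s powr (a - 1) * t powr (a - 1)"
      using True s by (simp add: powr_mult)
    moreover have "s powr (a + b - 2) = s powr (a - 1) * s powr (b - 1)"
      by (simp flip: powr_add)
    moreover have "s * t \<in> {0..s}"
      using True s by (simp add: mult_le_cancel_left1)
    ultimately show ?thesis
      using True by (simp add: mult_ac)
  next
    case False
    then have "s * t \<notin> {0..s}"
      using s by (auto simp: zero_le_mult_iff)
    with False show ?thesis by simp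
  qed
  have "(\<integral>\<^sup>+y. ennreal (y powr (a - 1) * (s - y) powr (b - 1) * indicator {0..s} y) \<partial>lborel) =
      ennreal s * (\<integral>\<^sup>+t. ennreal (s powr (a + b - 2) *
        (t powr (a - 1) * (1 - t) powr (b - 1) * indicator {0..1} t)) \<partial>lborel)"
    by (subst nn_integral_real_affine[where c=s and t=0]) (use s in \<open>simp_all add: scale\<close>)
  also have "\<dots> = ennreal s * (ennreal (s powr (a + b - 2)) * ennreal (Beta a b))"
  proof -
    have "(\<lambda>t. t powr (a - 1) * (1 - t) powr (b - 1) * indicator {0..1} t) \<in> borel_measurable lborel"
      by measurable
    then show ?thesis
      by (subst ennreal_mult') (simp_all only: nn_integral_cmult measurable_compose_rev[OF measurable_ennreal] unit powr_ge_zero)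
  qed
  also have "\<dots> = ennreal (s * s powr (a + b - 2) * Beta a b)"
    using s by (simp add: ennreal_mult' mult.assoc)
  also have "s * s powr (a + b - 2) = s powr (a + b - 1)"
    using s powr_add[of s 1 "a + b - 2"] by simp
  finally show ?thesis .
qed

text \<open>The fibre over \<open>x\<close> is the interval on which the scaled Beta integral is
  taken.\<close>

lemma unit_simplex_Suc_iff:
  assumes "x \<in> {1..d} \<rightarrow>\<^sub>E UNIV"
  shows "x(Suc d := y) \<in> unit_simplex (Suc d) \<longleftrightarrow>
    x \<in> unit_simplex d \<and> y \<in> {0..stick x (Suc d)}"
proof -
  have s: "(\<Sum>i=1..d. (x(Suc d := y)) i) = (\<Sum>i=1..d. x i)"
    by (intro sum.cong) auto
  have "{1..Suc d} = insert (Suc d) {1..d}" by auto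
  then have "x(Suc d := y) \<in> {1..Suc d} \<rightarrow>\<^sub>E UNIV"
    using assms by (auto simp: PiE_iff extensional_def)
  moreover have "(\<forall>i\<in>{1..Suc d}. 0 \<le> (x(Suc d := y)) i) \<longleftrightarrow> (\<forall>i\<in>{1..d}. 0 \<le> x i) \<and> 0 \<le> y"
    by (auto simp: le_Suc_eq)
  ultimately show ?thesis
    using assms s unfolding unit_simplex_def stick_def
    by (auto simp: atLeastLessThanSuc_atLeastAtMost)
qed

lemma sets_unit_simplex [measurable]: "unit_simplex d \<in> sets (\<Pi>\<^sub>M i\<in>{1..d}. lborel)"
proof -
  have "unit_simplex d = {x \<in> space (\<Pi>\<^sub>M i\<in>{1..d}. lborel).
      (\<forall>i\<in>{1..d}. 0 \<le> x i) \<and> (\<Sum>i=1..d. x i) \<le> 1}"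
    by (auto simp: unit_simplex_def space_PiM)
  also have "\<dots> \<in> sets (\<Pi>\<^sub>M i\<in>{1..d}. lborel)"
    by measurable
  finally show ?thesis .
qed

lemma stick_nonneg: "x \<in> unit_simplex d \<Longrightarrow> j \<le> Suc d \<Longrightarrow> stick x j \<ge> 0"
proof -
  assume x: "x \<in> unit_simplex d" and j: "j \<le> Suc d"
  have "(\<Sum>i=1..<j. x i) \<le> (\<Sum>i=1..d. x i)"
    using x j by (intro sum_mono2) (auto simp: unit_simplex_def)
  also have "\<dots> \<le> 1" using x by (simp add: unit_simplex_def)
  finally show ?thesis by (simp add: stick_def)
qed

lemma measurable_stick [measurable]:
  "j \<le> Suc d \<Longrightarrow> (\<lambda>x. stick x j) \<in> borel_measurable (\<Pi>\<^sub>M i\<in>{1..d}. lborel)"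
proof -
  assume j: "j \<le> Suc d"
  have "(\<lambda>x. x i) \<in> borel_measurable (\<Pi>\<^sub>M i\<in>{1..d}. lborel)" if "i \<in> {1..<j}" for i
  proof -
    from that j have "i \<in> {1..d}" by auto
    then show ?thesis by measurable
  qed
  then show ?thesis
    unfolding stick_def by measurable
qed

text \<open>A Dirichlet density enriched by a power of every stick. This family is closed under
  integrating out the last coordinate. The factor with index 0 is a power of
  \<open>stick x 1\<close>, hence 1; it is where the induction puts the exponent inherited in
  dimension 0.\<close>

definition stick_density :: "nat \<Rightarrow> (nat \<Rightarrow> real) \<Rightarrow> (nat \<Rightarrow> real) \<Rightarrow> (nat \<Rightarrow> real) \<Rightarrow> real" where
  "stick_density d p r x = (\<Prod>i=1..d. x i powr (p i - 1)) * (\<Prod>i\<le>d. stick x (Suc i) powr r i)"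

lemma measurable_stick_density [measurable]:
  "stick_density d p r \<in> borel_measurable (\<Pi>\<^sub>M i\<in>{1..d}. lborel)"
proof -
  have "(\<lambda>x. x i powr (p i - 1)) \<in> borel_measurable (\<Pi>\<^sub>M i\<in>{1..d}. lborel)" if "i \<in> {1..d}" for i
    using that by measurable
  moreover have "(\<lambda>x. stick x (Suc i) powr r i) \<in> borel_measurable (\<Pi>\<^sub>M i\<in>{1..d}. lborel)"
    if "i \<in> {..d}" for i
  proof -
    have "(\<lambda>x. stick x (Suc i)) \<in> borel_measurable (\<Pi>\<^sub>M i\<in>{1..d}. lborel)"
      using that by (intro measurable_stick) auto
    then show ?thesis by measurable
  qed
  ultimately show ?thesis
    unfolding stick_density_def[abs_def]
    by (intro borel_measurable_times borel_measurable_prod) auto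
qed

text \<open>The last coordinate is integrated first: its Beta integral leaves a power of the
  preceding stick, and the integrand is again a \<open>stick_density\<close>. Exponents thus
  accumulate from the end, and only the accumulated second Beta parameters have to be positive; a
  single \<open>r j\<close> may be any real.\<close>

lemma nn_integral_stick_density:
  assumes "\<And>j. j \<in> {1..d} \<Longrightarrow> p j > 0"
    and "\<And>j. j \<in> {1..d} \<Longrightarrow> 1 + r j + (\<Sum>i=j+1..d. p i + r i) > 0"
  shows "(\<integral>\<^sup>+x. ennreal (indicator (unit_simplex d) x * stick_density d p r x)
      \<partial>(\<Pi>\<^sub>M i\<in>{1..d}. lborel)) =
    ennreal (\<Prod>j=1..d. Beta (p j) (1 + r j + (\<Sum>i=j+1..d. p i + r i)))"
  using assms
proof (induction d arbitrary: r)
  case 0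
  interpret product_sigma_finite "\<lambda>_. lborel :: real measure"
    by standard
  show ?case
    by (simp add: nn_integral_empty stick_density_def unit_simplex_def)
next
  case (Suc d)
  interpret product_sigma_finite "\<lambda>_. lborel :: real measure"
    by standard
  \<comment> \<open>Integrating y^(p-1) (s - y)^r over [0, s] yields s^(p+r) times a Beta value.
    Here s is \<open>stick x (Suc d)\<close>, whose exponent carries the index d.\<close>
  define r' where "r' = r(d := r d + p (Suc d) + r (Suc d))"
  have I: "{1..Suc d} = insert (Suc d) {1..d}" by auto
  have tail: "1 + r' j + (\<Sum>i=j+1..d. p i + r' i) = 1 + r j + (\<Sum>i=j+1..Suc d. p i + r i)"
    if "j \<in> {1..d}" for j
  proof (cases "j = d")
    case True
    then show ?thesis by (simp add: r'_def)
  next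
    case False
    define e where "e = d - 1"
    have e: "d = Suc e" "j \<le> e" using that False by (auto simp: e_def)
    have "(\<Sum>i=j+1..e. p i + r' i) = (\<Sum>i=j+1..e. p i + r i)"
      by (intro sum.cong) (auto simp: r'_def e)
    then show ?thesis using e by (simp add: r'_def)
  qed
  have p: "p (Suc d) > 0" and r: "1 + r (Suc d) > 0"
    using Suc.prems(1)[of "Suc d"] Suc.prems(2)[of "Suc d"] by auto
  have Bpos: "Beta (p (Suc d)) (1 + r (Suc d)) > 0"
    unfolding Beta_def using p r by (intro divide_pos_pos mult_pos_pos Gamma_real_pos) auto
  have inner: "(\<integral>\<^sup>+y. ennreal (indicator (unit_simplex (Suc d)) (x(Suc d := y)) *
        stick_density (Suc d) p r (x(Suc d := y))) \<partial>lborel) =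
      ennreal (Beta (p (Suc d)) (1 + r (Suc d))) *
      ennreal (indicator (unit_simplex d) x * stick_density d p r' x)"
    if x: "x \<in> space (\<Pi>\<^sub>M i\<in>{1..d}. lborel)" for x
  proof (cases "x \<in> unit_simplex d")
    case False
    then show ?thesis
      using x by (simp add: indicator_def unit_simplex_Suc_iff space_PiM)
  next
    case True
    define s where "s = stick x (Suc d)"
    define c where "c = stick_density d p r x"
    have s: "s \<ge> 0" using True by (simp add: s_def stick_nonneg)
    have c: "c \<ge> 0"
      unfolding c_def stick_density_def by (intro mult_nonneg_nonneg prod_nonneg) auto
    have st: "stick (x(Suc d := y)) j = stick x j" if "j \<le> Suc d" for j y
      using that unfolding stick_def by (intro arg_cong2[where f="(-)"] sum.cong) auto
    have "stick_density (Suc d) p r (x(Suc d := y)) =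
        c * (y powr (p (Suc d) - 1) * (s - y) powr r (Suc d))" for y
    proof -
      have "(\<Prod>i=1..d. (x(Suc d := y)) i powr (p i - 1)) = (\<Prod>i=1..d. x i powr (p i - 1))"
        by (intro prod.cong) auto
      moreover have "(\<Prod>i\<le>d. stick (x(Suc d := y)) (Suc i) powr r i) =
          (\<Prod>i\<le>d. stick x (Suc i) powr r i)"
        by (intro prod.cong) (auto simp: st)
      ultimately show ?thesis
        by (simp add: stick_density_def c_def stick_Suc[of "Suc d"] st s_def)
    qed
    moreover have "indicator (unit_simplex (Suc d)) (x(Suc d := y)) = (indicator {0..s} y :: real)" for y
      using x True by (simp add: indicator_def unit_simplex_Suc_iff space_PiM s_def)
    ultimately have "(\<integral>\<^sup>+y. ennreal (indicator (unit_simplex (Suc d)) (x(Suc d := y)) *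
          stick_density (Suc d) p r (x(Suc d := y))) \<partial>lborel) =
        (\<integral>\<^sup>+y. ennreal c * ennreal (y powr (p (Suc d) - 1) * (s - y) powr (1 + r (Suc d) - 1) *
           indicator {0..s} y) \<partial>lborel)"
      using c by (intro nn_integral_cong) (simp add: mult_ac flip: ennreal_mult')
    also have "\<dots> = ennreal c * ennreal (s powr (p (Suc d) + (1 + r (Suc d)) - 1) *
        Beta (p (Suc d)) (1 + r (Suc d)))"
      by (subst nn_integral_cmult, measurable) (simp only: nn_integral_Beta_scaled[OF p r s])
    also have "\<dots> = ennreal (Beta (p (Suc d)) (1 + r (Suc d))) *
        ennreal (c * s powr (p (Suc d) + r (Suc d)))"
      using c Bpos by (simp add: ennreal_mult mult_ac)
    also have "c * s powr (p (Suc d) + r (Suc d)) = stick_density d p r' x"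
    proof -
      have "(\<Prod>i\<le>d. stick x (Suc i) powr r' i) =
          (\<Prod>i\<le>d. stick x (Suc i) powr r i * (if i = d then s powr (p (Suc d) + r (Suc d)) else 1))"
        by (intro prod.cong refl) (auto simp: r'_def s_def add.assoc simp flip: powr_add)
      also have "\<dots> = (\<Prod>i\<le>d. stick x (Suc i) powr r i) * s powr (p (Suc d) + r (Suc d))"
        by (simp add: prod.distrib prod.delta)
      finally show ?thesis by (simp add: stick_density_def c_def mult.assoc)
    qed
    finally show ?thesis using True by (simp del: fun_upd_apply)
  qed
  have "(\<integral>\<^sup>+x. ennreal (indicator (unit_simplex (Suc d)) x * stick_density (Suc d) p r x)
      \<partial>(\<Pi>\<^sub>M i\<in>{1..Suc d}. lborel)) =
    (\<integral>\<^sup>+x. (\<integral>\<^sup>+y. ennreal (indicator (unit_simplex (Suc d)) (x(Suc d := y)) *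
        stick_density (Suc d) p r (x(Suc d := y))) \<partial>lborel) \<partial>(\<Pi>\<^sub>M i\<in>{1..d}. lborel))"
  proof -
    have "(\<lambda>x. ennreal (indicator (unit_simplex (Suc d)) x * stick_density (Suc d) p r x))
        \<in> borel_measurable (\<Pi>\<^sub>M i\<in>{1..Suc d}. lborel)"
      by measurable
    then show ?thesis
      unfolding I by (subst product_nn_integral_insert) auto
  qed
  also have "\<dots> = (\<integral>\<^sup>+x. ennreal (Beta (p (Suc d)) (1 + r (Suc d))) *
      ennreal (indicator (unit_simplex d) x * stick_density d p r' x) \<partial>(\<Pi>\<^sub>M i\<in>{1..d}. lborel))"
    by (intro nn_integral_cong inner)
  also have "\<dots> = ennreal (Beta (p (Suc d)) (1 + r (Suc d))) *
      ennreal (\<Prod>j=1..d. Beta (p j) (1 + r' j + (\<Sum>i=j+1..d. p i + r' i)))"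
  proof -
    have "(\<lambda>x. ennreal (indicator (unit_simplex d) x * stick_density d p r' x))
        \<in> borel_measurable (\<Pi>\<^sub>M i\<in>{1..d}. lborel)"
      by measurable
    moreover have "1 + r' j + (\<Sum>i=j+1..d. p i + r' i) > 0" if "j \<in> {1..d}" for j
      unfolding tail[OF that] using Suc.prems(2)[of j] that by simp
    ultimately show ?thesis
      using Suc.prems(1) by (simp only: nn_integral_cmult) (subst Suc.IH; simp)
  qed
  also have "(\<Prod>j=1..d. Beta (p j) (1 + r' j + (\<Sum>i=j+1..d. p i + r' i))) =
      (\<Prod>j=1..d. Beta (p j) (1 + r j + (\<Sum>i=j+1..Suc d. p i + r i)))"
    by (intro prod.cong refl) (simp only: tail)
  finally show ?case
    using Bpos by (simp add: mult_ac flip: ennreal_mult')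
qed

lemma power_mult_powr:
  fixes x :: real
  assumes "x \<ge> 0"
  shows "x ^ n * x powr a = x powr (a + real n)"
  using assms by (cases "x = 0") (auto simp: powr_add powr_realpow)

lemma stick_antimono:
  assumes "x \<in> unit_simplex d" "i \<le> j" "j \<le> Suc d"
  shows "stick x j \<le> stick x i"
  unfolding stick_def using assms
  by (intro diff_left_mono sum_mono2) (auto simp: unit_simplex_def)

text \<open>Translates weight times polynomial into a \<open>stick_density\<close>. The last stick
  receives the exponent of the last barycentric coordinate in addition to \<open>e d\<close>; index
  0 receives nothing.\<close>

lemma stick_density_eq:
  assumes x: "x \<in> unit_simplex d"
    and p: "\<And>i. p i = \<kappa> i + 1 + real (\<alpha> i)"
    and r: "\<And>i. r i = (if i = d then \<kappa> (d + 1) + real (\<alpha> (d + 1)) else 0) +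
      (if i = 0 then 0 else real (e i))"
  shows "monomial (d + 1) \<alpha> (extend_coords d x) * (\<Prod>j=1..d. stick x (Suc j) ^ e j) *
    weight d \<kappa> x = stick_density d p r x"
proof -
  have nn: "\<And>i. i \<in> {1..d} \<Longrightarrow> x i \<ge> 0"
    using x by (simp add: unit_simplex_def)
  have last: "1 - (\<Sum>i=1..d. x i) = stick x (Suc d)"
    by (simp add: stick_def atLeastLessThanSuc_atLeastAtMost)
  have mono: "monomial (d + 1) \<alpha> (extend_coords d x) =
      (\<Prod>i=1..d. x i ^ \<alpha> i) * stick x (Suc d) ^ \<alpha> (Suc d)"
    by (simp add: monomial_def extend_coords_def flip: last)
  have xs: "(\<Prod>i=1..d. x i ^ \<alpha> i) * (\<Prod>i=1..d. x i powr \<kappa> i) = (\<Prod>i=1..d. x i powr (p i - 1))"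
    unfolding prod.distrib[symmetric] by (intro prod.cong refl) (simp add: power_mult_powr nn p)
  show ?thesis
  \<comment> \<open>If the last stick vanishes, \<open>0 powr _ = 0\<close> makes both sides 0.
    Otherwise all sticks are positive, because they decrease, and their integer powers can be merged
    into \<open>powr\<close>.\<close>
  proof (cases "stick x (Suc d) = 0")
    case True
    have "(\<Prod>i\<le>d. stick x (Suc i) powr r i) = 0"
      by (rule prod_zero) (use True in auto)
    then show ?thesis
      unfolding weight_def last stick_density_def using True by simp
  next
    case False
    then have "stick x (Suc d) > 0" using stick_nonneg[OF x, of "Suc d"] by simp
    then have pos: "stick x (Suc i) > 0" if "i \<le> d" for i
      using stick_antimono[OF x, of "Suc i" "Suc d"] that by simp
    have "(\<Prod>i\<le>d. stick x (Suc i) powr r i) =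
        (\<Prod>i\<le>d. (if i = d then stick x (Suc d) powr (\<kappa> (d + 1) + real (\<alpha> (d + 1))) else 1) *
          (if i = 0 then 1 else stick x (Suc i) ^ e i))"
    proof (intro prod.cong refl)
      fix i assume "i \<in> {..d}"
      then have "stick x (Suc i) > 0" using pos by simp
      then show "stick x (Suc i) powr r i =
          (if i = d then stick x (Suc d) powr (\<kappa> (d + 1) + real (\<alpha> (d + 1))) else 1) *
          (if i = 0 then 1 else stick x (Suc i) ^ e i)"
        by (auto simp: r powr_add powr_realpow)
    qed
    also have "\<dots> = stick x (Suc d) powr (\<kappa> (d + 1) + real (\<alpha> (d + 1))) *
        (\<Prod>i\<in>{..d}. if i = 0 then 1 else stick x (Suc i) ^ e i)"
      by (simp add: prod.distrib prod.delta)
    also have "(\<Prod>i\<in>{..d}. if i = 0 then 1 else stick x (Suc i) ^ e i) =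
        (\<Prod>i=1..d. stick x (Suc i) ^ e i)"
      by (intro prod.mono_neutral_cong_right) auto
    also have "stick x (Suc d) powr (\<kappa> (d + 1) + real (\<alpha> (d + 1))) =
        stick x (Suc d) ^ \<alpha> (Suc d) * stick x (Suc d) powr \<kappa> (Suc d)"
      using pos[of d] by (simp add: power_mult_powr)
    finally show ?thesis
      unfolding weight_def last stick_density_def mono xs[symmetric] by (simp add: mult_ac)
  qed
qed

lemma Beta_pos: "a > 0 \<Longrightarrow> b > 0 \<Longrightarrow> Beta a b > (0 :: real)"
  unfolding Beta_def by (intro divide_pos_pos mult_pos_pos Gamma_real_pos) auto

text \<open>With A_j the sum of the parameters from j on, the j-th factor is Gamma(a_j)
  Gamma(A_{j+1}) / Gamma(A_j), and the quotients of A-terms telescope. The result is the Dirichlet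
  normalization.\<close>

lemma prod_Beta_telescope:
  fixes a :: "nat \<Rightarrow> real"
  assumes "\<And>i. i \<in> {1..d+1} \<Longrightarrow> a i > 0"
  shows "(\<Prod>j=1..d. Beta (a j) (\<Sum>i=j+1..d+1. a i)) =
    (\<Prod>i=1..d+1. Gamma (a i)) / Gamma (\<Sum>i=1..d+1. a i)"
proof -
  define A where "A j = (\<Sum>i=j..d+1. a i)" for j
  have A: "A j > 0" if "j \<in> {1..d+1}" for j
    unfolding A_def using that assms by (intro sum_pos) auto
  have step: "A j = a j + A (Suc j)" if "j \<in> {1..d}" for j
    using that by (simp add: A_def sum.atLeast_Suc_atMost)
  have tele: "(\<Prod>j=1..n. Gamma (A (Suc j)) / Gamma (A j)) = Gamma (A (Suc n)) / Gamma (A 1)"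
    if "n \<le> d" for n
    using that
  proof (induction n)
    case 0
    then show ?case using Gamma_real_pos[OF A[of 1]] by simp
  next
    case (Suc n)
    then show ?case using Gamma_real_pos[OF A[of "Suc n"]] by simp
  qed
  have "(\<Prod>j=1..d. Beta (a j) (\<Sum>i=j+1..d+1. a i)) =
      (\<Prod>j=1..d. Gamma (a j) * (Gamma (A (Suc j)) / Gamma (A j)))"
    by (intro prod.cong refl) (simp add: Beta_def step, simp add: A_def)
  also have "\<dots> = (\<Prod>j=1..d. Gamma (a j)) * (Gamma (A (Suc d)) / Gamma (A 1))"
    by (simp only: prod.distrib tele[OF order.refl])
  also have "A (Suc d) = a (d + 1)"
    by (simp add: A_def)
  finally show ?thesis by (simp add: A_def)
qed

section \<open>Moments of the Jacobi weight\<close>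

locale jacobi_weight =
  fixes d :: nat and \<kappa> :: "nat \<Rightarrow> real"
  assumes kappa: "i \<in> {1..d+1} \<Longrightarrow> \<kappa> i > -1"
begin

definition jacobi_int :: "((nat \<Rightarrow> real) \<Rightarrow> real) \<Rightarrow> real" where
  "jacobi_int h = jacobi_inner d \<kappa> h (\<lambda>_. 1)"

definition jacobi_integrable :: "((nat \<Rightarrow> real) \<Rightarrow> real) \<Rightarrow> bool" where
  "jacobi_integrable h \<longleftrightarrow>
    set_integrable (\<Pi>\<^sub>M i\<in>{1..d}. lborel) (unit_simplex d) (\<lambda>x. h x * weight d \<kappa> x)"

lemma jacobi_inner_eq: "jacobi_inner d \<kappa> f g = jacobi_int (\<lambda>x. f x * g x)"
  by (simp add: jacobi_int_def jacobi_inner_def)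

definition kappa_total :: real where "kappa_total = (\<Sum>i=1..d+1. \<kappa> i) + real d + 1"

lemma kappa_total_eq: "kappa_total = (\<Sum>i=1..d+1. \<kappa> i + 1)"
  by (simp add: kappa_total_def sum.distrib)

lemma kappa_total_pos: "kappa_total > 0"
  unfolding kappa_total_eq using kappa by (intro sum_pos) (force simp: add.commute)+

text \<open>Common source of two moment formulas: \<open>e = 0\<close> serves the barycentric
  monomials of the Durrmeyer operator, \<open>\<alpha> = 0\<close> the powers of sticks in the
  Jacobi polynomials.\<close>

lemma has_moment:
  fixes \<alpha> e :: "nat \<Rightarrow> nat"
  defines "h \<equiv> \<lambda>x. monomial (d + 1) \<alpha> (extend_coords d x) * (\<Prod>j=1..d. stick x (Suc j) ^ e j)"
  shows "jacobi_integrable h"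
    and "jacobi_int h = Gamma kappa_total / (\<Prod>i=1..d+1. Gamma (\<kappa> i + 1)) *
      (\<Prod>j=1..d. Beta (\<kappa> j + 1 + real (\<alpha> j))
        (real (\<Sum>i=j..d. e i) + (\<Sum>i=j+1..d+1. \<kappa> i + 1 + real (\<alpha> i))))"
proof -
  define p where "p i = \<kappa> i + 1 + real (\<alpha> i)" for i
  define r where "r i = (if i = d then \<kappa> (d + 1) + real (\<alpha> (d + 1)) else 0) +
      (if i = 0 then 0 else real (e i))" for i
  define B where "B = (\<Prod>j=1..d. Beta (\<kappa> j + 1 + real (\<alpha> j))
        (real (\<Sum>i=j..d. e i) + (\<Sum>i=j+1..d+1. \<kappa> i + 1 + real (\<alpha> i))))"
  let ?M = "\<Pi>\<^sub>M i\<in>{1..d}. lborel :: real measure"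
  have k1: "\<kappa> i + 1 > 0" if "i \<in> {1..d+1}" for i
    using kappa[OF that] by simp
  then have p: "p j > 0" if "j \<in> {1..d+1}" for j
    using that by (simp add: p_def add_pos_nonneg)
  \<comment> \<open>The 1 on the left and the exponent of the last coordinate, hidden in
    \<open>r d\<close>, combine to \<open>p (d + 1)\<close>.\<close>
  have R: "1 + r j + (\<Sum>i=j+1..d. p i + r i) =
      real (\<Sum>i=j..d. e i) + (\<Sum>i=j+1..d+1. \<kappa> i + 1 + real (\<alpha> i))" if "j \<in> {1..d}" for j
  proof -
    have "r j + (\<Sum>i=j+1..d. r i) = (\<Sum>i=j..d. r i)"
      using that by (simp add: sum.atLeast_Suc_atMost)
    also have "\<dots> = (\<Sum>i=j..d. if i = d then \<kappa> (d + 1) + real (\<alpha> (d + 1)) else 0) + (\<Sum>i=j..d. real (e i))"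
      unfolding sum.distrib[symmetric] using that by (intro sum.cong) (auto simp: r_def)
    also have "\<dots> = \<kappa> (d + 1) + real (\<alpha> (d + 1)) + (\<Sum>i=j..d. real (e i))"
      using that by (simp add: sum.delta)
    finally have "1 + r j + (\<Sum>i=j+1..d. p i + r i) =
        (\<Sum>i=j+1..d. p i) + p (d + 1) + (\<Sum>i=j..d. real (e i))"
      by (simp add: sum.distrib p_def)
    also have "(\<Sum>i=j+1..d. p i) + p (d + 1) = (\<Sum>i=j+1..d+1. p i)"
      using that by simp
    finally show ?thesis by (simp add: p_def)
  qed
  have Rpos: "1 + r j + (\<Sum>i=j+1..d. p i + r i) > 0" if "j \<in> {1..d}" for j
  proof -
    have "(\<Sum>i=j+1..d+1. p i) > 0"
      using p that by (intro sum_pos) auto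
    then have "real (\<Sum>i=j..d. e i) + (\<Sum>i=j+1..d+1. p i) > 0"
      by (rule add_nonneg_pos[OF of_nat_0_le_iff])
    then show ?thesis
      unfolding R[OF that] by (simp only: p_def)
  qed
  have B: "B = (\<Prod>j=1..d. Beta (p j) (1 + r j + (\<Sum>i=j+1..d. p i + r i)))"
    unfolding B_def by (intro prod.cong refl) (simp only: R, simp add: p_def)
  have Bnn: "B \<ge> 0"
    unfolding B using p Rpos by (intro prod_nonneg) (auto intro!: less_imp_le[OF Beta_pos])
  have nn: "stick_density d p r x \<ge> 0" for x
    unfolding stick_density_def by (intro mult_nonneg_nonneg prod_nonneg) auto
  have "has_bochner_integral ?M (\<lambda>x. indicator (unit_simplex d) x * stick_density d p r x) B"
  proof (rule has_bochner_integral_nn_integral)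
    show "(\<lambda>x. indicator (unit_simplex d) x * stick_density d p r x) \<in> borel_measurable ?M"
      by measurable
    show "(\<integral>\<^sup>+x. ennreal (indicator (unit_simplex d) x * stick_density d p r x) \<partial>?M) = ennreal B"
      unfolding B using p Rpos by (intro nn_integral_stick_density) auto
  qed (use nn Bnn in auto)
  also have "(\<lambda>x. indicator (unit_simplex d) x * stick_density d p r x) =
      (\<lambda>x. indicator (unit_simplex d) x *\<^sub>R (h x * weight d \<kappa> x))"
    using stick_density_eq[of _ d p \<kappa> \<alpha> r e, OF _ p_def r_def]
    by (auto simp: fun_eq_iff indicator_def h_def)
  finally have *: "has_bochner_integral ?M (\<lambda>x. indicator (unit_simplex d) x *\<^sub>R (h x * weight d \<kappa> x)) B" .
  from * show "jacobi_integrable h"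
    by (simp add: jacobi_integrable_def set_integrable_def has_bochner_integral_iff)
  from * show "jacobi_int h = Gamma kappa_total / (\<Prod>i=1..d+1. Gamma (\<kappa> i + 1)) * B"
    by (simp add: jacobi_int_def jacobi_inner_def set_lebesgue_integral_def has_bochner_integral_iff
        kappa_total_def)
qed

text \<open>The Beta factors telescope to the Dirichlet normalization with parameters \<kappa>_i + 1
  + \<alpha>_i. Compared with the one for \<alpha> = 0, it consists of quotients of Gamma values at
  integer distance, that is, of shifted factorials.\<close>

lemma moment_monomial:
  "jacobi_int (\<lambda>x. monomial (d + 1) \<alpha> (extend_coords d x)) =
    multi_pochhammer (d + 1) (\<lambda>i. \<kappa> i + 1) \<alpha> / pochhammer kappa_total (\<Sum>i=1..d+1. \<alpha> i)"
proof -
  have k1: "\<kappa> i + 1 > 0" if "i \<in> {1..d+1}" for i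
    using kappa[OF that] by simp
  have poch: "pochhammer z n = Gamma (z + real n) / Gamma z" if "z > 0" for z :: real and n
    using that by (intro pochhammer_Gamma) (auto elim!: nonpos_Ints_cases)
  have "jacobi_int (\<lambda>x. monomial (d + 1) \<alpha> (extend_coords d x)) =
      Gamma kappa_total / (\<Prod>i=1..d+1. Gamma (\<kappa> i + 1)) *
      (\<Prod>j=1..d. Beta (\<kappa> j + 1 + real (\<alpha> j)) (\<Sum>i=j+1..d+1. \<kappa> i + 1 + real (\<alpha> i)))"
    using has_moment(2)[of \<alpha> "\<lambda>_. 0"] by simp
  also have "(\<Prod>j=1..d. Beta (\<kappa> j + 1 + real (\<alpha> j)) (\<Sum>i=j+1..d+1. \<kappa> i + 1 + real (\<alpha> i))) =
      (\<Prod>i=1..d+1. Gamma (\<kappa> i + 1 + real (\<alpha> i))) / Gamma (\<Sum>i=1..d+1. \<kappa> i + 1 + real (\<alpha> i))"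
    using k1 by (intro prod_Beta_telescope) (simp add: add_pos_nonneg)
  also have "(\<Sum>i=1..d+1. \<kappa> i + 1 + real (\<alpha> i)) = kappa_total + real (\<Sum>i=1..d+1. \<alpha> i)"
    by (simp only: kappa_total_eq sum.distrib of_nat_sum)
  also have "(\<Prod>i=1..d+1. Gamma (\<kappa> i + 1 + real (\<alpha> i))) =
      (\<Prod>i=1..d+1. pochhammer (\<kappa> i + 1) (\<alpha> i) * Gamma (\<kappa> i + 1))"
  proof (intro prod.cong refl)
    fix i assume "i \<in> {1..d+1}"
    then have pos: "\<kappa> i + 1 > 0" by (rule k1)
    then have "Gamma (\<kappa> i + 1) \<noteq> 0" using Gamma_real_pos[OF pos] by linarith
    then show "Gamma (\<kappa> i + 1 + real (\<alpha> i)) = pochhammer (\<kappa> i + 1) (\<alpha> i) * Gamma (\<kappa> i + 1)"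
      unfolding poch[OF pos] by (rule nonzero_eq_divide_eq[THEN iffD1, OF _ refl, symmetric])
  qed
  also have "\<dots> = multi_pochhammer (d + 1) (\<lambda>i. \<kappa> i + 1) \<alpha> * (\<Prod>i=1..d+1. Gamma (\<kappa> i + 1))"
    by (simp only: multi_pochhammer_def prod.distrib)
  finally have *: "jacobi_int (\<lambda>x. monomial (d + 1) \<alpha> (extend_coords d x)) =
      Gamma kappa_total / (\<Prod>i=1..d+1. Gamma (\<kappa> i + 1)) *
      (multi_pochhammer (d + 1) (\<lambda>i. \<kappa> i + 1) \<alpha> * (\<Prod>i=1..d+1. Gamma (\<kappa> i + 1)) /
        Gamma (kappa_total + real (\<Sum>i=1..d+1. \<alpha> i)))" .
  have "(\<Prod>i=1..d+1. Gamma (\<kappa> i + 1)) > 0"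
    using k1 by (intro prod_pos) (auto intro!: Gamma_real_pos)
  moreover have "t / x * (m * x / y) = m / (y / t)" if "x > 0" for x y t m :: real
    using that by simp
  ultimately show ?thesis
    unfolding * poch[OF kappa_total_pos] by blast
qed

text \<open>Dirichlet parameters beyond j: under the normalized weight the ratio
  \<open>stick x (Suc j) / stick x j\<close> has a Beta distribution with parameters
  \<open>tail j\<close> and \<kappa>_j + 1.\<close>

definition tail :: "nat \<Rightarrow> real" where "tail j = (\<Sum>i=j+1..d+1. \<kappa> i + 1)"

lemma tail_pos: "j \<le> d \<Longrightarrow> tail j > 0"
proof -
  assume "j \<le> d"
  moreover have "\<kappa> i + 1 > 0" if "i \<in> {1..d+1}" for i
    using kappa[OF that] by simp
  ultimately show ?thesis
    unfolding tail_def by (intro sum_pos) auto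
qed

text \<open>A stick is the product of all ratios before it, so the j-th ratio enters with total
  exponent u_j plus all u_i + v_i with i > j. The ratios being independent, the integral is the
  product of their Beta moments of these orders.\<close>

lemma moment_stick:
  fixes u v :: "nat \<Rightarrow> nat"
  shows "jacobi_int (\<lambda>x. \<Prod>j=1..d. stick x (Suc j) ^ u j * stick x j ^ v j) =
    (\<Prod>j=1..d. pochhammer (tail j) (u j + (\<Sum>i=j+1..d. u i + v i)) /
      pochhammer (tail j + \<kappa> j + 1) (u j + (\<Sum>i=j+1..d. u i + v i)))"
proof -
  \<comment> \<open>Each stick collects its two exponents: \<open>stick x (Suc j)\<close> comes with
    \<open>u j\<close> and, as left stick of the next factor, with \<open>v (Suc j)\<close>. There
    is no factor d + 1, and \<open>v 1\<close> disappears because \<open>stick x 1\<close> is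
    1.\<close>
  define e where "e j = u j + (if j = d then 0 else v (Suc j))" for j
  define K where "K j = u j + (\<Sum>i=j+1..d. u i + v i)" for j
  have k1: "\<kappa> i + 1 > 0" if "i \<in> {1..d+1}" for i
    using kappa[OF that] by simp
  have poch: "pochhammer z n = Gamma (z + real n) / Gamma z" if "z > 0" for z :: real and n
    using that by (intro pochhammer_Gamma) (auto elim!: nonpos_Ints_cases)
  have K: "(\<Sum>i=j..d. e i) = K j" if "j \<in> {1..d}" for j
  proof -
    have "(\<Sum>i=j..d. e i) = (\<Sum>i=j..d. u i) + (\<Sum>i=j..d. if i = d then 0 else v (Suc i))"
      by (simp add: e_def sum.distrib)
    also have "(\<Sum>i=j..d. if i = d then 0 else v (Suc i)) = (\<Sum>i=j..<d. v (Suc i))"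
      by (intro sum.mono_neutral_cong_right) auto
    also have "\<dots> = (\<Sum>i=j+1..d. v i)"
      by (simp add: sum.shift_bounds_Suc_ivl[symmetric] atLeastLessThanSuc_atLeastAtMost)
    also have "(\<Sum>i=j..d. u i) = u j + (\<Sum>i=j+1..d. u i)"
      using that by (simp add: sum.atLeast_Suc_atMost)
    finally show ?thesis by (simp add: K_def sum.distrib)
  qed
  have e: "(\<Prod>j=1..d. stick x (Suc j) ^ e j) = (\<Prod>j=1..d. stick x (Suc j) ^ u j * stick x j ^ v j)" for x
  proof -
    have "(\<Prod>j=1..d. stick x (Suc j) ^ (if j = d then 0 else v (Suc j))) =
        (\<Prod>j=1..<d. stick x (Suc j) ^ v (Suc j))"
      by (intro prod.mono_neutral_cong_right) auto
    also have "\<dots> = (\<Prod>j=2..<Suc d. stick x j ^ v j)"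
      unfolding numeral_2_eq_2 One_nat_def
      by (rule prod.shift_bounds_Suc_ivl[symmetric, where g = "\<lambda>j. stick x j ^ v j"])
    also have "\<dots> = (\<Prod>j=1..d. stick x j ^ v j)"
    proof (intro prod.mono_neutral_left ballI)
      fix j assume "j \<in> {1..d} - {2..<Suc d}"
      then have "j = Suc 0" by auto
      then show "stick x j ^ v j = 1" by simp
    qed auto
    finally show ?thesis by (simp add: e_def power_add prod.distrib)
  qed
  have "jacobi_int (\<lambda>x. \<Prod>j=1..d. stick x (Suc j) ^ u j * stick x j ^ v j) =
      Gamma kappa_total / (\<Prod>i=1..d+1. Gamma (\<kappa> i + 1)) *
      (\<Prod>j=1..d. Beta (\<kappa> j + 1) (real (\<Sum>i=j..d. e i) + tail j))"
    unfolding e[symmetric] using has_moment(2)[of "\<lambda>_. 0" e] by (simp add: monomial_def tail_def)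
  also have "(\<Prod>j=1..d. Beta (\<kappa> j + 1) (real (\<Sum>i=j..d. e i) + tail j)) =
      (\<Prod>j=1..d. Beta (\<kappa> j + 1) (tail j) *
        (pochhammer (tail j) (K j) / pochhammer (tail j + \<kappa> j + 1) (K j)))"
  proof (intro prod.cong refl)
    fix j assume j: "j \<in> {1..d}"
    then have t: "tail j > 0" "\<kappa> j + 1 > 0"
      using tail_pos k1 by auto
    then have "tail j + \<kappa> j + 1 > 0" "tail j + real (K j) > 0" "tail j + \<kappa> j + 1 + real (K j) > 0"
      by linarith+
    then have "Gamma (tail j) > 0" "Gamma (\<kappa> j + 1) > 0" "Gamma (tail j + \<kappa> j + 1) > 0"
      "Gamma (tail j + real (K j)) > 0" "Gamma (tail j + \<kappa> j + 1 + real (K j)) > 0"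
      using t by (auto intro: Gamma_real_pos)
    then show "Beta (\<kappa> j + 1) (real (\<Sum>i=j..d. e i) + tail j) = Beta (\<kappa> j + 1) (tail j) *
        (pochhammer (tail j) (K j) / pochhammer (tail j + \<kappa> j + 1) (K j))"
      unfolding K[OF j] poch[OF t(1)] poch[OF \<open>tail j + \<kappa> j + 1 > 0\<close>] Beta_def
      by (simp add: add_ac)
  qed
  also have "\<dots> = (\<Prod>j=1..d. Beta (\<kappa> j + 1) (tail j)) *
      (\<Prod>j=1..d. pochhammer (tail j) (K j) / pochhammer (tail j + \<kappa> j + 1) (K j))"
    by (rule prod.distrib)
  also have "(\<Prod>j=1..d. Beta (\<kappa> j + 1) (tail j)) =
      (\<Prod>i=1..d+1. Gamma (\<kappa> i + 1)) / Gamma kappa_total"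
    unfolding tail_def kappa_total_eq using k1 by (intro prod_Beta_telescope)
  finally have *: "jacobi_int (\<lambda>x. \<Prod>j=1..d. stick x (Suc j) ^ u j * stick x j ^ v j) =
      Gamma kappa_total / (\<Prod>i=1..d+1. Gamma (\<kappa> i + 1)) *
      ((\<Prod>i=1..d+1. Gamma (\<kappa> i + 1)) / Gamma kappa_total *
      (\<Prod>j=1..d. pochhammer (tail j) (K j) / pochhammer (tail j + \<kappa> j + 1) (K j)))" .
  have "(\<Prod>i=1..d+1. Gamma (\<kappa> i + 1)) > 0"
    using k1 by (intro prod_pos) (auto intro!: Gamma_real_pos)
  moreover have "x / y * (y / x * z) = z" if "y > 0" "x > 0" for x y z :: real
    using that by simp
  ultimately show ?thesis
    unfolding * K_def[symmetric] using Gamma_real_pos[OF kappa_total_pos] by blast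
qed

end

section \<open>Polynomial functions and monomials\<close>

text \<open>Makes span, independence and the exchange lemma available for functions, as the
  dimension count requires.\<close>

global_interpretation fun_space: vector_space "\<lambda>(c :: real) (f :: 'a \<Rightarrow> real) x. c * f x"
  by standard (auto simp: fun_eq_iff algebra_simps)

lemma fun_sum_apply: "(\<Sum>i\<in>I. F i) x = (\<Sum>i\<in>I. F i x :: real)"
  by (induction I rule: infinite_finite_induct) auto

lemma fun_sum_eq: "(\<Sum>i\<in>I. F i) = (\<lambda>x. \<Sum>i\<in>I. F i x :: real)"
  by (simp add: fun_eq_iff fun_sum_apply)

text \<open>Coefficients are indexed by \<open>I\<close> and not by the image, so that families with
  repetitions are covered and sums over multi-indices can be used directly.\<close>

lemma fun_space_span_image:
  fixes F :: "'i \<Rightarrow> 'a \<Rightarrow> real"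
  assumes "finite I"
  shows "fun_space.span (F ` I) = {p. \<exists>c. p = (\<lambda>x. \<Sum>i\<in>I. c i * F i x)}"
proof
  have "fun_space.subspace {p. \<exists>c. p = (\<lambda>x. \<Sum>i\<in>I. c i * F i x)}"
  proof (rule fun_space.subspaceI)
    show "0 \<in> {p. \<exists>c. p = (\<lambda>x. \<Sum>i\<in>I. c i * F i x)}"
      by (auto intro!: exI[of _ "\<lambda>_. 0"])
  next
    fix p q
    assume "p \<in> {p. \<exists>c. p = (\<lambda>x. \<Sum>i\<in>I. c i * F i x)}" "q \<in> {p. \<exists>c. p = (\<lambda>x. \<Sum>i\<in>I. c i * F i x)}"
    then obtain c c' where "p = (\<lambda>x. \<Sum>i\<in>I. c i * F i x)" "q = (\<lambda>x. \<Sum>i\<in>I. c' i * F i x)"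
      by blast
    then have "p + q = (\<lambda>x. \<Sum>i\<in>I. (c i + c' i) * F i x)"
      by (auto simp: fun_eq_iff algebra_simps sum.distrib)
    then show "p + q \<in> {p. \<exists>c. p = (\<lambda>x. \<Sum>i\<in>I. c i * F i x)}"
      by (intro CollectI) (rule exI)
  next
    fix a p
    assume "p \<in> {p. \<exists>c. p = (\<lambda>x. \<Sum>i\<in>I. c i * F i x)}"
    then obtain c where "p = (\<lambda>x. \<Sum>i\<in>I. c i * F i x)"
      by blast
    then have "(\<lambda>x. a * p x) = (\<lambda>x. \<Sum>i\<in>I. (a * c i) * F i x)"
      by (auto simp: fun_eq_iff sum_distrib_left mult_ac)
    then show "(\<lambda>x. a * p x) \<in> {p. \<exists>c. p = (\<lambda>x. \<Sum>i\<in>I. c i * F i x)}"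
      by (intro CollectI) (rule exI)
  qed
  moreover have "F i \<in> {p. \<exists>c. p = (\<lambda>x. \<Sum>i\<in>I. c i * F i x)}" if "i \<in> I" for i
  proof -
    have "F i = (\<lambda>x. \<Sum>j\<in>I. (if j = i then 1 else 0) * F j x)"
    proof
      fix x
      have "(\<Sum>j\<in>I. (if j = i then 1 else 0) * F j x) = (\<Sum>j\<in>I. if j = i then F j x else 0)"
        by (intro sum.cong) auto
      then show "F i x = (\<Sum>j\<in>I. (if j = i then 1 else 0) * F j x)"
        using that assms by simp
    qed
    then show ?thesis by (intro CollectI) (rule exI)
  qed
  ultimately show "fun_space.span (F ` I) \<subseteq> {p. \<exists>c. p = (\<lambda>x. \<Sum>i\<in>I. c i * F i x)}"
    by (intro fun_space.span_minimal) blast+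
next
  show "{p. \<exists>c. p = (\<lambda>x. \<Sum>i\<in>I. c i * F i x)} \<subseteq> fun_space.span (F ` I)"
  proof clarify
    fix c
    have "(\<lambda>x. \<Sum>i\<in>I. c i * F i x) = (\<Sum>i\<in>I. (\<lambda>x. c i * F i x))"
      by (auto simp: fun_eq_iff fun_sum_apply)
    also have "\<dots> \<in> fun_space.span (F ` I)"
      by (intro fun_space.span_sum fun_space.span_scale fun_space.span_base) auto
    finally show "(\<lambda>x. \<Sum>i\<in>I. c i * F i x) \<in> fun_space.span (F ` I)" .
  qed
qed

lemma finite_multi_indices [simp]: "finite (multi_indices m n)"
proof (rule finite_subset)
  show "multi_indices m n \<subseteq> {f. \<forall>i. (i \<in> {1..m} \<longrightarrow> f i \<in> {..n}) \<and> (i \<notin> {1..m} \<longrightarrow> f i = 0)}"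
    by (auto simp: multi_indices_def intro: member_le_sum)
  show "finite {f :: nat \<Rightarrow> nat. \<forall>i. (i \<in> {1..m} \<longrightarrow> f i \<in> {..n}) \<and> (i \<notin> {1..m} \<longrightarrow> f i = 0)}"
    by (rule finite_set_of_finite_funs) auto
qed

lemma multi_indices_le: "\<alpha> \<in> multi_indices m n \<Longrightarrow> i \<in> {1..m} \<Longrightarrow> \<alpha> i \<le> n"
  by (auto simp: multi_indices_def intro: member_le_sum)

lemma multi_indices_disjoint: "m \<noteq> n \<Longrightarrow> multi_indices d m \<inter> multi_indices d n = {}"
  by (auto simp: multi_indices_def)

lemma multi_indices_add:
  "\<alpha> \<in> multi_indices m a \<Longrightarrow> \<beta> \<in> multi_indices m b \<Longrightarrow> (\<lambda>i. \<alpha> i + \<beta> i) \<in> multi_indices m (a + b)"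
  by (auto simp: multi_indices_def sum.distrib)

lemma multi_indices_Suc: "\<alpha> \<in> multi_indices m n \<Longrightarrow> \<alpha> \<in> multi_indices (m + 1) n"
  by (auto simp: multi_indices_def)

lemma monomial_add: "monomial m (\<lambda>i. \<alpha> i + \<beta> i) x = monomial m \<alpha> x * monomial m \<beta> x"
  by (simp add: monomial_def power_add prod.distrib)

lemma monomial_extend_coords:
  "\<gamma> \<in> multi_indices d k \<Longrightarrow> monomial (d + 1) \<gamma> (extend_coords d x) = monomial d \<gamma> x"
  by (simp add: monomial_def multi_indices_def extend_coords_def)

definition low_indices :: "nat \<Rightarrow> nat \<Rightarrow> (nat \<Rightarrow> nat) set" where
  "low_indices d n = (\<Union>k<n. multi_indices d k)"

lemma finite_low_indices [simp]: "finite (low_indices d n)"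
  by (simp add: low_indices_def)

lemma low_indicesE:
  assumes "\<nu> \<in> low_indices d n"
  obtains k where "\<nu> \<in> multi_indices d k" "k < n"
  using assms by (auto simp: low_indices_def)

text \<open>The strict bound gives the zero space for n = 0, so that "orthogonal to all lower
  degrees" and "lower order terms" make uniform sense for every n.\<close>

definition polys_below :: "nat \<Rightarrow> nat \<Rightarrow> ((nat \<Rightarrow> real) \<Rightarrow> real) set" where
  "polys_below d n = fun_space.span (monomial d ` low_indices d n)"

lemma poly_funs_eq: "poly_funs d n = polys_below d (Suc n)"
proof -
  have "(\<Sum>m\<le>n. \<Sum>\<alpha>\<in>multi_indices d m. c \<alpha> * monomial d \<alpha> x) =
      (\<Sum>\<alpha>\<in>low_indices d (Suc n). c \<alpha> * monomial d \<alpha> x)" for c x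
    unfolding low_indices_def lessThan_Suc_atMost
    by (rule sum.UNION_disjoint[symmetric]) (auto simp: multi_indices_disjoint)
  then show ?thesis
    unfolding poly_funs_def polys_below_def fun_space_span_image[OF finite_low_indices] by simp
qed

lemma polys_below_mono: "m \<le> n \<Longrightarrow> polys_below d m \<subseteq> polys_below d n"
  unfolding polys_below_def low_indices_def by (intro fun_space.span_mono) fastforce

lemma monomial_in_polys_below: "\<alpha> \<in> multi_indices d m \<Longrightarrow> m < n \<Longrightarrow> monomial d \<alpha> \<in> polys_below d n"
  unfolding polys_below_def low_indices_def by (intro fun_space.span_base) auto

lemma polys_below_add:
  "f \<in> polys_below d n \<Longrightarrow> g \<in> polys_below d n \<Longrightarrow> (\<lambda>x. f x + g x) \<in> polys_below d n"
  unfolding polys_below_def using fun_space.span_add[of f _ g] by (simp add: plus_fun_def)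

lemma polys_below_scale: "f \<in> polys_below d n \<Longrightarrow> (\<lambda>x. c * f x) \<in> polys_below d n"
  unfolding polys_below_def by (rule fun_space.span_scale)

lemma polys_below_diff:
  "f \<in> polys_below d n \<Longrightarrow> g \<in> polys_below d n \<Longrightarrow> (\<lambda>x. f x - g x) \<in> polys_below d n"
  using polys_below_add[OF _ polys_below_scale[of g d n "-1"], of f] by simp

lemma polys_below_sum:
  "(\<And>i. i \<in> I \<Longrightarrow> F i \<in> polys_below d n) \<Longrightarrow> (\<lambda>x. \<Sum>i\<in>I. F i x) \<in> polys_below d n"
  unfolding polys_below_def using fun_space.span_sum[of I F "monomial d ` low_indices d n"]
  by (simp add: fun_sum_eq)

lemma polys_belowE:
  assumes "f \<in> polys_below d n"
  obtains c where "f = (\<lambda>x. \<Sum>\<alpha>\<in>low_indices d n. c \<alpha> * monomial d \<alpha> x)"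
  using assms unfolding polys_below_def fun_space_span_image[OF finite_low_indices] by blast

lemma poly_funs_mono: "m \<le> n \<Longrightarrow> poly_funs d m \<subseteq> poly_funs d n"
  by (simp add: poly_funs_eq polys_below_mono)

lemma poly_funs_mult:
  assumes "f \<in> poly_funs d a" "g \<in> poly_funs d b"
  shows "(\<lambda>x. f x * g x) \<in> poly_funs d (a + b)"
proof -
  obtain c where f: "f = (\<lambda>x. \<Sum>\<alpha>\<in>low_indices d (Suc a). c \<alpha> * monomial d \<alpha> x)"
    using assms(1) unfolding poly_funs_eq by (rule polys_belowE)
  obtain c' where g: "g = (\<lambda>x. \<Sum>\<alpha>\<in>low_indices d (Suc b). c' \<alpha> * monomial d \<alpha> x)"
    using assms(2) unfolding poly_funs_eq by (rule polys_belowE)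
  have "(\<lambda>x. f x * g x) = (\<lambda>x. \<Sum>\<alpha>\<in>low_indices d (Suc a). \<Sum>\<beta>\<in>low_indices d (Suc b).
      (c \<alpha> * c' \<beta>) * monomial d (\<lambda>i. \<alpha> i + \<beta> i) x)"
    unfolding f g sum_product monomial_add by (simp add: mult_ac)
  also have "\<dots> \<in> polys_below d (Suc (a + b))"
  proof (intro polys_below_sum polys_below_scale)
    fix \<alpha> \<beta> assume "\<alpha> \<in> low_indices d (Suc a)" "\<beta> \<in> low_indices d (Suc b)"
    then obtain k l where "\<alpha> \<in> multi_indices d k" "k \<le> a" "\<beta> \<in> multi_indices d l" "l \<le> b"
      by (auto simp: low_indices_def less_Suc_eq_le)
    then show "monomial d (\<lambda>i. \<alpha> i + \<beta> i) \<in> polys_below d (Suc (a + b))"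
      by (intro monomial_in_polys_below[OF multi_indices_add]) auto
  qed
  finally show ?thesis by (simp add: poly_funs_eq)
qed

lemma poly_funs_const: "(\<lambda>_. c) \<in> poly_funs d n"
proof -
  have "monomial d (\<lambda>_. 0) \<in> polys_below d (Suc n)"
    by (intro monomial_in_polys_below[of _ _ 0]) (auto simp: multi_indices_def)
  from polys_below_scale[OF this, of c] show ?thesis
    by (simp add: poly_funs_eq monomial_def)
qed

lemma poly_funs_coord:
  assumes "i \<in> {1..d}"
  shows "(\<lambda>x. x i) \<in> poly_funs d 1"
proof -
  have "monomial d (\<lambda>j. if j = i then 1 else 0) \<in> polys_below d 2"
    using assms by (intro monomial_in_polys_below[of _ _ 1]) (auto simp: multi_indices_def sum.delta)
  also have "monomial d (\<lambda>j. if j = i then 1 else 0) = (\<lambda>x. x i)"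
  proof
    fix x :: "nat \<Rightarrow> real"
    have "(\<Prod>j=1..d. x j ^ (if j = i then 1 else 0)) = (\<Prod>j=1..d. if j = i then x j else 1)"
      by (intro prod.cong) auto
    then show "monomial d (\<lambda>j. if j = i then 1 else 0) x = x i"
      using assms by (simp add: monomial_def prod.delta)
  qed
  finally show ?thesis by (simp add: poly_funs_eq numeral_2_eq_2)
qed

lemma poly_funs_power: "f \<in> poly_funs d a \<Longrightarrow> (\<lambda>x. f x ^ k) \<in> poly_funs d (a * k)"
proof (induction k)
  case 0
  then show ?case by (simp add: poly_funs_const)
next
  case (Suc k)
  then show ?case using poly_funs_mult[of f d a "\<lambda>x. f x ^ k" "a * k"] by simp
qed

lemma poly_funs_prod:
  "(\<And>i. i \<in> I \<Longrightarrow> F i \<in> poly_funs d (a i)) \<Longrightarrow>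
    (\<lambda>x. \<Prod>i\<in>I. F i x) \<in> poly_funs d (\<Sum>i\<in>I. a i)"
proof (induction I rule: infinite_finite_induct)
  case (insert i I)
  then show ?case using poly_funs_mult[of "F i" d "a i" "\<lambda>x. \<Prod>i\<in>I. F i x"] by simp
qed (simp_all add: poly_funs_const)

lemma poly_funs_sum: "(\<And>i. i \<in> I \<Longrightarrow> F i \<in> poly_funs d n) \<Longrightarrow> (\<lambda>x. \<Sum>i\<in>I. F i x) \<in> poly_funs d n"
  unfolding poly_funs_eq by (rule polys_below_sum)

lemma poly_funs_extend_coords:
  assumes "i \<in> {1..d+1}"
  shows "(\<lambda>x. extend_coords d x i) \<in> poly_funs d 1"
proof (cases "i = d + 1")
  case True
  have "(\<lambda>x. 1 - (\<Sum>j=1..d. x j)) \<in> poly_funs d 1"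
    using poly_funs_const[of 1 d 1] poly_funs_sum[of "{1..d}" "\<lambda>i x. x i" d 1, OF poly_funs_coord]
    unfolding poly_funs_eq by (rule polys_below_diff)
  then show ?thesis using True by (simp add: extend_coords_def)
next
  case False
  then show ?thesis using assms poly_funs_coord[of i d] by (simp add: extend_coords_def)
qed

lemma poly_funs_monomial_extend_coords:
  assumes "\<alpha> \<in> multi_indices (d + 1) N"
  shows "(\<lambda>x. monomial (d + 1) \<alpha> (extend_coords d x)) \<in> poly_funs d N"
proof -
  have "(\<lambda>x. \<Prod>i=1..d+1. extend_coords d x i ^ \<alpha> i) \<in> poly_funs d (\<Sum>i=1..d+1. 1 * \<alpha> i)"
    by (intro poly_funs_prod poly_funs_power poly_funs_extend_coords)
  then show ?thesis using assms by (simp add: monomial_def multi_indices_def)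
qed

text \<open>Uniqueness of digits in base \<open>B\<close>. The digits up to position m sum to less
  than B^(m+1), so reduction modulo that power separates them from the top digit.\<close>

lemma base_digits_inj:
  fixes \<alpha> \<beta> :: "nat \<Rightarrow> nat"
  assumes "\<And>i. i \<in> {1..m} \<Longrightarrow> \<alpha> i < B" "\<And>i. i \<in> {1..m} \<Longrightarrow> \<beta> i < B"
    and "(\<Sum>i=1..m. \<alpha> i * B ^ i) = (\<Sum>i=1..m. \<beta> i * B ^ i)" "i \<in> {1..m}"
  shows "\<alpha> i = \<beta> i"
  using assms
proof (induction m arbitrary: i)
  case 0
  then show ?case by simp
next
  case (Suc m)
  have less: "(\<Sum>i=1..n. \<gamma> i * B ^ i) < B ^ Suc n"
    if "\<And>i. i \<in> {1..n} \<Longrightarrow> \<gamma> i < B" for n and \<gamma> :: "nat \<Rightarrow> nat"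
    using that
  proof (induction n)
    case 0
    then show ?case using Suc.prems(1)[of 1] by simp
  next
    case (Suc n)
    have "Suc (\<gamma> (Suc n)) * B ^ Suc n \<le> B * B ^ Suc n"
      using Suc.prems[of "Suc n"] by (intro mult_right_mono) auto
    moreover have "(\<Sum>i=1..n. \<gamma> i * B ^ i) < B ^ Suc n"
      using Suc by simp
    ultimately show ?case by simp
  qed
  define S T where "S = (\<Sum>i=1..m. \<alpha> i * B ^ i)" and "T = (\<Sum>i=1..m. \<beta> i * B ^ i)"
  have ST: "S < B ^ Suc m" "T < B ^ Suc m"
    unfolding S_def T_def using Suc.prems(1,2) by (intro less; simp)+
  have eq: "S + \<alpha> (Suc m) * B ^ Suc m = T + \<beta> (Suc m) * B ^ Suc m"
    using Suc.prems(3) by (simp add: S_def T_def)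
  have "(S + \<alpha> (Suc m) * B ^ Suc m) mod B ^ Suc m = S"
       "(T + \<beta> (Suc m) * B ^ Suc m) mod B ^ Suc m = T"
    using ST by (simp_all del: power_Suc)
  with eq have "S = T" by argo
  moreover have "\<alpha> (Suc m) = \<beta> (Suc m)"
    using eq \<open>S = T\<close> Suc.prems(1)[of "Suc m"] by auto
  ultimately show ?case
    using Suc.IH[of i] Suc.prems by (cases "i = Suc m") (auto simp: S_def T_def)
qed

text \<open>Substituting \<open>t ^ B ^ i\<close> for \<open>y i\<close> with a large \<open>B\<close> separates the monomials.\<close>

lemma monomials_independent:
  assumes "\<And>y. (\<And>i. i \<in> {1..m} \<Longrightarrow> y i > 0) \<Longrightarrow> (\<Sum>\<alpha>\<in>multi_indices m N. c \<alpha> * monomial m \<alpha> y) = 0"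
    and "\<alpha> \<in> multi_indices m N"
  shows "c \<alpha> = 0"
proof -
  \<comment> \<open>Base N + 1 suffices: every component of a multi-index of total N is at most N,
    hence a digit.\<close>
  define e where "e \<alpha> = (\<Sum>i=1..m. \<alpha> i * Suc N ^ i)" for \<alpha> :: "nat \<Rightarrow> nat"
  define q where "q = (\<Sum>\<alpha>\<in>multi_indices m N. monom (c \<alpha>) (e \<alpha>))"
  have inj: "\<beta> = \<alpha>" if "\<beta> \<in> multi_indices m N" "e \<beta> = e \<alpha>" for \<beta>
  proof
    fix i
    show "\<beta> i = \<alpha> i"
    proof (cases "i \<in> {1..m}")
      case True
      show ?thesis
        by (rule base_digits_inj[of m \<beta> "Suc N" \<alpha>])
          (use that assms(2) True in \<open>auto simp: e_def less_Suc_eq_le multi_indices_le\<close>)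
    next
      case False
      then show ?thesis using that assms(2) by (simp add: multi_indices_def)
    qed
  qed
  have "poly q t = 0" if "t > 0" for t
  proof -
    have "poly q t = (\<Sum>\<alpha>\<in>multi_indices m N. c \<alpha> * monomial m \<alpha> (\<lambda>i. t ^ Suc N ^ i))"
      unfolding q_def e_def
      by (simp add: poly_sum poly_monom monomial_def power_sum mult.commute power_mult[symmetric])
    also have "\<dots> = 0"
      using that by (intro assms(1)) simp
    finally show ?thesis .
  qed
  then have "{0<..} \<subseteq> {t. poly q t = 0}" by auto
  then have "infinite {t. poly q t = 0}"
    using infinite_Ioi[of "0 :: real"] finite_subset by blast
  then have "q = 0" using poly_roots_finite by blast
  then have "0 = coeff q (e \<alpha>)" by simp
  also have "\<dots> = (\<Sum>\<beta>\<in>multi_indices m N. if e \<beta> = e \<alpha> then c \<beta> else 0)"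
    by (simp add: q_def coeff_sum)
  also have "\<dots> = (\<Sum>\<beta>\<in>multi_indices m N. if \<beta> = \<alpha> then c \<beta> else 0)"
    by (intro sum.cong) (auto dest: inj)
  also have "\<dots> = c \<alpha>" using assms(2) by simp
  finally show ?thesis by simp
qed

section \<open>The multinomial theorem and falling factorials\<close>

lemma sum_multi_indices_Suc:
  fixes g :: "(nat \<Rightarrow> nat) \<Rightarrow> real"
  shows "(\<Sum>\<alpha>\<in>multi_indices (Suc m) N. g \<alpha>) =
    (\<Sum>k\<le>N. \<Sum>\<beta>\<in>multi_indices m k. g (\<beta>(Suc m := N - k)))"
proof -
  have "(\<Sum>k\<le>N. \<Sum>\<beta>\<in>multi_indices m k. g (\<beta>(Suc m := N - k))) =
      (\<Sum>(k, \<beta>)\<in>Sigma {..N} (multi_indices m). g (\<beta>(Suc m := N - k)))"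
    by (intro sum.Sigma) auto
  also have "\<dots> = (\<Sum>\<alpha>\<in>multi_indices (Suc m) N. g \<alpha>)"
  proof (rule sum.reindex_bij_witness[where i = "\<lambda>\<alpha>. (\<Sum>i=1..m. \<alpha> i, \<alpha>(Suc m := 0))"
        and j = "\<lambda>(k, \<beta>). \<beta>(Suc m := N - k)"])
    have s: "(\<Sum>i=1..m. (\<beta>(Suc m := z)) i) = (\<Sum>i=1..m. \<beta> i)" for \<beta> :: "nat \<Rightarrow> nat" and z
      by (intro sum.cong) auto
    fix a assume "a \<in> Sigma {..N} (multi_indices m)"
    then obtain k \<beta> where a: "a = (k, \<beta>)" "k \<le> N" "\<beta> \<in> multi_indices m k" by auto
    then have "\<beta> (Suc m) = 0" "(\<Sum>i=1..m. \<beta> i) = k"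
      by (auto simp: multi_indices_def)
    then show "(\<lambda>\<alpha>. (\<Sum>i=1..m. \<alpha> i, \<alpha>(Suc m := 0))) ((\<lambda>(k, \<beta>). \<beta>(Suc m := N - k)) a) = a"
      using a s[of \<beta> "N - k"] by (auto simp: fun_eq_iff)
    show "(\<lambda>(k, \<beta>). \<beta>(Suc m := N - k)) a \<in> multi_indices (Suc m) N"
      using a s[of \<beta> "N - k"] by (auto simp: multi_indices_def)
    show "g ((\<lambda>(k, \<beta>). \<beta>(Suc m := N - k)) a) = (case a of (k, \<beta>) \<Rightarrow> g (\<beta>(Suc m := N - k)))"
      by (simp add: a)
  next
    have s: "(\<Sum>i=1..m. (\<beta>(Suc m := z)) i) = (\<Sum>i=1..m. \<beta> i)" for \<beta> :: "nat \<Rightarrow> nat" and z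
      by (intro sum.cong) auto
    fix \<alpha> assume \<alpha>: "\<alpha> \<in> multi_indices (Suc m) N"
    then have N: "(\<Sum>i=1..m. \<alpha> i) + \<alpha> (Suc m) = N" by (simp add: multi_indices_def)
    then show "(\<lambda>(k, \<beta>). \<beta>(Suc m := N - k)) (\<Sum>i=1..m. \<alpha> i, \<alpha>(Suc m := 0)) = \<alpha>"
      by (auto simp: fun_eq_iff)
    show "(\<Sum>i=1..m. \<alpha> i, \<alpha>(Suc m := 0)) \<in> Sigma {..N} (multi_indices m)"
      using \<alpha> N s[of \<alpha> 0] by (auto simp: multi_indices_def)
  qed
  finally show ?thesis by simp
qed

lemma multinomial_theorem:
  "(\<Sum>i=1..m. y i) ^ N =
    (\<Sum>\<alpha>\<in>multi_indices m N. fact N / multi_fact m \<alpha> * monomial m \<alpha> y)"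
proof (induction m arbitrary: N)
  case 0
  have "multi_indices 0 N = (if N = 0 then {\<lambda>_. 0} else {})"
    by (auto simp: multi_indices_def)
  then show ?case by (simp add: multi_fact_def monomial_def)
next
  case (Suc m)
  have upd: "multi_fact (Suc m) (\<beta>(Suc m := l)) = multi_fact m \<beta> * fact l"
    "monomial (Suc m) (\<beta>(Suc m := l)) y = monomial m \<beta> y * y (Suc m) ^ l" for \<beta> l
    unfolding multi_fact_def monomial_def by (auto intro!: prod.cong)
  have "(\<Sum>i=1..Suc m. y i) ^ N =
      (\<Sum>k\<le>N. real (N choose k) * (\<Sum>i=1..m. y i) ^ k * y (Suc m) ^ (N - k))"
    by (simp add: binomial_ring)
  also have "\<dots> = (\<Sum>k\<le>N. \<Sum>\<beta>\<in>multi_indices m k.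
      fact N / multi_fact (Suc m) (\<beta>(Suc m := N - k)) * monomial (Suc m) (\<beta>(Suc m := N - k)) y)"
    unfolding Suc.IH upd sum_distrib_left sum_distrib_right
    by (intro sum.cong refl) (simp add: binomial_fact mult_ac)
  finally show ?case by (simp only: sum_multi_indices_Suc)
qed

text \<open>The falling factorial n (n - 1) ... (n - k + 1), written so that it vanishes for k > n
  without truncated subtraction.\<close>

definition falling :: "nat \<Rightarrow> nat \<Rightarrow> real" where
  "falling n k = real (n choose k) * fact k"

lemma falling_0 [simp]: "falling n 0 = 1"
  by (simp add: falling_def)

lemma falling_eq: "k \<le> n \<Longrightarrow> falling n k = fact n / fact (n - k)"
  by (simp add: falling_def binomial_fact)

lemma falling_eq_0: "n < k \<Longrightarrow> falling n k = 0"
  by (simp add: falling_def)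

lemma mult_falling: "real n * falling n k = falling n (Suc k) + real k * falling n k"
proof (cases "k < n")
  case True
  then have "fact (n - k) = real (n - k) * fact (n - Suc k)"
    by (metis Suc_diff_Suc fact_Suc of_nat_mult of_nat_fact)
  then have "falling n (Suc k) = real (n - k) * falling n k"
    using True by (simp add: falling_eq)
  then show ?thesis
    using True by (simp add: of_nat_diff left_diff_distrib)
next
  case False
  then show ?thesis
    by (cases "n = k") (auto simp: falling_eq_0)
qed

text \<open>(a + n)_g is a monic polynomial of degree g in n, and falling factorials are monic too.
  The leading coefficient 1 is all that the eigenvalue of the Durrmeyer operator takes from this
  expansion; the others only affect lower degrees.\<close>

lemma pochhammer_falling_expansion:
  "\<exists>c. c g = 1 \<and> (\<forall>n. pochhammer (a + real n) g = (\<Sum>j\<le>g. c j * falling n j))"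
proof (induction g)
  case 0
  then show ?case by (intro exI[of _ "\<lambda>_. 1"]) simp
next
  case (Suc g)
  then obtain c where c: "c g = 1" "\<And>n. pochhammer (a + real n) g = (\<Sum>j\<le>g. c j * falling n j)"
    by blast
  \<comment> \<open>By \<open>mult_falling\<close>, the new factor a + g + n sends
    \<open>falling n j\<close> to \<open>falling n (Suc j)\<close> plus (a + g + j) times itself;
    \<open>c'\<close> collects both contributions.\<close>
  define c' where "c' j = (if j = 0 then 0 else c (j - 1)) + (if j \<le> g then c j * (a + real g + real j) else 0)"
    for j
  have "pochhammer (a + real n) (Suc g) = (\<Sum>j\<le>Suc g. c' j * falling n j)" for n
  proof -
    have "pochhammer (a + real n) (Suc g) = (\<Sum>j\<le>g. c j * (falling n j * (a + real g + real n)))"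
      unfolding pochhammer_Suc c(2) sum_distrib_right by (simp add: algebra_simps)
    also have "\<dots> = (\<Sum>j\<le>g. c j * falling n (Suc j) + c j * (a + real g + real j) * falling n j)"
    proof (intro sum.cong refl)
      fix j
      have "falling n j * (a + real g + real n) = falling n (Suc j) + (a + real g + real j) * falling n j"
        using mult_falling[of n j] by (simp add: algebra_simps)
      then show "c j * (falling n j * (a + real g + real n)) =
          c j * falling n (Suc j) + c j * (a + real g + real j) * falling n j"
        by (simp add: algebra_simps)
    qed
    also have "\<dots> = (\<Sum>j\<le>g. c j * falling n (Suc j)) + (\<Sum>j\<le>g. c j * (a + real g + real j) * falling n j)"
      by (rule sum.distrib)
    also have "(\<Sum>j\<le>g. c j * falling n (Suc j)) =
        (\<Sum>j\<le>Suc g. (if j = 0 then 0 else c (j - 1)) * falling n j)"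
      by (subst sum.atMost_Suc_shift) simp
    also have "(\<Sum>j\<le>g. c j * (a + real g + real j) * falling n j) =
        (\<Sum>j\<le>Suc g. (if j \<le> g then c j * (a + real g + real j) else 0) * falling n j)"
      by (intro sum.mono_neutral_cong_left) auto
    finally show ?thesis
      unfolding sum.distrib[symmetric] distrib_right[symmetric] c'_def .
  qed
  moreover have "c' (Suc g) = 1" by (simp add: c'_def c)
  ultimately show ?case by blast
qed

text \<open>The multinomial theorem under the operator y^gamma times the partial derivative of order
  gamma: it multiplies y^alpha by the product of the falling factorials, and sends |y|^N to
  \<open>falling N k\<close> y^gamma |y|^(N-k). The proof shifts the summation by gamma instead of
  differentiating.\<close>

lemma multinomial_falling:
  assumes \<gamma>: "\<gamma> \<in> multi_indices m k" and k: "k \<le> N"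
  shows "(\<Sum>\<alpha>\<in>multi_indices m N. fact N / multi_fact m \<alpha> *
      (\<Prod>i=1..m. falling (\<alpha> i) (\<gamma> i)) * monomial m \<alpha> y) =
    falling N k * monomial m \<gamma> y * (\<Sum>i=1..m. y i) ^ (N - k)"
proof -
  let ?g = "\<lambda>\<alpha>. fact N / multi_fact m \<alpha> * (\<Prod>i=1..m. falling (\<alpha> i) (\<gamma> i)) * monomial m \<alpha> y"
  have "(\<Sum>\<alpha>\<in>multi_indices m N. ?g \<alpha>) =
      (\<Sum>\<alpha>\<in>{\<alpha>\<in>multi_indices m N. \<forall>i\<in>{1..m}. \<gamma> i \<le> \<alpha> i}. ?g \<alpha>)"
  proof (intro sum.mono_neutral_right ballI)
    fix \<alpha> assume "\<alpha> \<in> multi_indices m N - {\<alpha> \<in> multi_indices m N. \<forall>i\<in>{1..m}. \<gamma> i \<le> \<alpha> i}"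
    then obtain i where "i \<in> {1..m}" "\<alpha> i < \<gamma> i" by force
    then have "(\<Prod>i=1..m. falling (\<alpha> i) (\<gamma> i)) = 0"
      using falling_eq_0[of "\<alpha> i" "\<gamma> i"] by (intro prod_zero) auto
    then show "?g \<alpha> = 0" by simp
  qed auto
  also have "\<dots> = (\<Sum>\<beta>\<in>multi_indices m (N - k).
      falling N k * monomial m \<gamma> y * (fact (N - k) / multi_fact m \<beta> * monomial m \<beta> y))"
  proof (rule sum.reindex_bij_witness[where j = "\<lambda>\<alpha> i. \<alpha> i - \<gamma> i" and i = "\<lambda>\<beta> i. \<gamma> i + \<beta> i"])
    fix \<alpha> assume \<alpha>: "\<alpha> \<in> {\<alpha>\<in>multi_indices m N. \<forall>i\<in>{1..m}. \<gamma> i \<le> \<alpha> i}"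
    then have le: "\<gamma> i \<le> \<alpha> i" for i
      using \<gamma> by (cases "i \<in> {1..m}") (auto simp: multi_indices_def)
    then show inv: "(\<lambda>i. \<gamma> i + (\<alpha> i - \<gamma> i)) = \<alpha>" by simp
    have "(\<Sum>i=1..m. \<alpha> i - \<gamma> i) = (\<Sum>i=1..m. \<alpha> i) - (\<Sum>i=1..m. \<gamma> i)"
      using le by (intro sum_subtractf_nat) auto
    then show "(\<lambda>i. \<alpha> i - \<gamma> i) \<in> multi_indices m (N - k)"
      using \<alpha> \<gamma> by (auto simp: multi_indices_def)
    have "(\<Prod>i=1..m. falling (\<alpha> i) (\<gamma> i)) = multi_fact m \<alpha> / multi_fact m (\<lambda>i. \<alpha> i - \<gamma> i)"
      using le by (simp add: falling_eq multi_fact_def prod_dividef)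
    moreover have "multi_fact m \<alpha> \<noteq> 0" "multi_fact m (\<lambda>i. \<alpha> i - \<gamma> i) \<noteq> 0"
      by (simp_all add: multi_fact_def)
    moreover have "monomial m \<alpha> y = monomial m \<gamma> y * monomial m (\<lambda>i. \<alpha> i - \<gamma> i) y"
      using monomial_add[of m \<gamma> "\<lambda>i. \<alpha> i - \<gamma> i" y] by (simp add: inv)
    ultimately show "falling N k * monomial m \<gamma> y *
        (fact (N - k) / multi_fact m (\<lambda>i. \<alpha> i - \<gamma> i) * monomial m (\<lambda>i. \<alpha> i - \<gamma> i) y) = ?g \<alpha>"
      using k by (simp add: falling_eq)
  next
    fix \<beta> assume \<beta>: "\<beta> \<in> multi_indices m (N - k)"
    show "(\<lambda>i. \<gamma> i + \<beta> i - \<gamma> i) = \<beta>" by simp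
    show "(\<lambda>i. \<gamma> i + \<beta> i) \<in> {\<alpha> \<in> multi_indices m N. \<forall>i\<in>{1..m}. \<gamma> i \<le> \<alpha> i}"
      using multi_indices_add[OF \<gamma> \<beta>] k by auto
  qed
  also have "\<dots> = falling N k * monomial m \<gamma> y * (\<Sum>i=1..m. y i) ^ (N - k)"
    unfolding multinomial_theorem[of y m "N - k"] sum_distrib_left ..
  finally show ?thesis .
qed

section \<open>Orthogonality of the Jacobi polynomials\<close>

lemma poly_funs_scale: "f \<in> poly_funs d n \<Longrightarrow> (\<lambda>x. c * f x) \<in> poly_funs d n"
  unfolding poly_funs_eq by (rule polys_below_scale)

lemma poly_funs_stick:
  assumes "j \<le> Suc d"
  shows "(\<lambda>x. stick x j) \<in> poly_funs d 1"
proof -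
  have "(\<lambda>x. \<Sum>i=1..<j. x i) \<in> poly_funs d 1"
    using assms by (intro poly_funs_sum poly_funs_coord) auto
  with poly_funs_const[of 1 d 1] show ?thesis
    unfolding poly_funs_eq stick_def by (rule polys_below_diff)
qed

text \<open>With s = \<open>stick x j\<close> the difference s - x_j is the next stick, so each
  factor is a homogeneous form in two consecutive sticks.\<close>

lemma simplex_jacobi_stick:
  "simplex_jacobi d \<kappa> \<nu> x =
    (\<Prod>j=1..d. \<Sum>k\<le>\<nu> j. jacobi_coeff (\<nu> j) (jacobi_param d \<kappa> \<nu> j) (\<kappa> j) k *
      (stick x (Suc j) ^ k * stick x j ^ (\<nu> j - k)))"
  unfolding simplex_jacobi_def jacobi_homogeneous_def
  by (intro prod.cong sum.cong refl) (simp add: stick_Suc jacobi_coeff_def, simp add: stick_def)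

lemma poly_funs_simplex_jacobi:
  assumes "\<nu> \<in> multi_indices d n"
  shows "simplex_jacobi d \<kappa> \<nu> \<in> poly_funs d n"
proof -
  have "(\<lambda>x. stick x (Suc j) ^ k * stick x j ^ (\<nu> j - k)) \<in> poly_funs d (\<nu> j)"
    if "j \<in> {1..d}" "k \<le> \<nu> j" for j k
    using poly_funs_mult[OF poly_funs_power[OF poly_funs_stick[of "Suc j" d], of k]
        poly_funs_power[OF poly_funs_stick[of j d], of "\<nu> j - k"]] that by simp
  then have "simplex_jacobi d \<kappa> \<nu> \<in> poly_funs d (\<Sum>j=1..d. \<nu> j)"
    unfolding simplex_jacobi_stick[abs_def]
    by (intro poly_funs_prod poly_funs_sum poly_funs_scale) auto
  then show ?thesis using assms by (simp add: multi_indices_def)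
qed

context jacobi_weight
begin

lemma jacobi_int_eq:
  "jacobi_int h = Gamma kappa_total / (\<Prod>i=1..d+1. Gamma (\<kappa> i + 1)) *
    (\<integral>x. indicator (unit_simplex d) x *\<^sub>R (h x * weight d \<kappa> x) \<partial>(\<Pi>\<^sub>M i\<in>{1..d}. lborel))"
  by (simp add: jacobi_int_def jacobi_inner_def set_lebesgue_integral_def kappa_total_def)

lemma jacobi_integrable_sum:
  assumes "\<And>i. i \<in> I \<Longrightarrow> jacobi_integrable (F i)"
  shows "jacobi_integrable (\<lambda>x. \<Sum>i\<in>I. c i * F i x)"
    and "jacobi_int (\<lambda>x. \<Sum>i\<in>I. c i * F i x) = (\<Sum>i\<in>I. c i * jacobi_int (F i))"
proof -
  let ?M = "\<Pi>\<^sub>M i\<in>{1..d}. lborel :: real measure"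
  let ?G = "\<lambda>h x. indicator (unit_simplex d) x *\<^sub>R (h x * weight d \<kappa> x) :: real"
  have eq: "?G (\<lambda>x. \<Sum>i\<in>I. c i * F i x) = (\<lambda>x. \<Sum>i\<in>I. c i * ?G (F i) x)"
    by (simp add: fun_eq_iff sum_distrib_left sum_distrib_right mult_ac)
  have int: "integrable ?M (?G (F i))" if "i \<in> I" for i
    using assms[OF that] by (simp add: jacobi_integrable_def set_integrable_def)
  show "jacobi_integrable (\<lambda>x. \<Sum>i\<in>I. c i * F i x)"
    unfolding jacobi_integrable_def set_integrable_def eq
    by (intro Bochner_Integration.integrable_sum integrable_mult_right int)
  have "integral\<^sup>L ?M (\<lambda>x. \<Sum>i\<in>I. c i * ?G (F i) x) = (\<Sum>i\<in>I. integral\<^sup>L ?M (\<lambda>x. c i * ?G (F i) x))"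
    by (intro Bochner_Integration.integral_sum integrable_mult_right int)
  also have "\<dots> = (\<Sum>i\<in>I. c i * integral\<^sup>L ?M (?G (F i)))"
    by (intro sum.cong refl Bochner_Integration.integral_mult_right int)
  finally show "jacobi_int (\<lambda>x. \<Sum>i\<in>I. c i * F i x) = (\<Sum>i\<in>I. c i * jacobi_int (F i))"
    unfolding jacobi_int_eq eq by (simp add: sum_distrib_left mult_ac)
qed

lemma jacobi_integrable_poly:
  assumes "f \<in> poly_funs d n"
  shows "jacobi_integrable f"
proof -
  obtain c where f: "f = (\<lambda>x. \<Sum>\<alpha>\<in>low_indices d (Suc n). c \<alpha> * monomial d \<alpha> x)"
    using assms unfolding poly_funs_eq by (rule polys_belowE)
  have "jacobi_integrable (monomial d \<alpha>)" if "\<alpha> \<in> low_indices d (Suc n)" for \<alpha>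
  proof -
    obtain k where "\<alpha> \<in> multi_indices d k"
      using \<open>\<alpha> \<in> low_indices d (Suc n)\<close> by (rule low_indicesE)
    then show ?thesis
      using has_moment(1)[of \<alpha> "\<lambda>_. 0"] unfolding monomial_extend_coords[OF \<open>\<alpha> \<in> multi_indices d k\<close>]
      by simp
  qed
  then show ?thesis
    unfolding f by (rule jacobi_integrable_sum(1))
qed

lemma jacobi_int_scale:
  "jacobi_integrable f \<Longrightarrow> jacobi_int (\<lambda>x. c * f x) = c * jacobi_int f"
  using jacobi_integrable_sum(2)[of "{()}" "\<lambda>_. f" "\<lambda>_. c"] by simp

lemma jacobi_int_diff:
  assumes "jacobi_integrable f" "jacobi_integrable g"
  shows "jacobi_int (\<lambda>x. f x - g x) = jacobi_int f - jacobi_int g"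
  using jacobi_integrable_sum(2)[of "{True, False}" "\<lambda>b. if b then f else g" "\<lambda>b. if b then 1 else - 1"]
    assms by simp

lemma jacobi_int_sum_mult:
  assumes "\<And>i. i \<in> I \<Longrightarrow> F i \<in> poly_funs d n" "g \<in> poly_funs d m"
  shows "jacobi_int (\<lambda>x. (\<Sum>i\<in>I. c i * F i x) * g x) = (\<Sum>i\<in>I. c i * jacobi_int (\<lambda>x. F i x * g x))"
proof -
  have "jacobi_integrable (\<lambda>x. F i x * g x)" if "i \<in> I" for i
    using poly_funs_mult[OF assms(1)[OF that] assms(2)] by (rule jacobi_integrable_poly)
  from jacobi_integrable_sum(2)[OF this, where c=c] show ?thesis
    by (simp add: sum_distrib_right mult.assoc)
qed

abbreviation jacobi_poly :: "(nat \<Rightarrow> nat) \<Rightarrow> (nat \<Rightarrow> real) \<Rightarrow> real" where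
  "jacobi_poly \<equiv> simplex_jacobi d \<kappa>"

abbreviation coeff_at :: "(nat \<Rightarrow> nat) \<Rightarrow> nat \<Rightarrow> nat \<Rightarrow> real" where
  "coeff_at \<nu> j \<equiv> jacobi_coeff (\<nu> j) (jacobi_param d \<kappa> \<nu> j) (\<kappa> j)"

text \<open>The univariate integral over the j-th ratio of sticks. The shift of the moment order is
  due to the later factors: being homogeneous in sticks, each contributes its whole degree \<nu>_i +
  \<mu>_i as a power of this ratio.\<close>

definition jacobi_factor :: "(nat \<Rightarrow> nat) \<Rightarrow> (nat \<Rightarrow> nat) \<Rightarrow> nat \<Rightarrow> real" where
  "jacobi_factor \<nu> \<mu> j = (\<Sum>l\<le>\<mu> j. \<Sum>k\<le>\<nu> j. coeff_at \<mu> j l * coeff_at \<nu> j k *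
    (pochhammer (tail j) (k + l + (\<Sum>i=j+1..d. \<nu> i + \<mu> i)) /
     pochhammer (tail j + \<kappa> j + 1) (k + l + (\<Sum>i=j+1..d. \<nu> i + \<mu> i))))"

text \<open>In the variables \<open>stick x (Suc j) / stick x j\<close>, which are independent and Beta
  distributed, the Jacobi polynomials are products of univariate ones.\<close>

lemma jacobi_int_jacobi_poly_mult:
  "jacobi_int (\<lambda>x. jacobi_poly \<nu> x * jacobi_poly \<mu> x) = (\<Prod>j=1..d. jacobi_factor \<nu> \<mu> j)"
proof -
  define w where "w j p = coeff_at \<mu> j (fst p) * coeff_at \<nu> j (snd p)" for j p
  define D where "D j = {..\<mu> j} \<times> {..\<nu> j}" for j
  \<comment> \<open>\<open>G\<close> picks one pair for every coordinate when the product of sums is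
    multiplied out; the first entry of a pair belongs to \<open>\<mu>\<close>, the second to
    \<open>\<nu>\<close>.\<close>
  define G where "G = PiE {1..d} D"
  define u where "u g j = snd (g j) + fst (g j)" for g :: "nat \<Rightarrow> nat \<times> nat" and j
  define v where "v g j = \<nu> j + \<mu> j - u g j" for g :: "nat \<Rightarrow> nat \<times> nat" and j
  define F where "F g = (\<lambda>x. \<Prod>j=1..d. stick x (Suc j) ^ u g j * stick x j ^ v g j)" for g
  define T where "T j p = pochhammer (tail j) (snd p + fst p + (\<Sum>i=j+1..d. \<nu> i + \<mu> i)) /
     pochhammer (tail j + \<kappa> j + 1) (snd p + fst p + (\<Sum>i=j+1..d. \<nu> i + \<mu> i))" for j and p :: "nat \<times> nat"
  have finD: "finite (D j)" for j by (simp add: D_def)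
  have "jacobi_poly \<nu> x * jacobi_poly \<mu> x = (\<Sum>g\<in>G. (\<Prod>j=1..d. w j (g j)) * F g x)" for x
  proof -
    have "jacobi_poly \<nu> x * jacobi_poly \<mu> x =
        (\<Prod>j=1..d. \<Sum>p\<in>D j. w j p *
          (stick x (Suc j) ^ (snd p + fst p) * stick x j ^ (\<nu> j + \<mu> j - (snd p + fst p))))"
      unfolding simplex_jacobi_stick prod.distrib[symmetric]
    proof (intro prod.cong refl)
      fix j
      have "(\<Sum>k\<le>\<nu> j. coeff_at \<nu> j k * (stick x (Suc j) ^ k * stick x j ^ (\<nu> j - k))) *
          (\<Sum>l\<le>\<mu> j. coeff_at \<mu> j l * (stick x (Suc j) ^ l * stick x j ^ (\<mu> j - l))) =
          (\<Sum>(l, k)\<in>D j. coeff_at \<mu> j l * (stick x (Suc j) ^ l * stick x j ^ (\<mu> j - l)) *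
            (coeff_at \<nu> j k * (stick x (Suc j) ^ k * stick x j ^ (\<nu> j - k))))"
        unfolding D_def by (subst mult.commute) (simp only: sum_product sum.cartesian_product)
      also have "\<dots> = (\<Sum>p\<in>D j. w j p *
          (stick x (Suc j) ^ (snd p + fst p) * stick x j ^ (\<nu> j + \<mu> j - (snd p + fst p))))"
      proof (intro sum.cong refl)
        fix p assume "p \<in> D j"
        then obtain l k where p: "p = (l, k)" "l \<le> \<mu> j" "k \<le> \<nu> j" by (auto simp: D_def)
        then have "\<nu> j + \<mu> j - (k + l) = (\<mu> j - l) + (\<nu> j - k)" by simp
        then have "stick x j ^ (\<nu> j + \<mu> j - (k + l)) = stick x j ^ (\<mu> j - l) * stick x j ^ (\<nu> j - k)"
          by (simp only: power_add)
        then show "(case p of (l, k) \<Rightarrow> coeff_at \<mu> j l * (stick x (Suc j) ^ l * stick x j ^ (\<mu> j - l)) *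
            (coeff_at \<nu> j k * (stick x (Suc j) ^ k * stick x j ^ (\<nu> j - k)))) =
          w j p * (stick x (Suc j) ^ (snd p + fst p) * stick x j ^ (\<nu> j + \<mu> j - (snd p + fst p)))"
          by (simp add: p w_def power_add mult_ac)
      qed
      finally show "(\<Sum>k\<le>\<nu> j. coeff_at \<nu> j k * (stick x (Suc j) ^ k * stick x j ^ (\<nu> j - k))) *
          (\<Sum>l\<le>\<mu> j. coeff_at \<mu> j l * (stick x (Suc j) ^ l * stick x j ^ (\<mu> j - l))) =
          (\<Sum>p\<in>D j. w j p *
          (stick x (Suc j) ^ (snd p + fst p) * stick x j ^ (\<nu> j + \<mu> j - (snd p + fst p))))" .
    qed
    also have "\<dots> = (\<Sum>g\<in>G. \<Prod>j=1..d. w j (g j) *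
          (stick x (Suc j) ^ (snd (g j) + fst (g j)) * stick x j ^ (\<nu> j + \<mu> j - (snd (g j) + fst (g j)))))"
      unfolding G_def by (rule prod_sum_PiE) (auto simp: finD)
    finally show ?thesis by (simp only: prod.distrib F_def u_def v_def)
  qed
  then have "jacobi_int (\<lambda>x. jacobi_poly \<nu> x * jacobi_poly \<mu> x) =
      jacobi_int (\<lambda>x. \<Sum>g\<in>G. (\<Prod>j=1..d. w j (g j)) * F g x)"
    by simp
  also have "\<dots> = (\<Sum>g\<in>G. (\<Prod>j=1..d. w j (g j)) * jacobi_int (F g))"
  proof (rule jacobi_integrable_sum(2))
    fix g
    have "(\<lambda>x. stick x (Suc j) ^ u g j * stick x j ^ v g j) \<in> poly_funs d (u g j + v g j)"
      if "j \<in> {1..d}" for j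
      using poly_funs_mult[OF poly_funs_power[OF poly_funs_stick[of "Suc j" d]]
          poly_funs_power[OF poly_funs_stick[of j d]], of "u g j" "v g j"] that by simp
    then have "F g \<in> poly_funs d (\<Sum>j=1..d. u g j + v g j)"
      unfolding F_def by (rule poly_funs_prod)
    then show "jacobi_integrable (F g)" by (rule jacobi_integrable_poly)
  qed
  also have "\<dots> = (\<Sum>g\<in>G. \<Prod>j=1..d. w j (g j) * T j (g j))"
  proof (intro sum.cong refl)
    fix g assume g: "g \<in> G"
    \<comment> \<open>The total degree in each coordinate is independent of \<open>g\<close>. Hence
      the j-th factor of the moment depends on \<open>g j\<close> alone, and the sum over
      \<open>G\<close> folds back into a product of sums.\<close>
    have uv: "u g i + v g i = \<nu> i + \<mu> i" if "i \<in> {1..d}" for i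
    proof -
      have "g i \<in> D i" using g that by (auto simp: G_def)
      then show ?thesis by (auto simp: u_def v_def D_def)
    qed
    have "jacobi_int (F g) = (\<Prod>j=1..d. T j (g j))"
      unfolding F_def moment_stick
    proof (intro prod.cong refl)
      fix j assume "j \<in> {1..d}"
      then have "(\<Sum>i=j+1..d. u g i + v g i) = (\<Sum>i=j+1..d. \<nu> i + \<mu> i)"
        by (intro sum.cong refl uv) auto
      then show "pochhammer (tail j) (u g j + (\<Sum>i=j+1..d. u g i + v g i)) /
          pochhammer (tail j + \<kappa> j + 1) (u g j + (\<Sum>i=j+1..d. u g i + v g i)) = T j (g j)"
        by (simp only: T_def u_def)
    qed
    then show "(\<Prod>j=1..d. w j (g j)) * jacobi_int (F g) = (\<Prod>j=1..d. w j (g j) * T j (g j))"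
      by (simp only: prod.distrib)
  qed
  also have "\<dots> = (\<Prod>j=1..d. \<Sum>p\<in>D j. w j p * T j p)"
    unfolding G_def by (rule prod_sum_PiE[symmetric]) (auto simp: finD)
  also have "\<dots> = (\<Prod>j=1..d. jacobi_factor \<nu> \<mu> j)"
    unfolding jacobi_factor_def w_def T_def D_def sum.cartesian_product
    by (simp add: case_prod_beta)
  finally show ?thesis .
qed

text \<open>Explains the parameter a_j: beyond the Beta parameter \<open>tail j\<close> it accounts
  for the power of the j-th ratio that two copies of the later factors contribute.\<close>

lemma jacobi_param_gt:
  assumes "j \<in> {1..d}"
  shows "jacobi_param d \<kappa> \<nu> j > -1"
    and "jacobi_param d \<kappa> \<nu> j + 1 = tail j + real (2 * (\<Sum>i=j+1..d. \<nu> i))"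
proof -
  have "tail j = (\<Sum>i=j+1..d+1. \<kappa> i) + real (d + 1 - j)"
    by (simp only: tail_def sum.distrib) simp
  then show *: "jacobi_param d \<kappa> \<nu> j + 1 = tail j + real (2 * (\<Sum>i=j+1..d. \<nu> i))"
    using assms by (simp add: jacobi_param_def of_nat_diff del: sum.cl_ivl_Suc)
  have "tail j > 0" using assms by (intro tail_pos) simp
  with * show "jacobi_param d \<kappa> \<nu> j > -1"
    by (smt (verit) of_nat_0_le_iff)
qed

text \<open>If the indices agree beyond j, both polynomials have the same parameter
  \<open>a\<close>, and the shift of the moment order is twice the sum of the later
  \<open>\<nu> i\<close>. Splitting the shift off the shifted factorials leaves Beta moments with
  exactly the parameters a + 1 and \<kappa>_j + 1 of the univariate lemmas, times a
  constant.\<close>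

lemma jacobi_factor_eq:
  assumes j: "j \<in> {1..d}" and eq: "\<And>i. i \<in> {j+1..d} \<Longrightarrow> \<mu> i = \<nu> i"
  defines "a \<equiv> jacobi_param d \<kappa> \<nu> j"
  shows "\<exists>c\<noteq>0. jacobi_factor \<nu> \<mu> j = c * (\<Sum>l\<le>\<mu> j. jacobi_coeff (\<mu> j) a (\<kappa> j) l *
    (\<Sum>k\<le>\<nu> j. jacobi_coeff (\<nu> j) a (\<kappa> j) k *
      (pochhammer (a + 1) (k + l) / pochhammer (a + \<kappa> j + 2) (k + l))))"
proof -
  define S where "S = 2 * (\<Sum>i=j+1..d. \<nu> i)"
  define c where "c = pochhammer (tail j) S / pochhammer (tail j + \<kappa> j + 1) S"
  have S: "(\<Sum>i=j+1..d. \<nu> i + \<mu> i) = S"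
  proof -
    have "(\<Sum>i=j+1..d. \<nu> i + \<mu> i) = (\<Sum>i=j+1..d. 2 * \<nu> i)"
      by (intro sum.cong) (auto simp: eq)
    then show ?thesis by (simp only: S_def sum_distrib_left)
  qed
  have "(\<Sum>i=j+1..d. real (\<mu> i)) = (\<Sum>i=j+1..d. real (\<nu> i))"
    by (intro sum.cong) (auto simp: eq)
  then have b: "jacobi_param d \<kappa> \<mu> j = a"
    by (simp only: a_def jacobi_param_def)
  have a1: "tail j + real S = a + 1"
    using jacobi_param_gt(2)[OF j, of \<nu>] by (simp add: a_def S_def)
  have "tail j > 0" using j by (intro tail_pos) simp
  moreover have "\<kappa> j > -1" using j kappa by simp
  ultimately have c: "c > 0"
    unfolding c_def by (intro divide_pos_pos pochhammer_pos) auto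
  have split: "pochhammer (tail j) (k + l + S) / pochhammer (tail j + \<kappa> j + 1) (k + l + S) =
      c * (pochhammer (a + 1) (k + l) / pochhammer (a + \<kappa> j + 2) (k + l))" for k l
  proof -
    have "tail j + \<kappa> j + 1 + real S = a + \<kappa> j + 2" using a1 by simp
    moreover have "pochhammer x (k + l + S) = pochhammer x S * pochhammer (x + real S) (k + l)" for x :: real
      by (simp only: add.commute[of "k + l" S] pochhammer_product')
    ultimately show ?thesis
      by (simp only: c_def a1 times_divide_times_eq)
  qed
  have "jacobi_factor \<nu> \<mu> j = c * (\<Sum>l\<le>\<mu> j. jacobi_coeff (\<mu> j) a (\<kappa> j) l *
    (\<Sum>k\<le>\<nu> j. jacobi_coeff (\<nu> j) a (\<kappa> j) k *
      (pochhammer (a + 1) (k + l) / pochhammer (a + \<kappa> j + 2) (k + l))))"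
    unfolding jacobi_factor_def S split b a_def[symmetric] sum_distrib_left
    by (intro sum.cong refl) (simp only: mult_ac)
  with c show ?thesis by (intro exI[of _ c]) simp
qed

text \<open>At the last coordinate where the indices differ, the parameters still coincide, so that
  factor is a univariate integral of two Jacobi polynomials of different degrees. Expanding the one
  of lower degree into powers makes it vanish.\<close>

lemma jacobi_poly_orthogonal:
  assumes "\<nu> \<in> multi_indices d m" "\<mu> \<in> multi_indices d n" "\<nu> \<noteq> \<mu>"
  shows "jacobi_int (\<lambda>x. jacobi_poly \<nu> x * jacobi_poly \<mu> x) = 0"
proof -
  have zero: "jacobi_int (\<lambda>x. jacobi_poly \<nu> x * jacobi_poly \<mu> x) = 0"
    if j: "j \<in> {1..d}" "\<mu> j < \<nu> j" and eq: "\<And>i. i \<in> {j+1..d} \<Longrightarrow> \<mu> i = \<nu> i" for \<nu> \<mu> j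
  proof -
    define a where "a = jacobi_param d \<kappa> \<nu> j"
    have "(\<Sum>k\<le>\<nu> j. jacobi_coeff (\<nu> j) a (\<kappa> j) k *
        (pochhammer (a + 1) (k + l) / pochhammer (a + \<kappa> j + 2) (k + l))) = 0" if "l \<le> \<mu> j" for l
      using that j jacobi_param_gt(1)[OF j(1)] kappa[of j] unfolding a_def
      by (intro jacobi_moment_eq_0) auto
    then have "jacobi_factor \<nu> \<mu> j = 0"
      using jacobi_factor_eq[of j \<mu> \<nu>, OF j(1) eq] unfolding a_def[symmetric] by fastforce
    then show ?thesis
      unfolding jacobi_int_jacobi_poly_mult using j(1) by (intro prod_zero) auto
  qed
  define J where "J = {j\<in>{1..d}. \<nu> j \<noteq> \<mu> j}"
  have "J \<noteq> {}"
  proof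
    assume "J = {}"
    then have "\<nu> i = \<mu> i" for i
      using assms(1,2) by (cases "i \<in> {1..d}") (auto simp: J_def multi_indices_def)
    then show False using assms(3) by auto
  qed
  define j where "j = Max J"
  have "finite J" by (simp add: J_def)
  then have "j \<in> J" "\<And>i. i \<in> J \<Longrightarrow> i \<le> j"
    using \<open>J \<noteq> {}\<close> by (auto simp: j_def)
  then have j: "j \<in> {1..d}" "\<nu> j \<noteq> \<mu> j"
    by (auto simp: J_def)
  have eq: "\<mu> i = \<nu> i" if "i \<in> {j+1..d}" for i
  proof (rule ccontr)
    assume "\<mu> i \<noteq> \<nu> i"
    then have "i \<in> J" using that by (auto simp: J_def)
    then show False using that \<open>\<And>i. i \<in> J \<Longrightarrow> i \<le> j\<close>[of i] by simp
  qed
  from j(2) consider "\<mu> j < \<nu> j" | "\<nu> j < \<mu> j" by linarith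
  then show ?thesis
  proof cases
    case 1
    then show ?thesis using j eq by (intro zero)
  next
    case 2
    then have "jacobi_int (\<lambda>x. jacobi_poly \<mu> x * jacobi_poly \<nu> x) = 0"
      using j eq by (intro zero) auto
    then show ?thesis by (simp add: mult.commute)
  qed
qed

definition jacobi_norm2 :: "(nat \<Rightarrow> nat) \<Rightarrow> real" where
  "jacobi_norm2 \<nu> = jacobi_int (\<lambda>x. jacobi_poly \<nu> x * jacobi_poly \<nu> x)"

text \<open>Every univariate factor is nonzero: expand one copy of the polynomial in powers u^l; all
  l below the degree give 0 by orthogonality, and the top term is a nonzero coefficient times a
  nonzero moment.\<close>

lemma jacobi_norm2_neq_0: "jacobi_norm2 \<nu> \<noteq> 0"
proof -
  have "jacobi_factor \<nu> \<nu> j \<noteq> 0" if j: "j \<in> {1..d}" for j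
  proof -
    define a where "a = jacobi_param d \<kappa> \<nu> j"
    define m where "m = \<nu> j"
    define s where "s l = (\<Sum>k\<le>m. jacobi_coeff m a (\<kappa> j) k *
        (pochhammer (a + 1) (k + l) / pochhammer (a + \<kappa> j + 2) (k + l)))" for l
    have ab: "a > -1" "\<kappa> j > -1"
      using j jacobi_param_gt(1)[OF j] kappa by (auto simp: a_def)
    have "s l = 0" if "l < m" for l
      unfolding s_def using ab that by (rule jacobi_moment_eq_0)
    then have "(\<Sum>l\<le>m. jacobi_coeff m a (\<kappa> j) l * s l) = (\<Sum>l\<le>m. if l = m then jacobi_coeff m a (\<kappa> j) m * s m else 0)"
      by (intro sum.cong) auto
    then have "(\<Sum>l\<le>m. jacobi_coeff m a (\<kappa> j) l * s l) = jacobi_coeff m a (\<kappa> j) m * s m"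
      by simp
    moreover have "s m \<noteq> 0"
      unfolding s_def using ab by (rule jacobi_moment_neq_0)
    moreover have "jacobi_coeff m a (\<kappa> j) m \<noteq> 0"
    \<comment> \<open>For m = 0 the base a + \<kappa>_j + 1 need not be positive, but then the
      coefficient is 1.\<close>
    proof (cases "m = 0")
      case False
      then have "real m + a + \<kappa> j + 1 > 0" using ab by linarith
      then have "pochhammer (real m + a + \<kappa> j + 1) m > 0" by (rule pochhammer_pos)
      moreover have "pochhammer (a + 1) m > 0" using ab by (intro pochhammer_pos) simp
      moreover have "pochhammer (- real m) m \<noteq> 0"
        by (simp add: pochhammer_same)
      ultimately show ?thesis by (simp add: jacobi_coeff_def)
    qed (simp add: jacobi_coeff_def)
    moreover obtain c where "c \<noteq> 0" "jacobi_factor \<nu> \<nu> j = c * (\<Sum>l\<le>m. jacobi_coeff m a (\<kappa> j) l * s l)"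
      using jacobi_factor_eq[OF j, of \<nu> \<nu>] unfolding a_def m_def s_def by blast
    ultimately show ?thesis by simp
  qed
  then show ?thesis
    unfolding jacobi_norm2_def jacobi_int_jacobi_poly_mult by simp
qed

lemma poly_funs_jacobi_poly_low:
  assumes "\<nu> \<in> low_indices d n"
  shows "jacobi_poly \<nu> \<in> poly_funs d n"
  using assms
proof (rule low_indicesE)
  fix k assume "\<nu> \<in> multi_indices d k" "k < n"
  then show ?thesis
    using poly_funs_simplex_jacobi[of \<nu> d k \<kappa>] poly_funs_mono[of k n d] by auto
qed

text \<open>The index set is any part of \<open>low_indices\<close>: the whole set serves
  independence and general expansions, a single total degree serves the projection.\<close>

lemma jacobi_int_expansion:
  assumes I: "I \<subseteq> low_indices d n" and \<mu>: "\<mu> \<in> low_indices d n"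
  shows "jacobi_int (\<lambda>x. (\<Sum>\<nu>\<in>I. c \<nu> * jacobi_poly \<nu> x) * jacobi_poly \<mu> x) =
    (if \<mu> \<in> I then c \<mu> * jacobi_norm2 \<mu> else 0)"
proof -
  have fin: "finite I" using I by (rule finite_subset) simp
  have "jacobi_int (\<lambda>x. (\<Sum>\<nu>\<in>I. c \<nu> * jacobi_poly \<nu> x) * jacobi_poly \<mu> x) =
      (\<Sum>\<nu>\<in>I. c \<nu> * jacobi_int (\<lambda>x. jacobi_poly \<nu> x * jacobi_poly \<mu> x))"
    using I \<mu> by (intro jacobi_int_sum_mult[of _ _ n _ n] poly_funs_jacobi_poly_low) auto
  also have "\<dots> = (\<Sum>\<nu>\<in>I. if \<nu> = \<mu> then c \<mu> * jacobi_norm2 \<mu> else 0)"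
  proof (intro sum.cong refl)
    fix \<nu> assume "\<nu> \<in> I"
    then have "\<nu> \<in> low_indices d n" using I by auto
    with \<mu> show "c \<nu> * jacobi_int (\<lambda>x. jacobi_poly \<nu> x * jacobi_poly \<mu> x) =
        (if \<nu> = \<mu> then c \<mu> * jacobi_norm2 \<mu> else 0)"
      by (elim low_indicesE) (auto simp: jacobi_norm2_def intro: jacobi_poly_orthogonal)
  qed
  finally show ?thesis using fin by simp
qed

text \<open>Equal polynomials with different indices would be orthogonal to themselves. Injectivity
  makes the cardinality of the family that of its index set.\<close>

lemma jacobi_poly_inj: "inj_on jacobi_poly (low_indices d n)"
proof (rule inj_onI, rule ccontr)
  fix \<nu> \<mu> assume "\<nu> \<in> low_indices d n" "\<mu> \<in> low_indices d n" "jacobi_poly \<nu> = jacobi_poly \<mu>" "\<nu> \<noteq> \<mu>"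
  then have "jacobi_norm2 \<nu> = 0"
    unfolding jacobi_norm2_def
    by (elim low_indicesE) (metis jacobi_poly_orthogonal)
  then show False using jacobi_norm2_neq_0 by simp
qed

lemma jacobi_poly_independent: "fun_space.independent (jacobi_poly ` low_indices d n)"
proof
  assume "fun_space.dependent (jacobi_poly ` low_indices d n)"
  then have "\<exists>f. (\<exists>p\<in>jacobi_poly ` low_indices d n. f p \<noteq> 0) \<and>
      (\<Sum>p\<in>jacobi_poly ` low_indices d n. (\<lambda>x. f p * p x)) = 0"
    by (subst (asm) fun_space.dependent_finite) auto
  then obtain f \<mu> where \<mu>: "\<mu> \<in> low_indices d n" "f (jacobi_poly \<mu>) \<noteq> 0"
    and sum: "(\<Sum>p\<in>jacobi_poly ` low_indices d n. (\<lambda>x. f p * p x)) = 0"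
    by blast
  have "(\<Sum>\<nu>\<in>low_indices d n. f (jacobi_poly \<nu>) * jacobi_poly \<nu> x) = 0" for x
    using fun_cong[OF sum, of x] by (simp add: fun_sum_apply sum.reindex[OF jacobi_poly_inj])
  then have "jacobi_int (\<lambda>x. (\<Sum>\<nu>\<in>low_indices d n. f (jacobi_poly \<nu>) * jacobi_poly \<nu> x) * jacobi_poly \<mu> x) =
      jacobi_int (\<lambda>x. 0)"
    by simp
  also have "\<dots> = 0" by (simp add: jacobi_int_eq)
  finally show False
    using \<mu> jacobi_norm2_neq_0
    by (simp add: jacobi_int_expansion[OF order.refl \<mu>(1), where c = "\<lambda>\<nu>. f (jacobi_poly \<nu>)"])
qed

text \<open>The Jacobi polynomials are as many as the monomials, so that by the exchange lemma their
  independence implies that they span.\<close>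

lemma polys_below_eq_span_jacobi: "polys_below d n = fun_space.span (jacobi_poly ` low_indices d n)"
proof
  let ?S = "jacobi_poly ` low_indices d n" and ?T = "monomial d ` low_indices d n"
  have S: "?S \<subseteq> fun_space.span ?T"
  proof clarify
    fix \<nu> assume "\<nu> \<in> low_indices d n"
    then obtain k where "\<nu> \<in> multi_indices d k" "k < n" by (rule low_indicesE)
    then have "jacobi_poly \<nu> \<in> polys_below d n"
      using poly_funs_simplex_jacobi[of \<nu> d k \<kappa>] polys_below_mono[of "Suc k" n d]
      by (auto simp: poly_funs_eq)
    then show "jacobi_poly \<nu> \<in> fun_space.span ?T" by (simp add: polys_below_def)
  qed
  then show "fun_space.span ?S \<subseteq> polys_below d n"
    unfolding polys_below_def by (intro fun_space.span_minimal) auto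
  have "t \<in> fun_space.span ?S" if "t \<in> ?T" for t
  proof (rule ccontr)
    assume t: "t \<notin> fun_space.span ?S"
    then have "fun_space.independent (insert t ?S)"
      by (rule fun_space.independent_insertI) (rule jacobi_poly_independent)
    moreover have "insert t ?S \<subseteq> fun_space.span ?T"
      using S that fun_space.span_base[of t ?T] by simp
    ultimately have "card (insert t ?S) \<le> card ?T"
      using fun_space.independent_span_bound[of ?T "insert t ?S"] by simp
    also have "\<dots> \<le> card (low_indices d n)"
      by (intro card_image_le) simp
    also have "\<dots> = card ?S"
      by (rule card_image[OF jacobi_poly_inj, symmetric])
    finally show False
      using t fun_space.span_base[of t ?S] by (auto simp: card_insert_if split: if_splits)
  qed
  then show "polys_below d n \<subseteq> fun_space.span ?S"
    unfolding polys_below_def by (intro fun_space.span_minimal) auto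
qed

end

section \<open>Orthogonal projection\<close>

context jacobi_weight
begin

lemma jacobi_expansion:
  assumes "p \<in> polys_below d n"
  shows "p = (\<lambda>x. \<Sum>\<nu>\<in>low_indices d n.
    (jacobi_int (\<lambda>x. p x * jacobi_poly \<nu> x) / jacobi_norm2 \<nu>) * jacobi_poly \<nu> x)"
proof -
  obtain c where p: "p = (\<lambda>x. \<Sum>\<nu>\<in>low_indices d n. c \<nu> * jacobi_poly \<nu> x)"
    using assms unfolding polys_below_eq_span_jacobi fun_space_span_image[OF finite_low_indices] by blast
  have "c \<mu> = jacobi_int (\<lambda>x. p x * jacobi_poly \<mu> x) / jacobi_norm2 \<mu>"
    if "\<mu> \<in> low_indices d n" for \<mu>
    unfolding p using jacobi_int_expansion[OF order.refl that, of c] that jacobi_norm2_neq_0 by simp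
  then have "(\<lambda>x. \<Sum>\<nu>\<in>low_indices d n. c \<nu> * jacobi_poly \<nu> x) = (\<lambda>x. \<Sum>\<nu>\<in>low_indices d n.
      (jacobi_int (\<lambda>x. p x * jacobi_poly \<nu> x) / jacobi_norm2 \<nu>) * jacobi_poly \<nu> x)"
    by (intro ext sum.cong refl) simp
  with p show ?thesis by simp
qed

text \<open>The spaces of lower degree increase, so the largest one carries the whole condition. For
  n = 0 there is no smaller degree, matched by the zero space
  \<open>polys_below d 0\<close>.\<close>

lemma orth_polys_eq:
  "orth_polys d \<kappa> n =
    {p \<in> poly_funs d n. \<forall>q\<in>polys_below d n. jacobi_int (\<lambda>x. p x * q x) = 0}"
proof -
  have "(\<forall>m<n. \<forall>q\<in>poly_funs d m. jacobi_inner d \<kappa> p q = 0) \<longleftrightarrow>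
      (\<forall>q\<in>polys_below d n. jacobi_int (\<lambda>x. p x * q x) = 0)" for p
  proof (cases n)
    case 0
    have "fun_space.span (monomial d ` low_indices d 0) = {0}"
      by (simp add: low_indices_def)
    then show ?thesis using 0 by (simp add: polys_below_def jacobi_int_eq)
  next
    case (Suc m)
    have "polys_below d (Suc k) \<subseteq> polys_below d n" if "k < n" for k
      using that by (intro polys_below_mono) simp
    then show ?thesis
      using Suc unfolding jacobi_inner_eq poly_funs_eq by blast
  qed
  then show ?thesis by (auto simp: orth_polys_def)
qed

lemma low_indices_Suc: "low_indices d (Suc n) = low_indices d n \<union> multi_indices d n"
  by (auto simp: low_indices_def less_Suc_eq)

lemma low_indices_disjoint: "low_indices d n \<inter> multi_indices d n = {}"
  using multi_indices_disjoint[of _ n d] by (force simp: low_indices_def)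

lemma jacobi_poly_in_polys_below: "\<nu> \<in> low_indices d n \<Longrightarrow> jacobi_poly \<nu> \<in> polys_below d n"
  unfolding polys_below_eq_span_jacobi by (intro fun_space.span_base) auto

lemma sum_jacobi_poly_in_orth_polys:
  "(\<lambda>x. \<Sum>\<nu>\<in>multi_indices d n. c \<nu> * jacobi_poly \<nu> x) \<in> orth_polys d \<kappa> n"
proof -
  let ?p = "\<lambda>x. \<Sum>\<nu>\<in>multi_indices d n. c \<nu> * jacobi_poly \<nu> x"
  have p: "?p \<in> poly_funs d n"
    by (intro poly_funs_sum poly_funs_scale poly_funs_simplex_jacobi)
  have orth: "jacobi_int (\<lambda>x. ?p x * jacobi_poly \<mu> x) = 0" if "\<mu> \<in> low_indices d n" for \<mu>
    using that low_indices_disjoint[of n]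
    by (subst jacobi_int_expansion[where n = "Suc n"]) (auto simp: low_indices_Suc)
  have "jacobi_int (\<lambda>x. ?p x * q x) = 0" if q': "q \<in> polys_below d n" for q
  proof -
    obtain b where q: "q = (\<lambda>x. \<Sum>\<mu>\<in>low_indices d n. b \<mu> * jacobi_poly \<mu> x)"
      using q' unfolding polys_below_eq_span_jacobi fun_space_span_image[OF finite_low_indices] by blast
    have "jacobi_int (\<lambda>x. q x * ?p x) = (\<Sum>\<mu>\<in>low_indices d n. b \<mu> * jacobi_int (\<lambda>x. jacobi_poly \<mu> x * ?p x))"
      unfolding q using p by (intro jacobi_int_sum_mult[of _ _ n _ n] poly_funs_jacobi_poly_low) auto
    also have "\<dots> = 0"
      using orth by (simp add: mult.commute)
    finally show ?thesis by (simp add: mult.commute)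
  qed
  with p show ?thesis by (simp add: orth_polys_eq)
qed

lemma jacobi_poly_in_orth_polys:
  assumes "\<nu> \<in> multi_indices d n"
  shows "jacobi_poly \<nu> \<in> orth_polys d \<kappa> n"
proof -
  have "(\<Sum>\<mu>\<in>multi_indices d n. (if \<mu> = \<nu> then 1 else 0) * jacobi_poly \<mu> x) = jacobi_poly \<nu> x" for x
  proof -
    have "(\<Sum>\<mu>\<in>multi_indices d n. (if \<mu> = \<nu> then 1 else 0) * jacobi_poly \<mu> x) =
        (\<Sum>\<mu>\<in>multi_indices d n. if \<mu> = \<nu> then jacobi_poly \<mu> x else 0)"
      by (intro sum.cong) auto
    then show ?thesis using assms by simp
  qed
  then show ?thesis
    using sum_jacobi_poly_in_orth_polys[of "\<lambda>\<mu>. if \<mu> = \<nu> then 1 else 0" n] by simp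
qed

lemma orth_polys_expansion:
  assumes "p \<in> orth_polys d \<kappa> n"
  shows "p = (\<lambda>x. \<Sum>\<nu>\<in>multi_indices d n.
    (jacobi_int (\<lambda>x. p x * jacobi_poly \<nu> x) / jacobi_norm2 \<nu>) * jacobi_poly \<nu> x)"
proof -
  let ?t = "\<lambda>x \<nu>. (jacobi_int (\<lambda>x. p x * jacobi_poly \<nu> x) / jacobi_norm2 \<nu>) * jacobi_poly \<nu> x"
  have "p \<in> polys_below d (Suc n)"
    using assms by (simp add: orth_polys_eq poly_funs_eq)
  then have "p = (\<lambda>x. \<Sum>\<nu>\<in>low_indices d (Suc n). ?t x \<nu>)"
    by (rule jacobi_expansion)
  also have "\<dots> = (\<lambda>x. \<Sum>\<nu>\<in>multi_indices d n. ?t x \<nu>)"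
  proof
    fix x
    show "(\<Sum>\<nu>\<in>low_indices d (Suc n). ?t x \<nu>) = (\<Sum>\<nu>\<in>multi_indices d n. ?t x \<nu>)"
    proof (intro sum.mono_neutral_right ballI)
      fix \<nu> assume "\<nu> \<in> low_indices d (Suc n) - multi_indices d n"
      then have "jacobi_poly \<nu> \<in> polys_below d n"
        by (intro jacobi_poly_in_polys_below) (auto simp: low_indices_Suc)
      then show "?t x \<nu> = 0"
        using assms by (simp add: orth_polys_eq)
    qed (auto simp: low_indices_Suc)
  qed
  finally show ?thesis .
qed

text \<open>Resolves the \<open>THE\<close>: the Fourier sum is a projection, and any other
  candidate has the same inner products as \<open>f\<close> with the degree n Jacobi polynomials,
  which determine an element of \<open>orth_polys d \<kappa> n\<close>.\<close>

lemma orth_proj_eq: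
  assumes f: "f \<in> poly_funs d N"
  shows "orth_proj d \<kappa> (orth_polys d \<kappa> n) f = (\<lambda>x. \<Sum>\<nu>\<in>multi_indices d n.
    (jacobi_int (\<lambda>x. f x * jacobi_poly \<nu> x) / jacobi_norm2 \<nu>) * jacobi_poly \<nu> x)"
proof -
  define b where "b \<nu> = jacobi_int (\<lambda>x. f x * jacobi_poly \<nu> x) / jacobi_norm2 \<nu>" for \<nu>
  define R where "R = (\<lambda>x. \<Sum>\<nu>\<in>multi_indices d n. b \<nu> * jacobi_poly \<nu> x)"
  have R: "R \<in> orth_polys d \<kappa> n"
    unfolding R_def by (rule sum_jacobi_poly_in_orth_polys)
  have diff: "jacobi_int (\<lambda>x. (f x - p x) * jacobi_poly \<nu> x) =
      jacobi_int (\<lambda>x. f x * jacobi_poly \<nu> x) - jacobi_int (\<lambda>x. p x * jacobi_poly \<nu> x)"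
    if "p \<in> poly_funs d n" "\<nu> \<in> multi_indices d n" for p \<nu>
    unfolding left_diff_distrib
    using that f by (intro jacobi_int_diff jacobi_integrable_poly[OF poly_funs_mult] poly_funs_simplex_jacobi)
  have "jacobi_int (\<lambda>x. R x * jacobi_poly \<nu> x) = jacobi_int (\<lambda>x. f x * jacobi_poly \<nu> x)"
    if "\<nu> \<in> multi_indices d n" for \<nu>
    unfolding R_def using that jacobi_norm2_neq_0
    by (subst jacobi_int_expansion[where n = "Suc n"]) (auto simp: low_indices_Suc b_def)
  then have R0: "jacobi_int (\<lambda>x. (f x - R x) * jacobi_poly \<nu> x) = 0"
    if "\<nu> \<in> multi_indices d n" for \<nu>
    using that R by (subst diff) (auto simp: orth_polys_eq)
  have "orth_proj d \<kappa> (orth_polys d \<kappa> n) f = R"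
    unfolding orth_proj_def jacobi_inner_eq
  proof (rule the_equality, intro conjI ballI R)
    fix q assume "q \<in> orth_polys d \<kappa> n"
    from orth_polys_expansion[OF this]
    obtain c where q: "q = (\<lambda>x. \<Sum>\<nu>\<in>multi_indices d n. c \<nu> * jacobi_poly \<nu> x)"
      by (rule that)
    have "(\<lambda>x. f x - R x) \<in> poly_funs d (max N n)"
    proof -
      have "f \<in> poly_funs d (max N n)" "R \<in> poly_funs d (max N n)"
        using f R poly_funs_mono[of N "max N n" d] poly_funs_mono[of n "max N n" d]
        by (auto simp: orth_polys_eq)
      then show ?thesis unfolding poly_funs_eq by (rule polys_below_diff)
    qed
    then have "jacobi_int (\<lambda>x. q x * (f x - R x)) =
        (\<Sum>\<nu>\<in>multi_indices d n. c \<nu> * jacobi_int (\<lambda>x. jacobi_poly \<nu> x * (f x - R x)))"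
      unfolding q by (intro jacobi_int_sum_mult[of _ _ n] poly_funs_simplex_jacobi)
    also have "\<dots> = 0" using R0 by (simp add: mult.commute)
    finally show "jacobi_int (\<lambda>x. (f x - R x) * q x) = 0" by (simp add: mult.commute)
  next
    fix p assume p: "p \<in> orth_polys d \<kappa> n \<and>
      (\<forall>q\<in>orth_polys d \<kappa> n. jacobi_int (\<lambda>x. (f x - p x) * q x) = 0)"
    have "jacobi_int (\<lambda>x. p x * jacobi_poly \<nu> x) = jacobi_int (\<lambda>x. f x * jacobi_poly \<nu> x)"
      if "\<nu> \<in> multi_indices d n" for \<nu>
      using diff[of p \<nu>] p that jacobi_poly_in_orth_polys[OF that] by (auto simp: orth_polys_eq)
    then have "(\<lambda>x. \<Sum>\<nu>\<in>multi_indices d n.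
        (jacobi_int (\<lambda>x. p x * jacobi_poly \<nu> x) / jacobi_norm2 \<nu>) * jacobi_poly \<nu> x) = R"
      unfolding R_def b_def by (intro ext sum.cong refl) simp
    moreover note orth_polys_expansion[OF conjunct1[OF p]]
    ultimately show "p = R" by simp
  qed
  then show ?thesis by (simp add: R_def b_def)
qed

section \<open>The Bernstein-Durrmeyer operator\<close>

abbreviation bary_monomial :: "(nat \<Rightarrow> nat) \<Rightarrow> (nat \<Rightarrow> real) \<Rightarrow> real" where
  "bary_monomial \<alpha> x \<equiv> monomial (d + 1) \<alpha> (extend_coords d x)"

abbreviation poch :: "(nat \<Rightarrow> nat) \<Rightarrow> real" where
  "poch \<equiv> multi_pochhammer (d + 1) (\<lambda>i. \<kappa> i + 1)"

lemma poch_pos: "poch \<alpha> > 0"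
proof -
  have "\<kappa> i + 1 > 0" if "i \<in> {1..d+1}" for i
    using kappa[OF that] by simp
  then show ?thesis
    unfolding multi_pochhammer_def by (intro prod_pos pochhammer_pos)
qed

lemma sum_extend_coords: "(\<Sum>i=1..d+1. extend_coords d x i) = 1"
proof -
  have "(\<Sum>i=1..d. extend_coords d x i) = (\<Sum>i=1..d. x i)"
    by (intro sum.cong) (auto simp: extend_coords_def)
  then show ?thesis by (simp add: extend_coords_def)
qed

text \<open>The quotient \<open>pochhammer kappa_total N / poch \<alpha>\<close> is the reciprocal
  of the integral of \<open>bary_monomial \<alpha>\<close>, so that constants are
  reproduced.\<close>

definition durrmeyer :: "nat \<Rightarrow> ((nat \<Rightarrow> real) \<Rightarrow> real) \<Rightarrow> (nat \<Rightarrow> real) \<Rightarrow> real" where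
  "durrmeyer N f x = (\<Sum>\<alpha>\<in>multi_indices (d + 1) N.
    (fact N / multi_fact (d + 1) \<alpha> * (pochhammer kappa_total N / poch \<alpha>) *
      jacobi_int (\<lambda>x. f x * bary_monomial \<alpha> x)) * bary_monomial \<alpha> x)"

text \<open>The quotient stems from the normalization and the denominator of a moment of degree k +
  N, the falling factorial from \<open>multinomial_falling\<close>.\<close>

definition durrmeyer_eigenvalue :: "nat \<Rightarrow> nat \<Rightarrow> real" where
  "durrmeyer_eigenvalue N k = pochhammer kappa_total N / pochhammer kappa_total (k + N) * falling N k"

lemma poly_funs_durrmeyer: "durrmeyer N f \<in> poly_funs d N"
  unfolding durrmeyer_def[abs_def]
  by (intro poly_funs_sum poly_funs_scale poly_funs_monomial_extend_coords)

lemma durrmeyer_sum: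
  assumes "\<And>i. i \<in> I \<Longrightarrow> F i \<in> poly_funs d n"
  shows "durrmeyer N (\<lambda>x. \<Sum>i\<in>I. c i * F i x) x = (\<Sum>i\<in>I. c i * durrmeyer N (F i) x)"
proof -
  have "jacobi_int (\<lambda>x. (\<Sum>i\<in>I. c i * F i x) * bary_monomial \<alpha> x) =
      (\<Sum>i\<in>I. c i * jacobi_int (\<lambda>x. F i x * bary_monomial \<alpha> x))"
    if "\<alpha> \<in> multi_indices (d + 1) N" for \<alpha>
    using assms that by (intro jacobi_int_sum_mult poly_funs_monomial_extend_coords)
  then have "durrmeyer N (\<lambda>x. \<Sum>i\<in>I. c i * F i x) x = (\<Sum>\<alpha>\<in>multi_indices (d + 1) N. \<Sum>i\<in>I.
      c i * ((fact N / multi_fact (d + 1) \<alpha> * (pochhammer kappa_total N / poch \<alpha>) *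
      jacobi_int (\<lambda>x. F i x * bary_monomial \<alpha> x)) * bary_monomial \<alpha> x))"
    unfolding durrmeyer_def
    by (intro sum.cong refl) (simp only: sum_distrib_left sum_distrib_right mult_ac)
  then show ?thesis
    unfolding durrmeyer_def sum_distrib_left by (subst (asm) sum.swap)
qed

lemma durrmeyer_inner:
  assumes "f \<in> poly_funs d n" "g \<in> poly_funs d m"
  shows "jacobi_int (\<lambda>x. durrmeyer N f x * g x) =
    (\<Sum>\<alpha>\<in>multi_indices (d + 1) N. fact N / multi_fact (d + 1) \<alpha> * (pochhammer kappa_total N / poch \<alpha>) *
      jacobi_int (\<lambda>x. f x * bary_monomial \<alpha> x) * jacobi_int (\<lambda>x. g x * bary_monomial \<alpha> x))"
proof -
  have "jacobi_int (\<lambda>x. durrmeyer N f x * g x) =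
    (\<Sum>\<alpha>\<in>multi_indices (d + 1) N. fact N / multi_fact (d + 1) \<alpha> * (pochhammer kappa_total N / poch \<alpha>) *
      jacobi_int (\<lambda>x. f x * bary_monomial \<alpha> x) * jacobi_int (\<lambda>x. bary_monomial \<alpha> x * g x))"
    unfolding durrmeyer_def using assms
    by (intro jacobi_int_sum_mult[of _ _ N] poly_funs_monomial_extend_coords)
  then show ?thesis by (simp only: mult.commute[of _ "g _"])
qed

lemma durrmeyer_sym:
  assumes "f \<in> poly_funs d n" "g \<in> poly_funs d m"
  shows "jacobi_int (\<lambda>x. durrmeyer N f x * g x) = jacobi_int (\<lambda>x. f x * durrmeyer N g x)"
proof -
  have "jacobi_int (\<lambda>x. f x * durrmeyer N g x) = jacobi_int (\<lambda>x. durrmeyer N g x * f x)"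
    by (simp only: mult.commute)
  also note durrmeyer_inner[OF assms(2,1)]
  finally show ?thesis
    unfolding durrmeyer_inner[OF assms] by (simp only: mult_ac)
qed

text \<open>The moment of x^gamma X^alpha is (\<kappa>+1)_alpha, cancelled by the weights, times the
  product of the (\<kappa>_i + 1 + alpha_i)_{gamma_i} over a constant. Expanded in falling
  factorials of the alpha_i, each term with exponents g sums to \<open>falling N\<close> |g| times
  X^g, since |X| = 1. The term g = gamma has coefficient 1 and yields the eigenvalue; all others
  have smaller degree.\<close>

lemma durrmeyer_monomial:
  assumes \<gamma>: "\<gamma> \<in> multi_indices d k" and k: "k \<le> N"
  shows "(\<lambda>x. durrmeyer N (monomial d \<gamma>) x - durrmeyer_eigenvalue N k * monomial d \<gamma> x) \<in> polys_below d k"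
proof -
  define C where "C = pochhammer kappa_total N / pochhammer kappa_total (k + N)"
  have \<gamma>': "\<gamma> \<in> multi_indices (d + 1) k" using \<gamma> by (rule multi_indices_Suc)
  have \<gamma>_last: "\<gamma> (d + 1) = 0" using \<gamma> by (simp add: multi_indices_def)
  have "\<exists>c. c (\<gamma> i) = 1 \<and> (\<forall>n. pochhammer (\<kappa> i + 1 + real n) (\<gamma> i) = (\<Sum>j\<le>\<gamma> i. c j * falling n j))" for i
    by (rule pochhammer_falling_expansion)
  then obtain c where c1: "\<And>i. c i (\<gamma> i) = 1"
    and c: "\<And>i n. pochhammer (\<kappa> i + 1 + real n) (\<gamma> i) = (\<Sum>j\<le>\<gamma> i. c i j * falling n j)"
    by metis
  define G where "G = PiE {1..d+1} (\<lambda>i. {..\<gamma> i})"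
  \<comment> \<open>Members of \<open>G\<close> are \<open>undefined\<close> outside {1..d+1},
    multi-indices are 0 there; \<open>z\<close> and \<open>g0\<close> translate between the
    two.\<close>
  define z where "z g i = (if i \<in> {1..d+1} then g i else 0)" for g :: "nat \<Rightarrow> nat" and i
  define s where "s g = (\<Sum>i=1..d+1. g i)" for g :: "nat \<Rightarrow> nat"
  define g0 where "g0 = restrict \<gamma> {1..d+1}"
  have z': "z g \<in> multi_indices (d + 1) (s g)" for g
    by (auto simp: multi_indices_def z_def s_def intro!: sum.cong)
  \<comment> \<open>Since gamma has last component 0, so has every \<open>g\<close> below it; X^g is
    therefore a monomial in x of degree |g|.\<close>
  have z: "z g \<in> multi_indices d (s g)" if "g \<in> G" for g
  proof -
    have "g (d + 1) \<in> {..\<gamma> (d + 1)}"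
      using that unfolding G_def by (rule PiE_mem) simp
    then have "z g (d + 1) = 0" using \<gamma>_last by (simp add: z_def)
    with z'[of g] show ?thesis
      by (auto simp: multi_indices_def le_Suc_eq)
  qed
  have sk: "s g \<le> k" if "g \<in> G" for g
  proof -
    have "s g \<le> (\<Sum>i=1..d+1. \<gamma> i)"
      unfolding s_def using that by (intro sum_mono) (auto simp: G_def PiE_iff)
    then show ?thesis using \<gamma>' by (simp add: multi_indices_def)
  qed
  have moment: "jacobi_int (\<lambda>x. monomial d \<gamma> x * bary_monomial \<alpha> x) =
      poch \<alpha> * (\<Prod>i=1..d+1. pochhammer (\<kappa> i + 1 + real (\<alpha> i)) (\<gamma> i)) / pochhammer kappa_total (k + N)"
    if \<alpha>: "\<alpha> \<in> multi_indices (d + 1) N" for \<alpha>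
  proof -
    have "(\<lambda>x. monomial d \<gamma> x * bary_monomial \<alpha> x) = bary_monomial (\<lambda>i. \<gamma> i + \<alpha> i)"
      by (simp only: monomial_add monomial_extend_coords[OF \<gamma>])
    moreover have "(\<Sum>i=1..d+1. \<gamma> i + \<alpha> i) = k + N"
      using multi_indices_add[OF \<gamma>' \<alpha>] by (simp add: multi_indices_def)
    moreover have "poch (\<lambda>i. \<gamma> i + \<alpha> i) =
        poch \<alpha> * (\<Prod>i=1..d+1. pochhammer (\<kappa> i + 1 + real (\<alpha> i)) (\<gamma> i))"
      unfolding multi_pochhammer_def add.commute[of "\<gamma> _"] pochhammer_product' prod.distrib ..
    ultimately show ?thesis by (simp only: moment_monomial)
  qed
  have expand: "durrmeyer N (monomial d \<gamma>) x =
      (\<Sum>g\<in>G. (C * (\<Prod>i=1..d+1. c i (g i)) * falling N (s g)) * monomial d (z g) x)" for x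
  proof -
    have "durrmeyer N (monomial d \<gamma>) x = (\<Sum>\<alpha>\<in>multi_indices (d + 1) N. C * (fact N / multi_fact (d + 1) \<alpha> *
        (\<Prod>i=1..d+1. pochhammer (\<kappa> i + 1 + real (\<alpha> i)) (\<gamma> i)) * bary_monomial \<alpha> x))"
      unfolding durrmeyer_def
    proof (intro sum.cong refl)
      fix \<alpha> assume "\<alpha> \<in> multi_indices (d + 1) N"
      have "f * (t / p) * (p * q / u) * m = t / u * (f * q * m)" if "p > 0" for f t p q u m :: real
        using that by simp
      from this[OF poch_pos[of \<alpha>]]
      show "fact N / multi_fact (d + 1) \<alpha> * (pochhammer kappa_total N / poch \<alpha>) *
          jacobi_int (\<lambda>x. monomial d \<gamma> x * bary_monomial \<alpha> x) * bary_monomial \<alpha> x =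
        C * (fact N / multi_fact (d + 1) \<alpha> *
          (\<Prod>i=1..d+1. pochhammer (\<kappa> i + 1 + real (\<alpha> i)) (\<gamma> i)) * bary_monomial \<alpha> x)"
        unfolding moment[OF \<open>\<alpha> \<in> _\<close>] C_def .
    qed
    also have "\<dots> = (\<Sum>\<alpha>\<in>multi_indices (d + 1) N. \<Sum>g\<in>G. C * (\<Prod>i=1..d+1. c i (g i)) *
        (fact N / multi_fact (d + 1) \<alpha> * (\<Prod>i=1..d+1. falling (\<alpha> i) (g i)) * bary_monomial \<alpha> x))"
    proof (intro sum.cong refl)
      fix \<alpha>
      have "(\<Prod>i=1..d+1. pochhammer (\<kappa> i + 1 + real (\<alpha> i)) (\<gamma> i)) =
          (\<Sum>g\<in>G. \<Prod>i=1..d+1. c i (g i) * falling (\<alpha> i) (g i))"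
        unfolding c G_def by (rule prod_sum_PiE) auto
      then show "C * (fact N / multi_fact (d + 1) \<alpha> *
          (\<Prod>i=1..d+1. pochhammer (\<kappa> i + 1 + real (\<alpha> i)) (\<gamma> i)) * bary_monomial \<alpha> x) =
        (\<Sum>g\<in>G. C * (\<Prod>i=1..d+1. c i (g i)) *
          (fact N / multi_fact (d + 1) \<alpha> * (\<Prod>i=1..d+1. falling (\<alpha> i) (g i)) * bary_monomial \<alpha> x))"
        by (simp only: prod.distrib sum_distrib_left sum_distrib_right mult_ac)
    qed
    also have "\<dots> = (\<Sum>g\<in>G. C * (\<Prod>i=1..d+1. c i (g i)) * (\<Sum>\<alpha>\<in>multi_indices (d + 1) N.
        fact N / multi_fact (d + 1) \<alpha> * (\<Prod>i=1..d+1. falling (\<alpha> i) (g i)) * bary_monomial \<alpha> x))"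
      by (subst sum.swap) (simp only: sum_distrib_left)
    also have "\<dots> = (\<Sum>g\<in>G. C * (\<Prod>i=1..d+1. c i (g i)) * (falling N (s g) * monomial d (z g) x))"
    proof (intro sum.cong refl arg_cong2[where f = times])
      fix g assume g: "g \<in> G"
      have "(\<Prod>i=1..d+1. falling (\<alpha> i) (g i)) = (\<Prod>i=1..d+1. falling (\<alpha> i) (z g i))" for \<alpha>
        by (intro prod.cong) (auto simp: z_def)
      then show "(\<Sum>\<alpha>\<in>multi_indices (d + 1) N. fact N / multi_fact (d + 1) \<alpha> *
          (\<Prod>i=1..d+1. falling (\<alpha> i) (g i)) * bary_monomial \<alpha> x) = falling N (s g) * monomial d (z g) x"
        using multinomial_falling[OF z', of g N "extend_coords d x"] sk[OF g] k
        by (simp only: sum_extend_coords monomial_extend_coords[OF z[OF g]]) simp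
    qed
    finally show ?thesis by (simp only: mult.assoc)
  qed
  have g0: "g0 \<in> G" by (auto simp: g0_def G_def)
  have zg0: "z g0 = \<gamma>"
    using \<gamma> by (auto simp: z_def g0_def multi_indices_def fun_eq_iff)
  have "s g0 = (\<Sum>i=1..d+1. \<gamma> i)"
    unfolding s_def g0_def by (intro sum.cong) auto
  then have sg0: "s g0 = k" using \<gamma>' by (simp add: multi_indices_def)
  have cg0: "(\<Prod>i=1..d+1. c i (g0 i)) = 1"
    using c1 by (intro prod.neutral) (auto simp: g0_def)
  have finG: "finite G" unfolding G_def by (intro finite_PiE) auto
  have less: "s g < k" if "g \<in> G - {g0}" for g
  proof -
    have "\<exists>i\<in>{1..d+1}. g i < \<gamma> i"
    proof (rule ccontr)
      assume "\<not> (\<exists>i\<in>{1..d+1}. g i < \<gamma> i)"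
      then have "g i = \<gamma> i" if "i \<in> {1..d+1}" for i
        using \<open>g \<in> G - {g0}\<close> that by (force simp: G_def PiE_iff)
      then have "g = g0"
        using that by (auto simp: G_def g0_def PiE_iff extensional_def fun_eq_iff)
      then show False using that by simp
    qed
    then have "s g < (\<Sum>i=1..d+1. \<gamma> i)"
      unfolding s_def using that by (intro sum_strict_mono_ex1) (auto simp: G_def PiE_iff)
    then show ?thesis using \<gamma>' by (simp add: multi_indices_def)
  qed
  have "durrmeyer N (monomial d \<gamma>) x - durrmeyer_eigenvalue N k * monomial d \<gamma> x =
      (\<Sum>g\<in>G - {g0}. (C * (\<Prod>i=1..d+1. c i (g i)) * falling N (s g)) * monomial d (z g) x)" for x
    unfolding expand sum.remove[OF finG g0] cg0 sg0 zg0 durrmeyer_eigenvalue_def C_def[symmetric] by simp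
  moreover have "(\<lambda>x. \<Sum>g\<in>G - {g0}. (C * (\<Prod>i=1..d+1. c i (g i)) * falling N (s g)) * monomial d (z g) x)
      \<in> polys_below d k"
    using less z by (intro polys_below_sum polys_below_scale monomial_in_polys_below) auto
  ultimately show ?thesis by presburger
qed

end

section \<open>Hahn polynomials as coefficients\<close>

context jacobi_weight
begin

lemma durrmeyer_monomial_below:
  assumes "\<gamma> \<in> multi_indices d k" "k < n" "n \<le> Suc N"
  shows "durrmeyer N (monomial d \<gamma>) \<in> polys_below d n"
proof -
  have "(\<lambda>x. durrmeyer N (monomial d \<gamma>) x - durrmeyer_eigenvalue N k * monomial d \<gamma> x) \<in> polys_below d n"
    using durrmeyer_monomial[OF assms(1), of N] polys_below_mono[of k n d] assms(2,3) by auto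
  moreover have "(\<lambda>x. durrmeyer_eigenvalue N k * monomial d \<gamma> x) \<in> polys_below d n"
    using assms by (intro polys_below_scale monomial_in_polys_below)
  ultimately show ?thesis
    using polys_below_add[of "\<lambda>x. durrmeyer N (monomial d \<gamma>) x - durrmeyer_eigenvalue N k * monomial d \<gamma> x" d n
        "\<lambda>x. durrmeyer_eigenvalue N k * monomial d \<gamma> x"] by simp
qed

lemma durrmeyer_expansion:
  assumes "f = (\<lambda>x. \<Sum>\<gamma>\<in>low_indices d n. c \<gamma> * monomial d \<gamma> x)"
  shows "durrmeyer N f x = (\<Sum>\<gamma>\<in>low_indices d n. c \<gamma> * durrmeyer N (monomial d \<gamma>) x)"
  unfolding assms
proof (rule durrmeyer_sum)
  fix \<gamma> assume "\<gamma> \<in> low_indices d n"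
  then show "monomial d \<gamma> \<in> poly_funs d n"
    unfolding poly_funs_eq by (elim low_indicesE) (rule monomial_in_polys_below, auto)
qed

lemma durrmeyer_polys_below:
  assumes "f \<in> polys_below d n" "n \<le> Suc N"
  shows "durrmeyer N f \<in> polys_below d n"
proof -
  obtain c where "f = (\<lambda>x. \<Sum>\<gamma>\<in>low_indices d n. c \<gamma> * monomial d \<gamma> x)"
    using assms(1) by (rule polys_belowE)
  note durrmeyer_expansion[OF this]
  moreover have "(\<lambda>x. \<Sum>\<gamma>\<in>low_indices d n. c \<gamma> * durrmeyer N (monomial d \<gamma>) x) \<in> polys_below d n"
    using assms(2)
    by (intro polys_below_sum polys_below_scale) (auto elim!: low_indicesE intro: durrmeyer_monomial_below)
  ultimately show ?thesis by presburger
qed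

text \<open>Monomials of degree below n stay below n, whatever their own eigenvalue; only those of
  degree n are sensitive to the scalar.\<close>

lemma durrmeyer_leading:
  assumes f: "f \<in> poly_funs d n" and n: "n \<le> N"
  shows "(\<lambda>x. durrmeyer N f x - durrmeyer_eigenvalue N n * f x) \<in> polys_below d n"
proof -
  obtain c where c: "f = (\<lambda>x. \<Sum>\<gamma>\<in>low_indices d (Suc n). c \<gamma> * monomial d \<gamma> x)"
    using f unfolding poly_funs_eq by (rule polys_belowE)
  have "durrmeyer N f x - durrmeyer_eigenvalue N n * f x = (\<Sum>\<gamma>\<in>low_indices d (Suc n).
      c \<gamma> * (durrmeyer N (monomial d \<gamma>) x - durrmeyer_eigenvalue N n * monomial d \<gamma> x))" for x
    unfolding durrmeyer_expansion[OF c] by (subst c) (simp add: sum_distrib_left sum_subtractf algebra_simps)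
  moreover have "(\<lambda>x. \<Sum>\<gamma>\<in>low_indices d (Suc n).
      c \<gamma> * (durrmeyer N (monomial d \<gamma>) x - durrmeyer_eigenvalue N n * monomial d \<gamma> x)) \<in> polys_below d n"
  proof (intro polys_below_sum polys_below_scale)
    fix \<gamma> assume "\<gamma> \<in> low_indices d (Suc n)"
    then obtain k where k: "\<gamma> \<in> multi_indices d k" "k < Suc n" by (rule low_indicesE)
    show "(\<lambda>x. durrmeyer N (monomial d \<gamma>) x - durrmeyer_eigenvalue N n * monomial d \<gamma> x) \<in> polys_below d n"
    proof (cases "k = n")
      case True
      then show ?thesis using durrmeyer_monomial k n by simp
    next
      case False
      then have "k < n" using k by simp
      then show ?thesis
        using k n by (intro polys_below_diff polys_below_scale durrmeyer_monomial_below
            monomial_in_polys_below) auto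
    qed
  qed
  ultimately show ?thesis by presburger
qed

text \<open>The difference of the two sides has degree below n and is orthogonal to everything of
  degree below n: for p by assumption, for its image because the operator can be moved to the other
  argument without raising its degree. All Jacobi coefficients of the difference thus
  vanish.\<close>

lemma durrmeyer_orth_polys:
  assumes p: "p \<in> orth_polys d \<kappa> n" and n: "n \<le> N"
  shows "durrmeyer N p x = durrmeyer_eigenvalue N n * p x"
proof -
  let ?D = "\<lambda>x. durrmeyer N p x - durrmeyer_eigenvalue N n * p x"
  have pn: "p \<in> poly_funs d n" using p by (simp add: orth_polys_eq)
  then have D: "?D \<in> polys_below d n" using n by (rule durrmeyer_leading)
  have "jacobi_int (\<lambda>x. ?D x * jacobi_poly \<nu> x) = 0" if \<nu>: "\<nu> \<in> low_indices d n" for \<nu>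
  proof -
    have q: "jacobi_poly \<nu> \<in> polys_below d n" "jacobi_poly \<nu> \<in> poly_funs d n"
      using \<nu> by (auto intro: jacobi_poly_in_polys_below poly_funs_jacobi_poly_low)
    have pq: "jacobi_int (\<lambda>x. p x * jacobi_poly \<nu> x) = 0"
      using p q by (simp add: orth_polys_eq)
    have int: "jacobi_integrable (\<lambda>x. p x * jacobi_poly \<nu> x)"
      "jacobi_integrable (\<lambda>x. durrmeyer N p x * jacobi_poly \<nu> x)"
      using jacobi_integrable_poly[OF poly_funs_mult[OF pn q(2)]]
        jacobi_integrable_poly[OF poly_funs_mult[OF poly_funs_durrmeyer q(2)]] by auto
    have "jacobi_int (\<lambda>x. durrmeyer N p x * jacobi_poly \<nu> x) =
        jacobi_int (\<lambda>x. p x * durrmeyer N (jacobi_poly \<nu>) x)"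
      using pn q(2) by (rule durrmeyer_sym)
    also have "\<dots> = 0"
      using p durrmeyer_polys_below[OF q(1), of N] n by (simp add: orth_polys_eq)
    finally have dq: "jacobi_int (\<lambda>x. durrmeyer N p x * jacobi_poly \<nu> x) = 0" .
    have "jacobi_integrable (\<lambda>x. durrmeyer_eigenvalue N n * (p x * jacobi_poly \<nu> x))"
      using jacobi_integrable_sum(1)[of "{()}", OF int(1), of "\<lambda>_. durrmeyer_eigenvalue N n"] by simp
    then have "jacobi_int (\<lambda>x. durrmeyer N p x * jacobi_poly \<nu> x -
        durrmeyer_eigenvalue N n * (p x * jacobi_poly \<nu> x)) = 0"
      using int by (simp add: jacobi_int_diff jacobi_int_scale pq dq)
    then show ?thesis by (simp add: left_diff_distrib mult.assoc)
  qed
  then have "(\<Sum>\<nu>\<in>low_indices d n.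
      (jacobi_int (\<lambda>x. ?D x * jacobi_poly \<nu> x) / jacobi_norm2 \<nu>) * jacobi_poly \<nu> x) = 0"
    by (intro sum.neutral) simp
  with fun_cong[OF jacobi_expansion[OF D], of x] show ?thesis by simp
qed

text \<open>Homogenization: the components of y / |y| add up to 1, so \<open>extend_coords\<close>
  restores the coordinate d + 1 from the first d.\<close>

lemma bary_monomial_normalize:
  assumes s: "s = (\<Sum>i=1..d+1. y i)" "s \<noteq> 0" and \<alpha>: "\<alpha> \<in> multi_indices (d + 1) N"
  shows "s ^ N * bary_monomial \<alpha> (\<lambda>i. y i / s) = monomial (d + 1) \<alpha> y"
proof -
  have "extend_coords d (\<lambda>i. y i / s) i = y i / s" if "i \<in> {1..d+1}" for i
  proof (cases "i = d + 1")
    case True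
    have "1 - (\<Sum>j=1..d. y j) / s = y (d + 1) / s"
      using s by (simp add: field_simps)
    then show ?thesis using True by (simp add: extend_coords_def sum_divide_distrib)
  qed (simp add: extend_coords_def)
  then have "bary_monomial \<alpha> (\<lambda>i. y i / s) = (\<Prod>i=1..d+1. (y i / s) ^ \<alpha> i)"
    unfolding monomial_def by (intro prod.cong refl) simp
  also have "\<dots> = monomial (d + 1) \<alpha> y / (\<Prod>i=1..d+1. s ^ \<alpha> i)"
    by (simp only: monomial_def power_divide prod_dividef)
  also have "(\<Prod>i=1..d+1. s ^ \<alpha> i) = s ^ N"
    using \<alpha> by (simp add: multi_indices_def flip: power_sum)
  finally show ?thesis using s by simp
qed

lemma bary_monomials_independent:
  assumes "\<And>x. (\<Sum>\<alpha>\<in>multi_indices (d + 1) N. c \<alpha> * bary_monomial \<alpha> x) = 0"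
    and "\<alpha> \<in> multi_indices (d + 1) N"
  shows "c \<alpha> = 0"
proof (rule monomials_independent[OF _ assms(2), of c])
  fix y :: "nat \<Rightarrow> real"
  assume y: "\<And>i. i \<in> {1..d+1} \<Longrightarrow> y i > 0"
  define s where "s = (\<Sum>i=1..d+1. y i)"
  have "s > 0" unfolding s_def using y by (intro sum_pos) auto
  then have "monomial (d + 1) \<alpha> y = s ^ N * bary_monomial \<alpha> (\<lambda>i. y i / s)"
    if "\<alpha> \<in> multi_indices (d + 1) N" for \<alpha>
    using bary_monomial_normalize[OF s_def _ that] by simp
  then have "(\<Sum>\<alpha>\<in>multi_indices (d + 1) N. c \<alpha> * monomial (d + 1) \<alpha> y) =
      (\<Sum>\<alpha>\<in>multi_indices (d + 1) N. s ^ N * (c \<alpha> * bary_monomial \<alpha> (\<lambda>i. y i / s)))"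
    by (intro sum.cong refl) simp
  also have "\<dots> = 0"
    by (simp only: sum_distrib_left[symmetric] assms(1) mult_zero_right)
  finally show "(\<Sum>\<alpha>\<in>multi_indices (d + 1) N. c \<alpha> * monomial (d + 1) \<alpha> y) = 0" .
qed

text \<open>For k \<le> N the monomial x^gamma equals x^gamma |X|^(N-k), which
  \<open>multinomial_falling\<close> expands into the X^alpha of degree N up to the nonzero factor
  \<open>falling N k\<close>.\<close>

lemma poly_funs_bary_representation:
  assumes "f \<in> poly_funs d N"
  shows "\<exists>c. f = (\<lambda>x. \<Sum>\<alpha>\<in>multi_indices (d + 1) N. c \<alpha> * bary_monomial \<alpha> x)"
proof -
  let ?V = "fun_space.span (bary_monomial ` multi_indices (d + 1) N)"
  have V: "?V = {p. \<exists>c. p = (\<lambda>x. \<Sum>\<alpha>\<in>multi_indices (d + 1) N. c \<alpha> * bary_monomial \<alpha> x)}"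
    by (rule fun_space_span_image) simp
  have "monomial d \<gamma> \<in> ?V" if "\<gamma> \<in> low_indices d (Suc N)" for \<gamma>
  proof -
    obtain k where k: "\<gamma> \<in> multi_indices d k" "k < Suc N"
      using \<open>\<gamma> \<in> low_indices d (Suc N)\<close> by (rule low_indicesE)
    then have k: "\<gamma> \<in> multi_indices d k" "k \<le> N" by auto
    then have nz: "falling N k \<noteq> 0"
      by (simp add: falling_def)
    have "monomial d \<gamma> x = (\<Sum>\<alpha>\<in>multi_indices (d + 1) N.
        (fact N / multi_fact (d + 1) \<alpha> * (\<Prod>i=1..d+1. falling (\<alpha> i) (\<gamma> i)) / falling N k) * bary_monomial \<alpha> x)" for x
    proof -
      have "falling N k * monomial d \<gamma> x = (\<Sum>\<alpha>\<in>multi_indices (d + 1) N.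
          fact N / multi_fact (d + 1) \<alpha> * (\<Prod>i=1..d+1. falling (\<alpha> i) (\<gamma> i)) * bary_monomial \<alpha> x)"
        unfolding multinomial_falling[OF multi_indices_Suc[OF k(1)] k(2)] sum_extend_coords
          monomial_extend_coords[OF k(1)] by simp
      then have "monomial d \<gamma> x = (\<Sum>\<alpha>\<in>multi_indices (d + 1) N.
          fact N / multi_fact (d + 1) \<alpha> * (\<Prod>i=1..d+1. falling (\<alpha> i) (\<gamma> i)) * bary_monomial \<alpha> x) / falling N k"
        using nz by (metis nonzero_mult_div_cancel_left)
      then show ?thesis by (simp only: sum_divide_distrib times_divide_eq_left)
    qed
    then show ?thesis
      unfolding V by (intro CollectI exI[of _ "\<lambda>\<alpha>. fact N / multi_fact (d + 1) \<alpha> *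
          (\<Prod>i=1..d+1. falling (\<alpha> i) (\<gamma> i)) / falling N k"] ext)
  qed
  then have "polys_below d (Suc N) \<subseteq> ?V"
    unfolding polys_below_def by (intro fun_space.span_minimal) auto
  with assms show ?thesis unfolding poly_funs_eq V by auto
qed

text \<open>Resolves the \<open>THE\<close> in \<open>hahn\<close>: existence is the representation
  by barycentric monomials, homogenized, and uniqueness their independence. The identity at points
  with |y| = 1 already determines the coefficients.\<close>

lemma jacobi_poly_hahn:
  assumes \<nu>: "\<nu> \<in> multi_indices d n" and n: "n \<le> N"
  shows "jacobi_poly \<nu> x = (\<Sum>\<alpha>\<in>multi_indices (d + 1) N.
    (fact N / multi_fact (d + 1) \<alpha> * hahn d \<kappa> N \<nu> \<alpha>) * bary_monomial \<alpha> x)"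
proof -
  let ?I = "multi_indices (d + 1) N"
  have mf: "multi_fact (d + 1) \<alpha> > 0" for \<alpha>
    unfolding multi_fact_def by (intro prod_pos) simp
  have "jacobi_poly \<nu> \<in> poly_funs d N"
    using poly_funs_simplex_jacobi[OF \<nu>] poly_funs_mono[OF n] by auto
  then obtain c where c: "jacobi_poly \<nu> = (\<lambda>x. \<Sum>\<alpha>\<in>?I. c \<alpha> * bary_monomial \<alpha> x)"
    using poly_funs_bary_representation by blast
  define h where "h \<alpha> = (if \<alpha> \<in> ?I then c \<alpha> * multi_fact (d + 1) \<alpha> / fact N else 0)" for \<alpha>
  have ch: "c \<alpha> = fact N / multi_fact (d + 1) \<alpha> * h \<alpha>" if "\<alpha> \<in> ?I" for \<alpha>
    using that mf[of \<alpha>] by (simp add: h_def)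
  have "hahn d \<kappa> N \<nu> = h"
    unfolding hahn_def
  proof (rule the_equality, intro conjI allI impI)
    fix y :: "nat \<Rightarrow> real"
    define s where "s = (\<Sum>i=1..d+1. y i)"
    assume "(\<Sum>i=1..d+1. y i) \<noteq> 0"
    then have s: "s \<noteq> 0" by (simp add: s_def)
    have "s ^ N * jacobi_poly \<nu> (\<lambda>i. y i / s) =
        (\<Sum>\<alpha>\<in>?I. c \<alpha> * (s ^ N * bary_monomial \<alpha> (\<lambda>i. y i / s)))"
      unfolding c sum_distrib_left by (intro sum.cong refl) (simp only: mult_ac)
    also have "\<dots> = (\<Sum>\<alpha>\<in>?I. fact N / multi_fact (d + 1) \<alpha> * h \<alpha> * monomial (d + 1) \<alpha> y)"
      by (intro sum.cong refl) (simp only: bary_monomial_normalize[OF s_def s] ch)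
    finally show "(\<Sum>i=1..d+1. y i) ^ N * jacobi_poly \<nu> (\<lambda>i. y i / (\<Sum>i=1..d+1. y i)) =
        (\<Sum>\<alpha>\<in>?I. fact N / multi_fact (d + 1) \<alpha> * h \<alpha> * monomial (d + 1) \<alpha> y)"
      by (simp only: s_def)
  next
    fix \<alpha> assume "\<alpha> \<notin> ?I"
    then show "h \<alpha> = 0" by (simp add: h_def)
  next
    fix h' assume h': "(\<forall>\<alpha>. \<alpha> \<notin> ?I \<longrightarrow> h' \<alpha> = 0) \<and>
        (\<forall>y. (\<Sum>i=1..d+1. y i) \<noteq> 0 \<longrightarrow>
           (\<Sum>i=1..d+1. y i) ^ N * jacobi_poly \<nu> (\<lambda>i. y i / (\<Sum>i=1..d+1. y i)) =
           (\<Sum>\<alpha>\<in>?I. fact N / multi_fact (d + 1) \<alpha> * h' \<alpha> * monomial (d + 1) \<alpha> y))"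
    have "(\<Sum>\<alpha>\<in>?I. (fact N / multi_fact (d + 1) \<alpha> * (h' \<alpha> - h \<alpha>)) * bary_monomial \<alpha> x) = 0" for x
    proof -
      \<comment> \<open>The polynomial reads only the coordinates 1..d, and
        \<open>extend_coords\<close> overwrites only the coordinate d + 1.\<close>
      have "jacobi_poly \<nu> (extend_coords d x) = jacobi_poly \<nu> x"
        unfolding simplex_jacobi_def extend_coords_def
        by (intro prod.cong refl arg_cong2[where f = "jacobi_homogeneous _ _ _"]
            arg_cong2[where f = "(-)"] sum.cong) auto
      then have "jacobi_poly \<nu> x = (\<Sum>\<alpha>\<in>?I. fact N / multi_fact (d + 1) \<alpha> * h' \<alpha> * bary_monomial \<alpha> x)"
        using h'[THEN conjunct2, THEN spec, of "extend_coords d x"] unfolding sum_extend_coords by simp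
      moreover have "jacobi_poly \<nu> x = (\<Sum>\<alpha>\<in>?I. fact N / multi_fact (d + 1) \<alpha> * h \<alpha> * bary_monomial \<alpha> x)"
        unfolding c by (intro sum.cong refl) (simp only: ch)
      ultimately show ?thesis
        by (simp only: right_diff_distrib left_diff_distrib sum_subtractf diff_self)
    qed
    then have "fact N / multi_fact (d + 1) \<alpha> * (h' \<alpha> - h \<alpha>) = 0" if "\<alpha> \<in> ?I" for \<alpha>
      using that by (rule bary_monomials_independent)
    then have "h' \<alpha> = h \<alpha>" if "\<alpha> \<in> ?I" for \<alpha>
      using that mf[of \<alpha>] by fastforce
    moreover have "h' \<alpha> = h \<alpha>" if "\<alpha> \<notin> ?I" for \<alpha>
      using that h' by (simp add: h_def)
    ultimately show "h' = h" by blast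
  qed
  then show ?thesis unfolding c by (intro sum.cong refl) (simp only: ch)
qed

lemma jacobi_int_bary_monomial:
  assumes \<nu>: "\<nu> \<in> multi_indices d n" and n: "n \<le> N" and \<alpha>: "\<alpha> \<in> multi_indices (d + 1) N"
  shows "jacobi_int (\<lambda>x. jacobi_poly \<nu> x * bary_monomial \<alpha> x) =
    durrmeyer_eigenvalue N n * (poch \<alpha> / pochhammer kappa_total N) * hahn d \<kappa> N \<nu> \<alpha>"
proof -
  let ?I = "multi_indices (d + 1) N"
  define Q where "Q \<alpha> = jacobi_int (\<lambda>x. jacobi_poly \<nu> x * bary_monomial \<alpha> x)" for \<alpha>
  have "(\<Sum>\<alpha>\<in>?I. (fact N / multi_fact (d + 1) \<alpha> * (pochhammer kappa_total N / poch \<alpha> * Q \<alpha> -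
      durrmeyer_eigenvalue N n * hahn d \<kappa> N \<nu> \<alpha>)) * bary_monomial \<alpha> x) = 0" for x
  proof -
    have "durrmeyer N (jacobi_poly \<nu>) x = durrmeyer_eigenvalue N n * jacobi_poly \<nu> x"
      using jacobi_poly_in_orth_polys[OF \<nu>] n by (rule durrmeyer_orth_polys)
    then have "(\<Sum>\<alpha>\<in>?I. (fact N / multi_fact (d + 1) \<alpha> * (pochhammer kappa_total N / poch \<alpha>) * Q \<alpha>) * bary_monomial \<alpha> x) =
        (\<Sum>\<alpha>\<in>?I. durrmeyer_eigenvalue N n *
          ((fact N / multi_fact (d + 1) \<alpha> * hahn d \<kappa> N \<nu> \<alpha>) * bary_monomial \<alpha> x))"
      unfolding jacobi_poly_hahn[OF \<nu> n, of x] durrmeyer_def Q_def sum_distrib_left .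
    then have "(\<Sum>\<alpha>\<in>?I. (fact N / multi_fact (d + 1) \<alpha> * (pochhammer kappa_total N / poch \<alpha>) * Q \<alpha>) * bary_monomial \<alpha> x -
        durrmeyer_eigenvalue N n *
          ((fact N / multi_fact (d + 1) \<alpha> * hahn d \<kappa> N \<nu> \<alpha>) * bary_monomial \<alpha> x)) = 0"
      by (simp only: sum_subtractf diff_self)
    then show ?thesis
      by (simp only: right_diff_distrib left_diff_distrib mult_ac)
  qed
  from bary_monomials_independent[OF this \<alpha>]
  have "fact N / multi_fact (d + 1) \<alpha> * (pochhammer kappa_total N / poch \<alpha> * Q \<alpha> -
      durrmeyer_eigenvalue N n * hahn d \<kappa> N \<nu> \<alpha>) = 0" .
  moreover have "multi_fact (d + 1) \<alpha> > 0"
    unfolding multi_fact_def by (intro prod_pos) simp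
  ultimately have "pochhammer kappa_total N / poch \<alpha> * Q \<alpha> = durrmeyer_eigenvalue N n * hahn d \<kappa> N \<nu> \<alpha>"
    by simp
  moreover have "q = e * (p / t) * h" if "t / p * q = e * h" "p > 0" "t > 0" for p q t e h :: real
    using that by (simp add: field_simps)
  ultimately show ?thesis
    using poch_pos[of \<alpha>] pochhammer_pos[OF kappa_total_pos, of N] unfolding Q_def by blast
qed

lemma jacobi_norm2_hahn_norm:
  assumes \<nu>: "\<nu> \<in> multi_indices d n" and n: "n \<le> N"
  shows "jacobi_norm2 \<nu> = durrmeyer_eigenvalue N n * hahn_norm d \<kappa> N \<nu>"
proof -
  let ?I = "multi_indices (d + 1) N"
  have "jacobi_norm2 \<nu> = jacobi_int (\<lambda>x. (\<Sum>\<alpha>\<in>?I.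
      (fact N / multi_fact (d + 1) \<alpha> * hahn d \<kappa> N \<nu> \<alpha>) * bary_monomial \<alpha> x) * jacobi_poly \<nu> x)"
    unfolding jacobi_norm2_def by (simp only: jacobi_poly_hahn[OF \<nu> n, symmetric])
  also have "\<dots> = (\<Sum>\<alpha>\<in>?I. (fact N / multi_fact (d + 1) \<alpha> * hahn d \<kappa> N \<nu> \<alpha>) *
      jacobi_int (\<lambda>x. bary_monomial \<alpha> x * jacobi_poly \<nu> x))"
    using \<nu> by (intro jacobi_int_sum_mult poly_funs_monomial_extend_coords poly_funs_simplex_jacobi)
  also have "\<dots> = (\<Sum>\<alpha>\<in>?I. durrmeyer_eigenvalue N n * (fact N / pochhammer kappa_total N *
      ((hahn d \<kappa> N \<nu> \<alpha>)\<^sup>2 * poch \<alpha> / multi_fact (d + 1) \<alpha>)))"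
    unfolding mult.commute[of "bary_monomial _ _"]
    by (intro sum.cong refl) (simp add: jacobi_int_bary_monomial[OF \<nu> n, simplified] power2_eq_square mult_ac)
  also have "\<dots> = durrmeyer_eigenvalue N n * hahn_norm d \<kappa> N \<nu>"
    by (simp only: hahn_norm_def kappa_total_def sum_distrib_left)
  finally show ?thesis .
qed

lemma R_proj_eq:
  assumes "\<alpha> \<in> multi_indices (d + 1) N"
  shows "R_proj d \<kappa> n \<alpha> x = (\<Sum>\<nu>\<in>multi_indices d n.
    (jacobi_int (\<lambda>x. jacobi_poly \<nu> x * bary_monomial \<alpha> x) / jacobi_norm2 \<nu>) * jacobi_poly \<nu> x)"
  unfolding R_proj_def orth_proj_eq[OF poly_funs_monomial_extend_coords[OF assms]]
  by (simp only: mult.commute[of "bary_monomial _ _"])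

lemma R_proj_hahn:
  assumes n: "n \<le> N" and \<alpha>: "\<alpha> \<in> multi_indices (d + 1) N"
  shows "R_proj d \<kappa> n \<alpha> x = poch \<alpha> / pochhammer kappa_total N *
    (\<Sum>\<nu>\<in>multi_indices d n. hahn d \<kappa> N \<nu> \<alpha> / hahn_norm d \<kappa> N \<nu> * jacobi_poly \<nu> x)"
  unfolding R_proj_eq[OF \<alpha>] sum_distrib_left
proof (intro sum.cong refl)
  fix \<nu> assume \<nu>: "\<nu> \<in> multi_indices d n"
  \<comment> \<open>It is a factor of the nonzero norm of the Jacobi polynomial.\<close>
  have "durrmeyer_eigenvalue N n \<noteq> 0"
    using jacobi_norm2_neq_0[of \<nu>] jacobi_norm2_hahn_norm[OF \<nu> n] by auto
  then show "jacobi_int (\<lambda>x. jacobi_poly \<nu> x * bary_monomial \<alpha> x) / jacobi_norm2 \<nu> * jacobi_poly \<nu> x =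
      poch \<alpha> / pochhammer kappa_total N * (hahn d \<kappa> N \<nu> \<alpha> / hahn_norm d \<kappa> N \<nu> * jacobi_poly \<nu> x)"
    unfolding jacobi_int_bary_monomial[OF \<nu> n \<alpha>] jacobi_norm2_hahn_norm[OF \<nu> n] by simp
qed

text \<open>P_nu is its own projection. Projecting its expansion in the X^alpha term by term, here
  at the level of Fourier coefficients, replaces every X^alpha by its projection.\<close>

lemma jacobi_poly_R_proj:
  assumes n: "n \<le> N" and \<nu>: "\<nu> \<in> multi_indices d n"
  shows "jacobi_poly \<nu> x = (\<Sum>\<alpha>\<in>multi_indices (d + 1) N.
    fact N / multi_fact (d + 1) \<alpha> * hahn d \<kappa> N \<nu> \<alpha> * R_proj d \<kappa> n \<alpha> x)"
proof -
  let ?I = "multi_indices (d + 1) N"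
  define w where "w \<alpha> = fact N / multi_fact (d + 1) \<alpha> * hahn d \<kappa> N \<nu> \<alpha>" for \<alpha>
  have inner: "jacobi_int (\<lambda>x. jacobi_poly \<nu> x * jacobi_poly \<mu> x) =
      (\<Sum>\<alpha>\<in>?I. w \<alpha> * jacobi_int (\<lambda>x. jacobi_poly \<mu> x * bary_monomial \<alpha> x))"
    if "\<mu> \<in> multi_indices d n" for \<mu>
  proof -
    have "jacobi_int (\<lambda>x. jacobi_poly \<nu> x * jacobi_poly \<mu> x) =
        jacobi_int (\<lambda>x. (\<Sum>\<alpha>\<in>?I. w \<alpha> * bary_monomial \<alpha> x) * jacobi_poly \<mu> x)"
      by (simp only: jacobi_poly_hahn[OF \<nu> n] w_def)
    also have "\<dots> = (\<Sum>\<alpha>\<in>?I. w \<alpha> * jacobi_int (\<lambda>x. bary_monomial \<alpha> x * jacobi_poly \<mu> x))"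
      using that by (intro jacobi_int_sum_mult poly_funs_monomial_extend_coords poly_funs_simplex_jacobi)
    finally show ?thesis by (simp only: mult.commute[of "bary_monomial _ _"])
  qed
  have "jacobi_poly \<nu> x = (\<Sum>\<mu>\<in>multi_indices d n.
      (jacobi_int (\<lambda>x. jacobi_poly \<nu> x * jacobi_poly \<mu> x) / jacobi_norm2 \<mu>) * jacobi_poly \<mu> x)"
    by (rule fun_cong[OF orth_polys_expansion[OF jacobi_poly_in_orth_polys[OF \<nu>]]])
  also have "\<dots> = (\<Sum>\<mu>\<in>multi_indices d n. \<Sum>\<alpha>\<in>?I. w \<alpha> *
      ((jacobi_int (\<lambda>x. jacobi_poly \<mu> x * bary_monomial \<alpha> x) / jacobi_norm2 \<mu>) * jacobi_poly \<mu> x))"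
  proof (intro sum.cong refl)
    fix \<mu> assume "\<mu> \<in> multi_indices d n"
    then show "jacobi_int (\<lambda>x. jacobi_poly \<nu> x * jacobi_poly \<mu> x) / jacobi_norm2 \<mu> * jacobi_poly \<mu> x =
        (\<Sum>\<alpha>\<in>?I. w \<alpha> * ((jacobi_int (\<lambda>x. jacobi_poly \<mu> x * bary_monomial \<alpha> x) / jacobi_norm2 \<mu>) *
          jacobi_poly \<mu> x))"
      by (simp only: inner sum_divide_distrib sum_distrib_right mult.assoc times_divide_eq_right)
        (simp add: mult_ac)
  qed
  also have "\<dots> = (\<Sum>\<alpha>\<in>?I. w \<alpha> * R_proj d \<kappa> n \<alpha> x)"
    by (subst sum.swap) (simp add: R_proj_eq[simplified] sum_distrib_left)
  finally show ?thesis by (simp only: w_def)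
qed

end

theorem corollary3p8:
  fixes d n N :: nat and \<kappa> :: "nat \<Rightarrow> real"
  assumes "d \<ge> 1"
    and "\<forall>i\<in>{1..d+1}. \<kappa> i > -1"
    and "n \<le> N"
  shows "(\<forall>\<alpha>\<in>multi_indices (d + 1) N. \<forall>x.
            R_proj d \<kappa> n \<alpha> x =
              multi_pochhammer (d + 1) (\<lambda>i. \<kappa> i + 1) \<alpha> /
              pochhammer ((\<Sum>i=1..d+1. \<kappa> i) + real d + 1) N *
              (\<Sum>\<nu>\<in>multi_indices d n.
                 hahn d \<kappa> N \<nu> \<alpha> / hahn_norm d \<kappa> N \<nu> * simplex_jacobi d \<kappa> \<nu> x)) \<and>
         (\<forall>\<nu>\<in>multi_indices d n. \<forall>x.
            simplex_jacobi d \<kappa> \<nu> x =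
              (\<Sum>\<alpha>\<in>multi_indices (d + 1) N.
                 fact N / multi_fact (d + 1) \<alpha> * hahn d \<kappa> N \<nu> \<alpha> * R_proj d \<kappa> n \<alpha> x))"
proof -
  interpret jacobi_weight d \<kappa>
    using assms(2) by unfold_locales blast
  from R_proj_hahn[OF assms(3)] jacobi_poly_R_proj[OF assms(3)] show ?thesis
    unfolding kappa_total_def by blast
qed

end
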